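(* Let $\mathbb{I}$ be a $\mathfrak{D}$-saturated idealistic filtration over $R$. The invariant $$\sigma:\mathfrak{m}\text{-}\operatorname{Spec}R\to\prod_{e\in\mathbb{Z}_{\ge0}}\mathbb{Z}_{\ge0}$$ is upper semi-continuous, where the target carries the lexicographical order; that is, for every $t\in\prod_{e\in\mathbb{Z}_{\ge0}}\mathbb{Z}_{\ge0}$ the set $\{P\in\mathfrak{m}\text{-}\operatorname{Spec}R: \sigma(P)\ge t\}$ is closed.
   Context: Standing setting: $k$ is an algebraically closed field of characteristic $p>0$ or of characteristic $0$; in characteristic $0$ one formally sets $p=\infty$ with $p^0=1$, and only the exponent $e=0$ is considered wherever $p^e$ occurs. $W$ is a nonsingular variety over $k$ of dimension $d$, and $R$ is the coordinate ring of an affine open subset $\operatorname{Spec}R\subset W$. $\mathfrak{m}\text{-}\operatorname{Spec}R$ is the set of closed points (maximal ideals) of $R$ with the Zariski topology. For a closed point $P$, $R_P$ is the local ring and $\mathfrak{m}_P$ its maximal ideal. Idealistic filtrations. An idealistic filtration over a ring $A$ is a subset $\mathbb{I}\subset A\times\mathbb{R}$ such that, writing $\mathbb{I}_a=\{f\in A: (f,a)\in\mathbb{I}\}$: each $\mathbb{I}_a$ is an ideal of $A$, with $\mathbb{I}_a=A$ for $a\le 0$; $(f,a),(g,b)\in\mathbb{I}$ implies $(fg,a+b)\in\mathbb{I}$; and $(f,a)\in\mathbb{I}$, $b\le a$ implies $(f,b)\in\mathbb{I}$. $\mathbb{I}$ over $R$ is $\mathfrak{D}$-saturated if $(f,a)\in\mathbb{I}$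 and $D$ a $k$-linear (Grothendieck) differential operator on $R$ of degree $\le t$ imply $(D(f),a-t)\in\mathbb{I}$. The localization $\mathbb{I}_P$ over $R_P$ is given by $(\mathbb{I}_P)_a=\mathbb{I}_aR_P$. Leading algebra and $\sigma$. For a closed point $P$ put $G_P=\bigoplus_{n\ge0}\mathfrak{m}_P^n/\mathfrak{m}_P^{n+1}$, $L(\mathbb{I}_P)_n=\{f\bmod\mathfrak{m}_P^{n+1}: (f,n)\in\mathbb{I}_P, f\in\mathfrak{m}_P^n\}$, and $L(\mathbb{I}_P)^{\mathrm{pure}}_{p^e}=L(\mathbb{I}_P)_{p^e}\cap\{v^{p^e}: v\in\mathfrak{m}_P/\mathfrak{m}_P^2\}$. The invariant $\sigma(P)$ is the sequence $(d-\dim_kL(\mathbb{I}_P)^{\mathrm{pure}}_{p^e})_{e\in\mathbb{Z}_{\ge0}}$ (in characteristic $0$ it consists only of the term $e=0$). *)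

theory Defs
  imports
    "HOL-Algebra.Algebraic_Closure_Type"
    "HOL-Algebra.Embedded_Algebras"
    "HOL-Algebra.Ideal_Product"
    "HOL-Algebra.Generated_Rings"
    "HOL-Analysis.Abstract_Topology"
    "HOL-Computational_Algebra.Fraction_Field"
    "HOL-Library.Extended_Nat"
    "HOL-Library.Fun_Lexorder"
begin

text \<open>
  Rings are type classes wherever possible: the ground field is a type \<open>'k\<close>, the coordinate
  ring is a type \<open>'a\<close>, and the \<open>k\<close>-algebra structure is the structure map \<open>\<iota>\<close> from \<open>'k\<close> to \<open>'a\<close>.
  Since \<open>'a\<close> is a domain, its localizations are subrings of the type \<open>'a fract\<close>.
  The record \<^const>\<open>ring_of_type_algebra\<close> gives access to the ideals and quotients of HOL-Algebra.
\<close>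

abbreviation type_ring :: "'a :: comm_ring_1 ring"
  where "type_ring \<equiv> ring_of_type_algebra"

subsection \<open>The maximal spectrum\<close>

definition max_spec :: "('a, 'm) ring_scheme \<Rightarrow> 'a set set"
  where "max_spec A = {P. maximalideal P A}"

definition zariski_max_spec :: "('a, 'm) ring_scheme \<Rightarrow> 'a set topology"
  where "zariski_max_spec A =
    topology (\<lambda>U. \<exists>S \<subseteq> carrier A. U = {P \<in> max_spec A. \<not> S \<subseteq> P})"

lemma (in cring) istopology_max_spec:
  "istopology (\<lambda>U. \<exists>S \<subseteq> carrier R. U = {P \<in> max_spec R. \<not> S \<subseteq> P})"
  unfolding istopology_def
proof (intro conjI allI impI)
  fix U V
  assume "\<exists>S \<subseteq> carrier R. U = {P \<in> max_spec R. \<not> S \<subseteq> P}"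
    and "\<exists>S \<subseteq> carrier R. V = {P \<in> max_spec R. \<not> S \<subseteq> P}"
  then obtain S T where S: "S \<subseteq> carrier R" "U = {P \<in> max_spec R. \<not> S \<subseteq> P}"
    and T: "T \<subseteq> carrier R" "V = {P \<in> max_spec R. \<not> T \<subseteq> P}" by blast
  define ST where "ST = {s \<otimes> t | s t. s \<in> S \<and> t \<in> T}"
  have sub: "ST \<subseteq> carrier R" using S(1) T(1) by (auto simp: ST_def)
  have "(\<not> ST \<subseteq> P) = (\<not> S \<subseteq> P \<and> \<not> T \<subseteq> P)" if "P \<in> max_spec R" for P
  proof -
    interpret maximalideal P R using that by (simp add: max_spec_def)
    interpret prime: primeideal P R by (rule maximalideal_prime[OF is_maximalideal])
    show ?thesis
    proof
      assume "\<not> ST \<subseteq> P"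
      then obtain s t where st: "s \<in> S" "t \<in> T" "s \<otimes> t \<notin> P" by (auto simp: ST_def)
      then have "s \<notin> P" "t \<notin> P" using S(1) T(1) I_l_closed I_r_closed by blast+
      with st show "\<not> S \<subseteq> P \<and> \<not> T \<subseteq> P" by blast
    next
      assume "\<not> S \<subseteq> P \<and> \<not> T \<subseteq> P"
      then obtain s t where st: "s \<in> S" "t \<in> T" "s \<notin> P" "t \<notin> P" by blast
      then have "s \<otimes> t \<notin> P" using prime.I_prime S(1) T(1) by blast
      with st show "\<not> ST \<subseteq> P" by (auto simp: ST_def)
    qed
  qed
  then have "U \<inter> V = {P \<in> max_spec R. \<not> ST \<subseteq> P}" using S T by blast
  with sub show "\<exists>S \<subseteq> carrier R. U \<inter> V = {P \<in> max_spec R. \<not> S \<subseteq> P}" by blast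
next
  fix \<U>
  assume "\<forall>U\<in>\<U>. \<exists>S \<subseteq> carrier R. U = {P \<in> max_spec R. \<not> S \<subseteq> P}"
  then obtain f where f: "\<And>U. U \<in> \<U> \<Longrightarrow> f U \<subseteq> carrier R \<and> U = {P \<in> max_spec R. \<not> f U \<subseteq> P}"
    by metis
  have "\<Union>\<U> = {P \<in> max_spec R. \<not> \<Union>(f ` \<U>) \<subseteq> P}"
    using f by blast
  moreover have "\<Union>(f ` \<U>) \<subseteq> carrier R" using f by blast
  ultimately show "\<exists>S \<subseteq> carrier R. \<Union>\<U> = {P \<in> max_spec R. \<not> S \<subseteq> P}" by blast
qed

lemma (in cring) openin_zariski_max_spec:
  "openin (zariski_max_spec R) U \<longleftrightarrow>
     (\<exists>S \<subseteq> carrier R. U = {P \<in> max_spec R. \<not> S \<subseteq> P})"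
  unfolding zariski_max_spec_def by (simp add: topology_inverse'[OF istopology_max_spec])

lemma (in cring) topspace_zariski_max_spec: "topspace (zariski_max_spec R) = max_spec R"
proof -
  have "\<not> carrier R \<subseteq> P" if "P \<in> max_spec R" for P
    using that by (metis max_spec_def mem_Collect_eq maximalideal.I_notcarr
        maximalideal.axioms(1) ideal.Icarr subsetI subset_antisym)
  then have "openin (zariski_max_spec R) (max_spec R)"
    unfolding openin_zariski_max_spec by (intro exI[of _ "carrier R"]) auto
  moreover have "U \<subseteq> max_spec R" if "openin (zariski_max_spec R) U" for U
    using that unfolding openin_zariski_max_spec by blast
  ultimately show ?thesis
    by (meson openin_subset openin_topspace subset_antisym)
qed

lemma (in cring) closedin_zariski_max_spec:
  "closedin (zariski_max_spec R) C \<longleftrightarrow>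
     (\<exists>S \<subseteq> carrier R. C = {P \<in> max_spec R. S \<subseteq> P})"
proof
  assume "closedin (zariski_max_spec R) C"
  then obtain S where "C \<subseteq> max_spec R" "S \<subseteq> carrier R" "max_spec R - C = {P \<in> max_spec R. \<not> S \<subseteq> P}"
    unfolding closedin_def topspace_zariski_max_spec openin_zariski_max_spec by blast
  then have "C = {P \<in> max_spec R. S \<subseteq> P}" by blast
  with \<open>S \<subseteq> carrier R\<close> show "\<exists>S \<subseteq> carrier R. C = {P \<in> max_spec R. S \<subseteq> P}" by blast
next
  assume "\<exists>S \<subseteq> carrier R. C = {P \<in> max_spec R. S \<subseteq> P}"
  then obtain S where S: "S \<subseteq> carrier R" "C = {P \<in> max_spec R. S \<subseteq> P}" by blast
  then have "max_spec R - C = {P \<in> max_spec R. \<not> S \<subseteq> P}" by blast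
  with S show "closedin (zariski_max_spec R) C"
    unfolding closedin_def topspace_zariski_max_spec openin_zariski_max_spec by blast
qed

subsection \<open>Local rings of a domain\<close>

text \<open>For a prime ideal \<open>P\<close>, the denominators below are automatically nonzero.\<close>

definition local_ring :: "'a :: idom set \<Rightarrow> 'a fract ring"
  where "local_ring P = type_ring\<lparr>carrier := {Fract a b | a b. b \<notin> P}\<rparr>"

definition local_max :: "'a :: idom set \<Rightarrow> 'a fract set"
  where "local_max P = {Fract a b | a b. a \<in> P \<and> b \<notin> P}"

subsection \<open>Nonsingular affine varieties\<close>

definition krull_dim :: "('a, 'm) ring_scheme \<Rightarrow> enat"
  where "krull_dim A = Sup {enat n | n. \<exists>\<pp>. (\<forall>i\<le>n. primeideal (\<pp> i) A) \<and>
    (\<forall>i<n. \<pp> i \<subset> \<pp> (Suc i))}"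

text \<open>
  For a Noetherian local ring \<open>A\<close> with maximal ideal \<open>\<mm>\<close>: \<open>A\<close> is regular
  iff \<open>\<mm>\<close> is generated by \<open>dim A\<close> elements.
\<close>

definition regular_local :: "('a, 'm) ring_scheme \<Rightarrow> 'a set \<Rightarrow> bool"
  where "regular_local A \<mm> \<longleftrightarrow>
    (\<exists>S. finite S \<and> S \<subseteq> carrier A \<and> enat (card S) = krull_dim A \<and> Idl\<^bsub>A\<^esub> S = \<mm>)"

text \<open>
  The following says that \<open>'a\<close>, with structure map \<open>\<iota>\<close>, is the coordinate ring of a nonsingular affine
  variety of dimension \<open>d\<close> over \<open>'k\<close>.  Such rings are exactly the coordinate rings of the nonempty
  affine open subsets of nonsingular varieties of dimension \<open>d\<close>.
\<close>

locale nonsingular_affine_variety =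
  fixes \<iota> :: "'k :: alg_closed_field \<Rightarrow> 'a :: idom" and d :: nat
  assumes structure_map: "\<iota> \<in> ring_hom type_ring type_ring"
    and finite_type: "\<exists>S. finite S \<and> generate_ring type_ring (range \<iota> \<union> S) = UNIV"
    and dimension: "krull_dim (type_ring :: 'a ring) = enat d"
    and nonsingular: "\<And>P :: 'a set. primeideal P type_ring \<Longrightarrow>
      regular_local (local_ring P) (local_max P)"

subsection \<open>Differential operators\<close>

definition k_linear :: "('k \<Rightarrow> 'a) \<Rightarrow> ('a :: comm_ring_1 \<Rightarrow> 'a) \<Rightarrow> bool"
  where "k_linear \<iota> D \<longleftrightarrow>
    (\<forall>x y. D (x + y) = D x + D y) \<and> (\<forall>c x. D (\<iota> c * x) = \<iota> c * D x)"

text \<open>\<open>k\<close>-linear Grothendieck differential operators of degree at most \<open>t\<close>, via commutators.\<close>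

primrec diff_op :: "('k \<Rightarrow> 'a) \<Rightarrow> nat \<Rightarrow> ('a :: comm_ring_1 \<Rightarrow> 'a) \<Rightarrow> bool"
  where
    "diff_op \<iota> 0 D \<longleftrightarrow> k_linear \<iota> D \<and> (\<forall>a x. D (a * x) - a * D x = 0)"
  | "diff_op \<iota> (Suc t) D \<longleftrightarrow> k_linear \<iota> D \<and> (\<forall>a. diff_op \<iota> t (\<lambda>x. D (a * x) - a * D x))"

subsection \<open>Idealistic filtrations\<close>

definition level :: "('a \<times> real) set \<Rightarrow> real \<Rightarrow> 'a set"
  where "level \<I> a = {f. (f, a) \<in> \<I>}"

definition idealistic_filtration :: "('a, 'm) ring_scheme \<Rightarrow> ('a \<times> real) set \<Rightarrow> bool"
  where "idealistic_filtration A \<I> \<longleftrightarrow>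
    \<I> \<subseteq> carrier A \<times> UNIV \<and>
    (\<forall>a. ideal (level \<I> a) A) \<and>
    (\<forall>a\<le>0. level \<I> a = carrier A) \<and>
    (\<forall>f a g b. (f, a) \<in> \<I> \<longrightarrow> (g, b) \<in> \<I> \<longrightarrow> (f \<otimes>\<^bsub>A\<^esub> g, a + b) \<in> \<I>) \<and>
    (\<forall>f a b. (f, a) \<in> \<I> \<longrightarrow> b \<le> a \<longrightarrow> (f, b) \<in> \<I>)"

definition D_saturated :: "('k \<Rightarrow> 'a) \<Rightarrow> ('a :: comm_ring_1 \<times> real) set \<Rightarrow> bool"
  where "D_saturated \<iota> \<I> \<longleftrightarrow>
    (\<forall>f a t D. (f, a) \<in> \<I> \<longrightarrow> diff_op \<iota> t D \<longrightarrow> (D f, a - real t) \<in> \<I>)"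

definition localization :: "('a :: idom \<times> real) set \<Rightarrow> 'a set \<Rightarrow> ('a fract \<times> real) set"
  where "localization \<I> P = {(g, a). g \<in> Idl\<^bsub>local_ring P\<^esub> ((\<lambda>f. Fract f 1) ` level \<I> a)}"

subsection \<open>The leading algebra and the invariant \<open>\<sigma>\<close>\<close>

definition ideal_pow :: "('a, 'm) ring_scheme \<Rightarrow> 'a set \<Rightarrow> nat \<Rightarrow> 'a set"
  where "ideal_pow A J n = (ideal_prod A J ^^ n) (carrier A)"

text \<open>
  The graded piece \<open>\<mm>\<^sup>n / \<mm>\<^sup>n\<^sup>+\<^sup>1\<close> is regarded as a subset of the quotient ring \<open>A / \<mm>\<^sup>n\<^sup>+\<^sup>1\<close>;
  this is the class of \<open>f\<close> there.
\<close>

definition graded_class :: "('a, 'm) ring_scheme \<Rightarrow> 'a set \<Rightarrow> nat \<Rightarrow> 'a \<Rightarrow> 'a set"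
  where "graded_class A \<mm> n f = ideal_pow A \<mm> (Suc n) +>\<^bsub>A\<^esub> f"

definition leading_part ::
    "('a, 'm) ring_scheme \<Rightarrow> 'a set \<Rightarrow> ('a \<times> real) set \<Rightarrow> nat \<Rightarrow> 'a set set"
  where "leading_part A \<mm> \<J> n =
    graded_class A \<mm> n ` {f \<in> ideal_pow A \<mm> n. (f, real n) \<in> \<J>}"

text \<open>
  By definition of the product of the graded ring, the \<open>n\<close>-th power of the class of \<open>x \<in> \<mm>\<close>
  in \<open>\<mm> / \<mm>\<^sup>2\<close> is the class of \<open>x\<^sup>n\<close> in \<open>\<mm>\<^sup>n / \<mm>\<^sup>n\<^sup>+\<^sup>1\<close>.
\<close>

definition pure_part ::
    "('a, 'm) ring_scheme \<Rightarrow> 'a set \<Rightarrow> ('a \<times> real) set \<Rightarrow> nat \<Rightarrow> 'a set set"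
  where "pure_part A \<mm> \<J> n =
    leading_part A \<mm> \<J> n \<inter> (\<lambda>x. graded_class A \<mm> n (x [^]\<^bsub>A\<^esub> n)) ` \<mm>"

text \<open>
  The dimension of \<open>L(\<I>\<^sub>P)\<^sup>p\<^sup>u\<^sup>r\<^sup>e\<close> in degree \<open>n\<close> over the image of the ground field in
  \<open>R\<^sub>P / \<mm>\<^sup>n\<^sup>+\<^sup>1\<close>.
\<close>

definition pure_dim :: "('k \<Rightarrow> 'a) \<Rightarrow> ('a :: idom \<times> real) set \<Rightarrow> 'a set \<Rightarrow> nat \<Rightarrow> nat"
  where "pure_dim \<iota> \<I> P n =
    (let A = local_ring P; \<mm> = local_max P; Q = ideal_pow A \<mm> (Suc n) in
       ring.dim (A Quot Q) (range (\<lambda>c. Q +>\<^bsub>A\<^esub> Fract (\<iota> c) 1))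
         (pure_part A \<mm> (localization \<I> P) n))"

text \<open>
  The exponents \<open>e\<close> for which \<open>p\<^sup>e\<close> is considered.  In characteristic \<open>0\<close>, where
  \<open>CHAR('k) = 0\<close>, only \<open>e = 0\<close> occurs, and \<open>CHAR('k) ^ 0 = 1\<close> is the conventional value of \<open>p\<^sup>0\<close>.
\<close>

definition exponents :: "'k :: semiring_1 itself \<Rightarrow> nat set"
  where "exponents _ = (if CHAR('k) = 0 then {0} else UNIV)"

text \<open>
  A sequence indexed by the exponents is an extensional function on \<^const>\<open>exponents\<close>, so that
  in characteristic \<open>0\<close> it has the single term \<open>e = 0\<close>.  The subtraction of natural numbers is never
  truncated on nonsingular varieties of dimension \<open>d\<close>: the pure part is the image, under the power map
  \<open>v \<mapsto> v\<^sup>p\<^sup>^\<^sup>e\<close>, of a subspace of the \<open>d\<close>-dimensional space \<open>\<mm> / \<mm>\<^sup>2\<close>.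
\<close>

definition sigma ::
    "('k :: alg_closed_field \<Rightarrow> 'a) \<Rightarrow> nat \<Rightarrow> ('a :: idom \<times> real) set \<Rightarrow> 'a set \<Rightarrow> nat \<Rightarrow> nat"
  where "sigma \<iota> d \<I> P =
    restrict (\<lambda>e. d - pure_dim \<iota> \<I> P (CHAR('k) ^ e)) (exponents TYPE('k))"

definition lex_le :: "(nat \<Rightarrow> nat) \<Rightarrow> (nat \<Rightarrow> nat) \<Rightarrow> bool"
  where "lex_le s t \<longleftrightarrow> s = t \<or> less_fun s t"

end

theory Submission
  imports Defs "Jordan_Normal_Form.Determinant"
begin

text \<open>
  At a closed point \<open>P\<close> of the support, saturation puts \<open>\<I>\<^sub>n\<close> into \<open>P\<^sup>n\<close>, so that the leading algebra is a
  graded subalgebra \<open>L\<close> of the polynomial ring \<open>gr\<^sub>P R\<close> which is stable under the divided power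
  derivatives.  In coordinates adapted to the flag of spaces \<open>{v. v\<^sup>p\<^sup>^\<^sup>e \<in> L}\<close>, stability forces \<open>L\<close> to
  be spanned by monomials in the powers \<open>x\<^sub>i ^ p ^ e\<^sub>i\<close> that it contains.  Hence, once the entries of
  \<open>\<sigma>\<close> below \<open>e\<close> are fixed, the \<open>e\<close>-th entry is determined by the dimension of \<open>L\<close> in degree \<open>p ^ e\<close>,
  decreasing in it, and this dimension is lower semicontinuous, being the rank of a matrix of
  functions \<open>D h\<close> with \<open>D\<close> a differential operator of order \<open>p ^ e\<close> and \<open>h \<in> \<I>\<close>.

  The differential operators come from Hasse--Schmidt derivations \<open>R \<rightarrow> R[[X]]\<close> integrating a tangent
  vector, found by Newton iteration from equations \<open>w = q(x, w)\<close> for the generators of \<open>R\<close> over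
  parameters \<open>x\<close>.  The iteration respects all relations of \<open>R\<close>: otherwise the algebra generated by the
  solution would have a chain of primes longer than the number of parameters, whereas a chain of \<open>s\<close>
  primes provides \<open>s\<close> independent derivations.
\<close>

text \<open>Regularity enters only as a bound on the number of generators of a maximal ideal, so no
  etale coordinates are at hand; two counts of derivations replace them. If the Newton solution
  violated a relation, the subalgebra B of \<open>'a fps\<close> that it generates would have a
  nonzero kernel under X = 0, and the zero ideal together with the preimages of \<open>d\<close> + 1
  nested primes of \<open>'a\<close> would be \<open>d\<close> + 2 nested primes of B. But a
  derivation of B is determined by its values on \<open>d\<close> parameters, because the Jacobian
  of w = q(x, w) is invertible up to a nonzero factor. Divided powers instead of iterated
  derivatives are forced by characteristic p: the m-th one multiplies x^n by the binomial
  coefficient of n over m and lowers the exponent by m. For 0 < m < n all these coefficients vanish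
  in \<open>'k\<close> exactly when n is a power of p, so only the powers x^(p^j) escape reduction
  to lower degree, and these are what the pure parts record. Off the support every pure part comes
  from the whole cotangent space and sigma is identically zero, so the argument concerns points of
  the support only.\<close>

section \<open>Linear algebra\<close>

lemma nontrivial_linear_relation:
  fixes v :: "'i \<Rightarrow> 'j \<Rightarrow> 'f :: Fields.field"
  assumes "finite J" "finite I" "card J < card I"
  shows "\<exists>l. (\<exists>i\<in>I. l i \<noteq> 0) \<and> (\<forall>j\<in>J. (\<Sum>i\<in>I. l i * v i j) = 0)"
  using assms
proof (induction J arbitrary: I v rule: finite_induct)
  case empty
  then have "I \<noteq> {}" by auto
  then show ?case by (intro exI[of _ "\<lambda>_. 1"]) auto
next
  case (insert j J)
  show ?case
  proof (cases "\<exists>i\<in>I. v i j \<noteq> 0")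
    case False
    have "card J < card I" using insert by simp
    from insert.IH[OF insert.prems(1) this, of v] obtain l where
      "\<exists>i\<in>I. l i \<noteq> 0" "\<forall>j\<in>J. (\<Sum>i\<in>I. l i * v i j) = 0" by blast
    with False show ?thesis by (intro exI[of _ l]) auto
  next
    case True
    then obtain i0 where i0: "i0 \<in> I" "v i0 j \<noteq> 0" by blast
    \<comment> \<open>Subtracting multiples of the pivot vector \<open>v i0\<close> clears
      coordinate \<open>j\<close>, so the induction hypothesis applies to the remaining
      vectors.\<close>
    define u where "u i j' = v i j' - v i j / v i0 j * v i0 j'" for i j'
    have "card J < card (I - {i0})" using insert i0 by simp
    from insert.IH[OF _ this, of u] insert.prems(1) obtain l where
      l: "\<exists>i\<in>I - {i0}. l i \<noteq> 0" "\<And>j'. j' \<in> J \<Longrightarrow> (\<Sum>i\<in>I - {i0}. l i * u i j') = 0" by auto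
    define l' where "l' i = (if i = i0 then - (\<Sum>i\<in>I - {i0}. l i * v i j) / v i0 j else l i)" for i
    have split: "(\<Sum>i\<in>I. l' i * v i j') = (\<Sum>i\<in>I - {i0}. l i * v i j')
        - (\<Sum>i\<in>I - {i0}. l i * v i j) / v i0 j * v i0 j'" for j'
    proof -
      have "(\<Sum>i\<in>I. l' i * v i j') = l' i0 * v i0 j' + (\<Sum>i\<in>I - {i0}. l' i * v i j')"
        using insert.prems(1) i0(1) by (rule sum.remove)
      also have "(\<Sum>i\<in>I - {i0}. l' i * v i j') = (\<Sum>i\<in>I - {i0}. l i * v i j')"
        by (rule sum.cong) (auto simp: l'_def)
      finally show ?thesis by (simp add: l'_def)
    qed
    have "(\<Sum>i\<in>I. l' i * v i j') = 0" if "j' \<in> J" for j'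
    proof -
      have "(\<Sum>i\<in>I. l' i * v i j') = (\<Sum>i\<in>I - {i0}. l i * u i j')"
        unfolding split u_def
        by (simp add: sum_distrib_left sum_distrib_right sum_divide_distrib sum_subtractf algebra_simps)
      with l(2) that show ?thesis by simp
    qed
    moreover have "(\<Sum>i\<in>I. l' i * v i j) = 0"
      unfolding split using i0(2) by simp
    moreover have "\<exists>i\<in>I. l' i \<noteq> 0" using l(1) by (auto simp: l'_def)
    ultimately show ?thesis by blast
  qed
qed

text \<open>Entries are functions, so that applying a homomorphism or an evaluation to a matrix is
  plain composition. Used for Jacobians and for the rank argument.\<close>

definition fun_det :: "nat \<Rightarrow> (nat \<Rightarrow> nat \<Rightarrow> 'r :: comm_ring_1) \<Rightarrow> 'r"
  where "fun_det m M = det (mat m m (\<lambda>(i, j). M i j))"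

text \<open>Over a ring without division a linear system can only be solved up to the factor
  \<open>fun_det m M\<close>; the adjugate does this from either side.\<close>

lemma fun_det_adjugate:
  fixes M :: "nat \<Rightarrow> nat \<Rightarrow> 'r :: comm_ring_1"
  shows "\<exists>N. (\<forall>i<m. \<forall>j<m. (\<Sum>l<m. M i l * N l j) = (if i = j then fun_det m M else 0)) \<and>
             (\<forall>i<m. \<forall>j<m. (\<Sum>l<m. N i l * M l j) = (if i = j then fun_det m M else 0))"
proof -
  define A where "A = mat m m (\<lambda>(i, j). M i j)"
  have A: "A \<in> carrier_mat m m" by (simp add: A_def)
  define N where "N i j = adj_mat A $$ (i, j)" for i j
  note adj = adj_mat[OF A]
  have "(\<Sum>l<m. M i l * N l j) = (A * adj_mat A) $$ (i, j)" if "i < m" "j < m" for i j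
    using that adj(1) A by (auto simp: scalar_prod_def N_def A_def lessThan_atLeast0 intro!: sum.cong)
  moreover have "(\<Sum>l<m. N i l * M l j) = (adj_mat A * A) $$ (i, j)" if "i < m" "j < m" for i j
    using that adj(1) A by (auto simp: scalar_prod_def N_def A_def lessThan_atLeast0 intro!: sum.cong)
  ultimately show ?thesis
    unfolding adj fun_det_def A_def[symmetric] by (intro exI[of _ N]) auto
qed

lemma fun_det_hom:
  fixes h :: "'r :: comm_ring_1 \<Rightarrow> 's :: comm_ring_1"
  assumes "\<And>a b. h (a + b) = h a + h b" "\<And>a b. h (a * b) = h a * h b" "h 1 = 1"
  shows "h (fun_det m M) = fun_det m (\<lambda>i j. h (M i j))"
proof -
  have "h 0 = 0" using assms(1)[of 0 0] by simp
  then interpret h: comm_ring_hom h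
    by unfold_locales (use assms in auto)
  have "map_mat h (mat m m (\<lambda>(i, j). M i j)) = mat m m (\<lambda>(i, j). h (M i j))" by auto
  then show ?thesis unfolding fun_det_def by (metis h.hom_det)
qed

lemma fun_det_one:
  assumes "\<And>i j. i < m \<Longrightarrow> j < m \<Longrightarrow> M i j = (if i = j then 1 else 0)"
  shows "fun_det m M = 1"
proof -
  have "mat m m (\<lambda>(i, j). M i j) = 1\<^sub>m m" using assms by (intro eq_matI) auto
  then show ?thesis by (simp add: fun_det_def)
qed

section \<open>Subalgebras and adjunction of elements\<close>

definition polys_over :: "'r :: comm_ring_1 set \<Rightarrow> 'r poly set"
  where "polys_over A = {p. \<forall>i. coeff p i \<in> A}"

definition adjoin :: "'r :: comm_ring_1 set \<Rightarrow> 'r \<Rightarrow> 'r set"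
  where "adjoin A y = (\<lambda>p. poly p y) ` polys_over A"

text \<open>Primes of a subring given as a set: the chain argument needs primes of subalgebras of a
  field, for which there is no type.\<close>

definition prime_in :: "'r :: comm_ring_1 set \<Rightarrow> 'r set \<Rightarrow> bool"
  where "prime_in B P \<longleftrightarrow> P \<subseteq> B \<and> 0 \<in> P \<and> 1 \<notin> P \<and> (\<forall>x\<in>P. \<forall>y\<in>P. x + y \<in> P) \<and>
    (\<forall>b\<in>B. \<forall>x\<in>P. b * x \<in> P) \<and> (\<forall>x\<in>B. \<forall>y\<in>B. x * y \<in> P \<longrightarrow> x \<in> P \<or> y \<in> P)"

locale algebra_map =
  fixes \<kappa> :: "'k :: Fields.field \<Rightarrow> 'r :: comm_ring_1"
  assumes map_add: "\<kappa> (a + b) = \<kappa> a + \<kappa> b"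
    and map_mult: "\<kappa> (a * b) = \<kappa> a * \<kappa> b"
    and map_one [simp]: "\<kappa> 1 = 1"
begin

lemma map_zero [simp]: "\<kappa> 0 = 0"
  using map_add[of 0 0] by simp

lemma map_minus: "\<kappa> (- a) = - \<kappa> a"
  using map_add[of a "- a"] by (simp add: eq_neg_iff_add_eq_0 add.commute)

lemma map_diff: "\<kappa> (a - b) = \<kappa> a - \<kappa> b"
  using map_add[of a "- b"] by (simp add: map_minus)

lemma map_sum: "\<kappa> (sum f S) = (\<Sum>s\<in>S. \<kappa> (f s))"
  by (induction S rule: infinite_finite_induct) (auto simp: map_add)

lemma map_power: "\<kappa> (a ^ n) = \<kappa> a ^ n"
  by (induction n) (auto simp: map_mult)

lemma map_of_nat: "\<kappa> (of_nat n) = of_nat n"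
  by (induction n) (auto simp: map_add)

definition subalg :: "'r set \<Rightarrow> bool"
  where "subalg A \<longleftrightarrow> range \<kappa> \<subseteq> A \<and> (\<forall>x\<in>A. \<forall>y\<in>A. x + y \<in> A) \<and> (\<forall>x\<in>A. \<forall>y\<in>A. x * y \<in> A)"

lemma subalg_range: "subalg (range \<kappa>)"
  unfolding subalg_def by (auto simp: map_add[symmetric] map_mult[symmetric])

context
  fixes A assumes A: "subalg A"
begin

lemma subalg_map [simp]: "\<kappa> c \<in> A"
  using A by (auto simp: subalg_def)

lemma subalg_zero [simp]: "0 \<in> A" and subalg_one [simp]: "1 \<in> A"
  using subalg_map[of 0] subalg_map[of 1] by simp_all

lemma subalg_add: "x \<in> A \<Longrightarrow> y \<in> A \<Longrightarrow> x + y \<in> A"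
  and subalg_mult: "x \<in> A \<Longrightarrow> y \<in> A \<Longrightarrow> x * y \<in> A"
  using A by (auto simp: subalg_def)

lemma subalg_minus: "x \<in> A \<Longrightarrow> - x \<in> A"
  using subalg_mult[OF subalg_map, of x "- 1"] by (simp add: map_minus)

lemma subalg_diff: "x \<in> A \<Longrightarrow> y \<in> A \<Longrightarrow> x - y \<in> A"
  using subalg_add[of x "- y"] subalg_minus by simp

lemma subalg_sum: "(\<And>s. s \<in> S \<Longrightarrow> f s \<in> A) \<Longrightarrow> sum f S \<in> A"
  by (induction S rule: infinite_finite_induct) (auto intro: subalg_add)

lemma subalg_power: "x \<in> A \<Longrightarrow> x ^ n \<in> A"
  by (induction n) (auto intro: subalg_mult)

lemma polys_over_0 [simp]: "0 \<in> polys_over A"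
  and polys_over_add: "p \<in> polys_over A \<Longrightarrow> q \<in> polys_over A \<Longrightarrow> p + q \<in> polys_over A"
  and polys_over_diff: "p \<in> polys_over A \<Longrightarrow> q \<in> polys_over A \<Longrightarrow> p - q \<in> polys_over A"
  and polys_over_mult: "p \<in> polys_over A \<Longrightarrow> q \<in> polys_over A \<Longrightarrow> p * q \<in> polys_over A"
  and polys_over_smult: "c \<in> A \<Longrightarrow> p \<in> polys_over A \<Longrightarrow> smult c p \<in> polys_over A"
  and polys_over_monom: "c \<in> A \<Longrightarrow> monom c n \<in> polys_over A"
  by (auto simp: polys_over_def coeff_mult subalg_add subalg_diff subalg_mult
      intro!: subalg_sum subalg_mult)

lemma polys_over_pCons [simp]: "pCons c p \<in> polys_over A \<longleftrightarrow> c \<in> A \<and> p \<in> polys_over A"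
  unfolding polys_over_def by (auto simp: coeff_pCons split: nat.splits)

lemma adjoin_subset: "A \<subseteq> adjoin A y"
proof
  fix a assume "a \<in> A"
  then show "a \<in> adjoin A y" unfolding adjoin_def by (intro image_eqI[of _ _ "[:a:]"]) auto
qed

lemma adjoin_mem: "y \<in> adjoin A y"
  unfolding adjoin_def by (intro image_eqI[of _ _ "[:0, 1:]"]) auto

lemma adjoin_poly: "p \<in> polys_over A \<Longrightarrow> poly p y \<in> adjoin A y"
  unfolding adjoin_def by auto

lemma subalg_adjoin: "subalg (adjoin A y)"
proof -
  have "poly p y + poly q y \<in> adjoin A y" "poly p y * poly q y \<in> adjoin A y"
    if "p \<in> polys_over A" "q \<in> polys_over A" for p q
    using adjoin_poly[of "p + q" y] adjoin_poly[of "p * q" y] polys_over_add polys_over_mult that by auto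
  moreover have "range \<kappa> \<subseteq> adjoin A y"
    using adjoin_subset subalg_map by (meson image_subsetI subsetD)
  ultimately show ?thesis unfolding subalg_def by (auto simp: adjoin_def)
qed

lemma adjoin_least:
  assumes "subalg B" "A \<subseteq> B" "y \<in> B"
  shows "adjoin A y \<subseteq> B"
proof
  fix v assume "v \<in> adjoin A y"
  then obtain p where p: "p \<in> polys_over A" "v = poly p y" by (auto simp: adjoin_def)
  have "poly p y \<in> B" using p(1)
  proof (induction p)
    case 0
    then show ?case using assms(1) by (simp add: subalg_def) (metis map_zero rangeI subsetD)
  next
    case (pCons a p)
    then have "a \<in> B" "poly p y \<in> B" using assms(2) by auto
    then show ?case using assms(1,3) by (simp add: subalg_def)
  qed
  with p show "v \<in> B" by simp
qed

text \<open>Division costs a power of the leading coefficient, as \<open>A\<close> need not be a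
  field. The remainder is bounded through vanishing coefficients, so that a constant
  \<open>G\<close> is covered (then \<open>r\<close> = 0); the last clause bounds the degree of the
  quotient for use in \<open>coprime_modulo_prime\<close>.\<close>

lemma pseudo_division:
  assumes "G \<in> polys_over A" "P \<in> polys_over A"
  shows "\<exists>N q r. q \<in> polys_over A \<and> r \<in> polys_over A \<and>
    smult (lead_coeff G ^ N) P = q * G + r \<and> (\<forall>i\<ge>degree G. coeff r i = 0) \<and>
    (\<forall>i. degree P < i + degree G \<longrightarrow> coeff q i = 0)"
proof -
  have "\<exists>N q r. q \<in> polys_over A \<and> r \<in> polys_over A \<and>
    smult (lead_coeff G ^ N) P = q * G + r \<and> (\<forall>i\<ge>degree G. coeff r i = 0) \<and>
    (\<forall>i. n \<le> i + degree G \<longrightarrow> coeff q i = 0)"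
    if "\<forall>i\<ge>n. coeff P i = 0" "P \<in> polys_over A" for n P
    using that
  proof (induction n arbitrary: P)
    case 0
    then have "P = 0" by (intro poly_eqI) auto
    then show ?case by (intro exI[of _ 0]) auto
  next
    case (Suc n)
    show ?case
    proof (cases "n < degree G")
      case True
      then show ?thesis using Suc.prems
        by (intro exI[of _ 0] exI[of _ P]) auto
    next
      case False
      define T where "T = monom (coeff P n) (n - degree G)"
      have T: "T \<in> polys_over A" unfolding T_def using Suc.prems(2)
        by (intro polys_over_monom) (auto simp: polys_over_def)
      have g: "lead_coeff G \<in> A" using assms(1) by (auto simp: polys_over_def)
      define P' where "P' = smult (lead_coeff G) P - T * G"
      have P': "P' \<in> polys_over A"
        unfolding P'_def using T g Suc.prems(2) assms(1)
        by (intro polys_over_diff polys_over_smult polys_over_mult)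
      have "coeff P' i = 0" if "i \<ge> n" for i
      proof (cases "i = n")
        case True
        then show ?thesis using False by (simp add: P'_def T_def coeff_monom_mult mult.commute[of T])
      next
        case i: False
        then show ?thesis using False that Suc.prems(1)
          by (simp add: P'_def T_def coeff_monom_mult coeff_eq_0)
      qed
      with Suc.IH[OF _ P'] obtain N q r where IH: "q \<in> polys_over A" "r \<in> polys_over A"
        "smult (lead_coeff G ^ N) P' = q * G + r" "\<forall>i\<ge>degree G. coeff r i = 0" "\<forall>i. n \<le> i + degree G \<longrightarrow> coeff q i = 0" by blast
      have "smult (lead_coeff G ^ Suc N) P = smult (lead_coeff G ^ N) (smult (lead_coeff G) P)"
        by (simp add: mult.commute)
      also have "smult (lead_coeff G) P = P' + T * G" by (simp add: P'_def)
      also have "smult (lead_coeff G ^ N) (P' + T * G) = (q + smult (lead_coeff G ^ N) T) * G + r"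
        by (simp add: smult_add_right IH(3) algebra_simps)
      finally have "smult (lead_coeff G ^ Suc N) P = (q + smult (lead_coeff G ^ N) T) * G + r" .
      moreover have "q + smult (lead_coeff G ^ N) T \<in> polys_over A"
        using IH T g by (intro polys_over_add polys_over_smult subalg_power)
      moreover have "coeff (q + smult (lead_coeff G ^ N) T) i = 0" if "Suc n \<le> i + degree G" for i
        using that IH(5) False by (auto simp: T_def)
      ultimately show ?thesis using IH(2,4) by blast
    qed
  qed
  from this[of "Suc (degree P)" P] show ?thesis using assms(2) by (auto simp: coeff_eq_0 Suc_le_eq)
qed

text \<open>The minimal polynomial of \<open>y\<close> over the fraction field of A / (A \<inter>
  Q), with denominators cleared and every equation read modulo \<open>Q\<close>. For a
  \<open>G\<close> of least degree, the remainder of any \<open>P\<close> vanishing at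
  \<open>y\<close> has smaller degree, hence all its coefficients in \<open>Q\<close>.\<close>

lemma minimal_polynomial:
  assumes Q: "prime_in UNIV Q"
    and ex: "p0 \<in> polys_over A" "poly p0 y \<in> Q" "coeff p0 i0 \<notin> Q"
  shows "\<exists>G \<in> polys_over A. poly G y \<in> Q \<and> lead_coeff G \<notin> Q \<and> 0 < degree G \<and>
    (\<forall>P \<in> polys_over A. poly P y \<in> Q \<longrightarrow> (\<forall>i\<ge>degree G. coeff P i = 0) \<longrightarrow> (\<forall>i. coeff P i \<in> Q)) \<and>
    (\<forall>P \<in> polys_over A. poly P y \<in> Q \<longrightarrow> (\<exists>N. \<exists>q\<in>polys_over A. \<exists>r\<in>polys_over A.
      smult (lead_coeff G ^ N) P = q * G + r \<and> (\<forall>i. coeff r i \<in> Q)))"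
proof -
  have Q0: "0 \<in> Q" and Q1: "1 \<notin> Q" and Qadd: "\<And>x y. x \<in> Q \<Longrightarrow> y \<in> Q \<Longrightarrow> x + y \<in> Q"
    and Qmul: "\<And>b x. x \<in> Q \<Longrightarrow> b * x \<in> Q" and Qp: "\<And>x y. x * y \<in> Q \<Longrightarrow> x \<in> Q \<or> y \<in> Q"
    using Q unfolding prime_in_def by auto
  have Qsum: "(\<And>s. s \<in> S \<Longrightarrow> f s \<in> Q) \<Longrightarrow> sum f S \<in> Q" for f :: "nat \<Rightarrow> 'r" and S
    by (induction S rule: infinite_finite_induct) (auto intro: Q0 Qadd)
  have Qmin: "x - y \<in> Q" if "x \<in> Q" "y \<in> Q" for x y
    using Qadd[OF that(1) Qmul[OF that(2), of "-1"]] by simp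
  define good where "good n p \<longleftrightarrow> p \<in> polys_over A \<and> poly p y \<in> Q \<and> coeff p n \<notin> Q \<and> (\<forall>i>n. coeff p i = 0)"
    for n p
  \<comment> \<open>Cutting off the top coefficients that lie in \<open>Q\<close> changes the value
    at \<open>y\<close> only by an element of \<open>Q\<close>, so the leading coefficient may be
    taken outside \<open>Q\<close>.\<close>
  have truncate: "\<exists>n p'. good n p' \<and> n \<le> m"
    if p: "p \<in> polys_over A" "poly p y \<in> Q" "coeff p i \<notin> Q" and m: "\<forall>i>m. coeff p i \<in> Q" for p i m
  proof -
    define S where "S = {i. coeff p i \<notin> Q}"
    have S: "finite S" "S \<noteq> {}" "S \<subseteq> {..m}"
    proof -
      show "S \<subseteq> {..m}" using m unfolding S_def by (auto simp: not_le[symmetric])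
      then show "finite S" by (rule finite_subset) simp
      show "S \<noteq> {}" using p(3) by (auto simp: S_def)
    qed
    define n where "n = Max S"
    have n: "coeff p n \<notin> Q" "\<forall>i>n. coeff p i \<in> Q" "n \<le> m"
      using Max_in[OF S(1,2)] Max_ge[OF S(1)] S(3) unfolding n_def
      by (auto simp: S_def not_le[symmetric])
    define p' where "p' = poly_cutoff (Suc n) p"
    have "poly (p - p') y \<in> Q"
      unfolding poly_altdef
      by (rule Qsum, subst mult.commute) (use n in \<open>auto simp: p'_def coeff_poly_cutoff Q0 intro!: Qmul\<close>)
    then have "poly p' y \<in> Q" using Qmin[OF p(2)] by fastforce
    moreover have "p' \<in> polys_over A" using p(1)
      by (auto simp: polys_over_def p'_def coeff_poly_cutoff)
    ultimately have "good n p'" using n by (auto simp: good_def p'_def coeff_poly_cutoff)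
    with n show ?thesis by blast
  qed
  have "\<exists>n p. good n p"
    using truncate[OF ex, of "degree p0"] Q0 by (auto simp: coeff_eq_0)
  then have "\<exists>n. (\<exists>p. good n p) \<and> (\<forall>m<n. \<not> (\<exists>p. good m p))"
    using exists_least_iff[of "\<lambda>n. \<exists>p. good n p"] by blast
  then obtain n G where G: "good n G" and least: "\<And>m p. m < n \<Longrightarrow> \<not> good m p" by blast
  have deg: "degree G = n"
    using G Q0 unfolding good_def by (metis coeff_eq_0 degree_le le_antisym not_le)
  have GA: "G \<in> polys_over A" and Gy: "poly G y \<in> Q" and lG: "lead_coeff G \<notin> Q"
    using G unfolding deg good_def by auto
  have "0 < degree G"
  proof (rule ccontr)
    assume "\<not> ?thesis"
    then have "G = [:lead_coeff G:]" by (auto elim: degree_eq_zeroE)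
    then have "poly G y = lead_coeff G" by (metis poly_const_conv)
    with lG Gy show False by simp
  qed
  moreover have small: "coeff r i \<in> Q"
    if r: "r \<in> polys_over A" "poly r y \<in> Q" "\<forall>i\<ge>degree G. coeff r i = 0" for r i
  proof (rule ccontr)
    assume ri: "coeff r i \<notin> Q"
    then have i: "i < degree G" using r(3) Q0 by (metis not_le)
    have "\<forall>i>degree G - 1. coeff r i \<in> Q" using r(3) Q0 by auto
    from truncate[OF r(1,2) ri this] i deg least show False by fastforce
  qed
  moreover have "\<exists>N. \<exists>q\<in>polys_over A. \<exists>r\<in>polys_over A.
      smult (lead_coeff G ^ N) P = q * G + r \<and> (\<forall>i. coeff r i \<in> Q)"
    if P: "P \<in> polys_over A" "poly P y \<in> Q" for P
  proof -
    obtain N q r where d: "q \<in> polys_over A" "r \<in> polys_over A"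
      "smult (lead_coeff G ^ N) P = q * G + r" "\<forall>i\<ge>degree G. coeff r i = 0"
      using pseudo_division[OF GA P(1)] by blast
    have "poly r y = lead_coeff G ^ N * poly P y - poly q y * poly G y"
      using arg_cong[OF d(3), of "\<lambda>p. poly p y"] by simp
    then have ry: "poly r y \<in> Q" using P(2) Gy by (auto intro: Qmin Qmul)
    have "coeff r i \<in> Q" for i using small[OF d(2) ry d(4)] .
    with d show ?thesis by blast
  qed
  ultimately show ?thesis using GA Gy lG by blast
qed

end

definition adjoin_list :: "'r set \<Rightarrow> 'r list \<Rightarrow> 'r set"
  where "adjoin_list A ys = foldl adjoin A ys"

lemma subalg_adjoin_list: "subalg A \<Longrightarrow> subalg (adjoin_list A ys)"
  by (induction ys arbitrary: A) (auto simp: adjoin_list_def subalg_adjoin)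

lemma adjoin_list_subset: "subalg A \<Longrightarrow> A \<subseteq> adjoin_list A ys"
proof (induction ys arbitrary: A)
  case (Cons y ys)
  then show ?case using Cons.IH[OF subalg_adjoin, of A y] adjoin_subset[of A y]
    by (auto simp: adjoin_list_def)
qed (auto simp: adjoin_list_def)

lemma adjoin_list_mem: "subalg A \<Longrightarrow> set ys \<subseteq> adjoin_list A ys"
proof (induction ys arbitrary: A)
  case (Cons y ys)
  have s: "subalg (adjoin A y)" using Cons.prems by (rule subalg_adjoin)
  from Cons.IH[OF s] adjoin_list_subset[OF s, of ys] adjoin_mem[OF Cons.prems, of y] show ?case
    by (auto simp: adjoin_list_def)
qed auto

lemma adjoin_list_least: "subalg A \<Longrightarrow> subalg B \<Longrightarrow> A \<subseteq> B \<Longrightarrow> set ys \<subseteq> B \<Longrightarrow> adjoin_list A ys \<subseteq> B"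
proof (induction ys arbitrary: A)
  case (Cons y ys)
  have "adjoin A y \<subseteq> B" using Cons.prems by (intro adjoin_least) auto
  with Cons.IH[OF subalg_adjoin[OF Cons.prems(1)], of y] Cons.prems show ?case
    by (auto simp: adjoin_list_def)
qed (auto simp: adjoin_list_def)

end

lemma prime_in_poly:
  assumes Q: "prime_in UNIV Q" and p: "\<And>i. coeff p i \<in> Q"
  shows "poly p x \<in> Q"
proof -
  have sum: "(\<And>s. s \<in> S \<Longrightarrow> f s \<in> Q) \<Longrightarrow> sum f S \<in> Q" for f and S :: "nat set"
    using Q by (induction S rule: infinite_finite_induct) (auto simp: prime_in_def)
  have "coeff p i * x ^ i \<in> Q" for i
    using Q p[of i] unfolding prime_in_def by (metis UNIV_I mult.commute)
  then show ?thesis unfolding poly_altdef by (intro sum)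
qed

section \<open>Extending points one generator at a time, over an algebraically closed field\<close>

section \<open>Extension of homomorphisms and the Nullstellensatz\<close>

context algebra_map
begin

text \<open>Homomorphisms from \<open>A / (A \<inter> Q)\<close> to the ground field, seen as functions on \<open>A\<close>.\<close>

definition point_on :: "'r set \<Rightarrow> 'r set \<Rightarrow> ('r \<Rightarrow> 'k) \<Rightarrow> bool"
  where "point_on Q A f \<longleftrightarrow> (\<forall>x\<in>A. \<forall>y\<in>A. f (x + y) = f x + f y) \<and>
    (\<forall>x\<in>A. \<forall>y\<in>A. f (x * y) = f x * f y) \<and> (\<forall>c. f (\<kappa> c) = c) \<and> (\<forall>x\<in>A \<inter> Q. f x = 0)"

lemma point_on_zero: "point_on Q A f \<Longrightarrow> f 0 = 0"
  unfolding point_on_def by (metis map_zero)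

context
  fixes A Q f assumes A: "subalg A" and f: "point_on Q A f"
begin

lemma point_on_poly_add:
  "p \<in> polys_over A \<Longrightarrow> q \<in> polys_over A \<Longrightarrow> map_poly f (p + q) = map_poly f p + map_poly f q"
  using f by (intro poly_eqI) (auto simp: coeff_map_poly point_on_zero[OF f] point_on_def polys_over_def)

lemma point_on_poly_smult:
  "c \<in> A \<Longrightarrow> q \<in> polys_over A \<Longrightarrow> map_poly f (smult c q) = smult (f c) (map_poly f q)"
  using f by (intro poly_eqI) (auto simp: coeff_map_poly point_on_zero[OF f] point_on_def polys_over_def)

lemma point_on_poly_mult:
  assumes "p \<in> polys_over A" "q \<in> polys_over A"
  shows "map_poly f (p * q) = map_poly f p * map_poly f q"
  using assms(1)
proof (induction p)
  case 0
  then show ?case by simp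
next
  case (pCons a p)
  then have p: "a \<in> A" "p \<in> polys_over A" using A by auto
  then have pq: "smult a q \<in> polys_over A" "pCons 0 (p * q) \<in> polys_over A"
    using assms A by (auto intro: polys_over_smult polys_over_mult)
  show ?case
    using pCons p assms(2) point_on_zero[OF f]
    by (simp add: mult_pCons_left point_on_poly_add[OF pq] point_on_poly_smult map_poly_pCons)
qed

lemma point_on_poly_diff:
  assumes "p \<in> polys_over A" "q \<in> polys_over A"
  shows "map_poly f (p - q) = map_poly f p - map_poly f q"
proof -
  have "p - q \<in> polys_over A" using assms A by (intro polys_over_diff)
  from point_on_poly_add[OF this assms(2)] show ?thesis by (simp add: algebra_simps)
qed

lemma point_on_extend:
  assumes well: "\<And>p. p \<in> polys_over A \<Longrightarrow> poly p y \<in> Q \<Longrightarrow> poly (map_poly f p) t = 0"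
    and Q0: "0 \<in> Q"
  obtains g where "point_on Q (adjoin A y) g"
    "\<And>p. p \<in> polys_over A \<Longrightarrow> g (poly p y) = poly (map_poly f p) t"
proof -
  \<comment> \<open>The value is read off from an arbitrary polynomial expression of the element;
    \<open>well\<close> makes any two choices agree.\<close>
  define g where "g v = poly (map_poly f (SOME p. p \<in> polys_over A \<and> poly p y = v)) t" for v
  have g: "g (poly p y) = poly (map_poly f p) t" if p: "p \<in> polys_over A" for p
  proof -
    define q where "q = (SOME q. q \<in> polys_over A \<and> poly q y = poly p y)"
    have q: "q \<in> polys_over A \<and> poly q y = poly p y" unfolding q_def by (rule someI_ex) (use p in auto)
    have "poly (map_poly f (q - p)) t = 0"
      using q p A Q0 by (intro well polys_over_diff) auto
    then show ?thesis using q p by (simp add: g_def q_def[symmetric] point_on_poly_diff)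
  qed
  have "g (x + y') = g x + g y' \<and> g (x * y') = g x * g y'" if "x \<in> adjoin A y" "y' \<in> adjoin A y" for x y'
  proof -
    from that obtain p q where pq: "p \<in> polys_over A" "q \<in> polys_over A" "x = poly p y" "y' = poly q y"
      by (auto simp: adjoin_def)
    have "p + q \<in> polys_over A" "p * q \<in> polys_over A" using pq A polys_over_add polys_over_mult by blast+
    from g[OF this(1)] g[OF this(2)] show ?thesis
      using pq by (simp add: g point_on_poly_add point_on_poly_mult)
  qed
  moreover have "g (\<kappa> c) = c" for c
    using g[of "[:\<kappa> c:]"] A f point_on_zero[OF f] by (simp add: map_poly_pCons point_on_def)
  moreover have "g x = 0" if "x \<in> adjoin A y \<inter> Q" for x
    using that g well by (auto simp: adjoin_def)
  ultimately have "point_on Q (adjoin A y) g" unfolding point_on_def by blast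
  with g that show thesis by blast
qed

end

text \<open>Bezout's identity over the fraction field of A / (A \<inter> Q). There \<open>G\<close>
  behaves like an irreducible polynomial, since by \<open>small\<close> nothing of lower degree
  vanishes at \<open>y\<close> modulo \<open>Q\<close>, and \<open>P\<close> is not a multiple of
  it; clearing denominators leaves a constant \<open>c\<close> outside \<open>Q\<close>.\<close>

lemma coprime_modulo_prime:
  assumes A: "subalg A" and Q: "prime_in UNIV Q"
    and P: "P \<in> polys_over A" "poly P y \<notin> Q"
    and G: "G \<in> polys_over A" "poly G y \<in> Q" "lead_coeff G \<notin> Q"
    and small: "\<And>p i. p \<in> polys_over A \<Longrightarrow> poly p y \<in> Q \<Longrightarrow> \<forall>i\<ge>degree G. coeff p i = 0 \<Longrightarrow> coeff p i \<in> Q"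
  obtains U V r c where "U \<in> polys_over A" "V \<in> polys_over A" "r \<in> polys_over A" "c \<in> A"
    "c \<notin> Q" "\<And>i. coeff r i \<in> Q" "U * P + V * G = [:c:] + r"
proof -
  have Q0: "0 \<in> Q" and Q1: "1 \<notin> Q" and Qadd: "\<And>x y. x \<in> Q \<Longrightarrow> y \<in> Q \<Longrightarrow> x + y \<in> Q"
    and Qmul: "\<And>b x. x \<in> Q \<Longrightarrow> b * x \<in> Q" and Qp: "\<And>x y. x * y \<in> Q \<Longrightarrow> x \<in> Q \<or> y \<in> Q"
    using Q unfolding prime_in_def by auto
  have Qpow: "x ^ n \<notin> Q" if "x \<notin> Q" for x n
    using that Q1 Qp by (induction n) auto
  have Qmin: "x - y \<in> Q" if "x \<in> Q" "y \<in> Q" for x y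
    using Qadd[OF that(1) Qmul[OF that(2), of "-1"]] by simp
  have Qsum: "(\<And>s. s \<in> S \<Longrightarrow> f s \<in> Q) \<Longrightarrow> sum f S \<in> Q" for f :: "nat \<Rightarrow> 'r" and S
    by (induction S rule: infinite_finite_induct) (auto intro: Q0 Qadd)
  note Qpoly = prime_in_poly[OF Q]
  have Qmulp: "coeff (p * q) i \<in> Q" if "\<And>i. coeff q i \<in> Q" for p q i
    unfolding coeff_mult using that by (intro Qsum Qmul)
  \<comment> \<open>\<open>M\<close> is, up to coefficients in \<open>Q\<close>, a combination of
    \<open>P\<close> and \<open>G\<close> of exact degree \<open>n\<close> with top coefficient
    outside \<open>Q\<close>; such an \<open>M\<close> of least degree plays the role of the
    gcd.\<close>
  define good where "good n M \<longleftrightarrow> (\<exists>U\<in>polys_over A. \<exists>V\<in>polys_over A. \<exists>r\<in>polys_over A. M \<in> polys_over A \<and>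
    (\<forall>i. coeff r i \<in> Q) \<and> U * P + V * G = M + r \<and> coeff M n \<notin> Q \<and> (\<forall>i>n. coeff M i = 0))" for n M
  have truncate: "\<exists>n M'. good n M' \<and> n \<le> m"
    if M: "U \<in> polys_over A" "V \<in> polys_over A" "r \<in> polys_over A" "M \<in> polys_over A"
      "\<forall>i. coeff r i \<in> Q" "U * P + V * G = M + r" "coeff M i \<notin> Q"
      and m: "\<forall>i>m. coeff M i \<in> Q" for U V r M i m
  proof -
    define S where "S = {i. coeff M i \<notin> Q}"
    have S: "finite S" "S \<noteq> {}" "S \<subseteq> {..m}"
    proof -
      show "S \<subseteq> {..m}" using m unfolding S_def by (auto simp: not_le[symmetric])
      then show "finite S" by (rule finite_subset) simp
      show "S \<noteq> {}" using M by (auto simp: S_def)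
    qed
    define n where "n = Max S"
    have n: "coeff M n \<notin> Q" "\<forall>i>n. coeff M i \<in> Q" "n \<le> m"
      using Max_in[OF S(1,2)] Max_ge[OF S(1)] S(3) unfolding n_def
      by (auto simp: S_def not_le[symmetric])
    define M' where "M' = poly_cutoff (Suc n) M"
    have M': "M' \<in> polys_over A" using M(4) A
      by (auto simp: polys_over_def M'_def coeff_poly_cutoff)
    have "coeff (r + (M - M')) i \<in> Q" for i
      using M(5) n by (auto simp: M'_def coeff_poly_cutoff intro!: Qadd Q0)
    moreover have "U * P + V * G = M' + (r + (M - M'))" using M by simp
    moreover have "r + (M - M') \<in> polys_over A" using M M' A by (intro polys_over_add polys_over_diff)
    moreover have "coeff M' n \<notin> Q" "\<forall>i>n. coeff M' i = 0"
      using n by (auto simp: M'_def coeff_poly_cutoff)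
    ultimately have "good n M'" unfolding good_def using M(1,2) M' by blast
    with n show ?thesis by blast
  qed
  have "\<exists>i. coeff P i \<notin> Q" using Qpoly P(2) by blast
  then obtain i0 where i0: "coeff P i0 \<notin> Q" ..
  have "\<exists>n M. good n M"
    using truncate[of 1 0 0 P i0 "degree P"] i0 P Q0 A by (force simp: coeff_eq_0 one_pCons)
  then have "\<exists>n. (\<exists>p. good n p) \<and> (\<forall>m<n. \<not> (\<exists>p. good m p))"
    using exists_least_iff[of "\<lambda>n. \<exists>p. good n p"] by blast
  then obtain n M where M: "good n M" and least: "\<And>m p. m < n \<Longrightarrow> \<not> good m p" by blast
  from M obtain U V r where UV: "U \<in> polys_over A" "V \<in> polys_over A" "r \<in> polys_over A"
    "M \<in> polys_over A" "\<forall>i. coeff r i \<in> Q" "U * P + V * G = M + r"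
    and Mn: "coeff M n \<notin> Q" "\<forall>i>n. coeff M i = 0"
    unfolding good_def by blast
  have deg: "degree M = n"
    using Mn Q0 by (metis coeff_eq_0 degree_le le_antisym not_le)
  have rem: "coeff s i \<in> Q" if s: "T * P + W * G = q * M + s" "T \<in> polys_over A" "W \<in> polys_over A"
    "q \<in> polys_over A" "s \<in> polys_over A" "\<forall>i\<ge>n. coeff s i = 0" for T W q s i
  proof (rule ccontr)
    assume si: "coeff s i \<notin> Q"
    then have i: "i < n" using s(6) Q0 by (metis not_le)
    have "(T - q * U) * P + (W - q * V) * G = s + q * (- r)"
    proof -
      have "(T - q * U) * P + (W - q * V) * G = (T * P + W * G) - q * (U * P + V * G)"
        by (simp add: algebra_simps)
      then show ?thesis unfolding s(1) UV(6) by (simp add: algebra_simps)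
    qed
    moreover have "T - q * U \<in> polys_over A" "W - q * V \<in> polys_over A"
      using s UV A by (auto intro!: polys_over_diff polys_over_mult)
    moreover have "q * (- r) \<in> polys_over A"
      using polys_over_mult[OF A s(4) polys_over_diff[OF A polys_over_0[OF A] UV(3)]] by simp
    moreover have "\<forall>i. coeff (q * (- r)) i \<in> Q"
      using Qmin[OF Q0] UV(5) by (intro allI Qmulp) (metis coeff_minus diff_0)
    moreover have "\<forall>i>n - 1. coeff s i \<in> Q" using s(6) Q0 by auto
    ultimately obtain m M' where "good m M'" "m \<le> n - 1" using truncate s(5) si by metis
    with i least show False by fastforce
  qed
  have mA: "lead_coeff M \<in> A" using UV(4) by (auto simp: polys_over_def)
  have lc: "lead_coeff M \<notin> Q" using Mn deg by simp
  have const: "[:lead_coeff M ^ N:] \<in> polys_over A" for N using mA A by (auto intro: subalg_power)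
  obtain N q s where d: "q \<in> polys_over A" "s \<in> polys_over A"
    "smult (lead_coeff M ^ N) P = q * M + s" "\<forall>i\<ge>n. coeff s i = 0"
    using pseudo_division[OF A UV(4) P(1)] deg by blast
  have sQ: "coeff s i \<in> Q" for i
    using rem[of "[:lead_coeff M ^ N:]" 0 q s i] d const A by simp
  have My: "poly M y \<notin> Q"
  proof
    assume "poly M y \<in> Q"
    then have "poly (smult (lead_coeff M ^ N) P) y \<in> Q"
      unfolding d(3) using Qpoly[OF sQ] by (auto intro: Qadd Qmul)
    with P(2) Qp[of "lead_coeff M ^ N"] Qpow[OF lc] show False by auto
  qed
  obtain N' q' s' where d': "q' \<in> polys_over A" "s' \<in> polys_over A"
    "smult (lead_coeff M ^ N') G = q' * M + s'" "\<forall>i\<ge>n. coeff s' i = 0"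
    "\<forall>i. degree G < i + n \<longrightarrow> coeff q' i = 0"
    using pseudo_division[OF A UV(4) G(1)] deg by blast
  have s'Q: "coeff s' i \<in> Q" for i
    using rem[of 0 "[:lead_coeff M ^ N':]" q' s' i] d' const A by simp
  \<comment> \<open>If \<open>M\<close> had positive degree, \<open>q'\<close> would have degree
    below that of \<open>G\<close>. The product of \<open>q'\<close> and \<open>M\<close> vanishes
    at \<open>y\<close> modulo \<open>Q\<close> and \<open>M\<close> does not, so
    \<open>small\<close> puts the coefficients of \<open>q'\<close> into \<open>Q\<close>, and then
    also the leading coefficient of \<open>G\<close>.\<close>
  have "n = 0"
  proof (rule ccontr)
    assume "n \<noteq> 0"
    then have deg': "\<forall>i\<ge>degree G. coeff q' i = 0" using d'(5) by auto
    have "poly (q' * M) y = lead_coeff M ^ N' * poly G y - poly s' y"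
      using arg_cong[OF d'(3), of "\<lambda>p. poly p y"] by simp
    then have "poly (q' * M) y \<in> Q" using G(2) Qpoly[OF s'Q] by (simp only:) (intro Qmin Qmul)
    then have "poly q' y \<in> Q" using My Qp by auto
    then have "coeff q' i \<in> Q" for i using small[OF d'(1) _ deg'] by blast
    then have "coeff (M * q') (degree G) \<in> Q" by (rule Qmulp)
    then have "coeff (M * q' + s') (degree G) \<in> Q"
      unfolding coeff_add using s'Q by (rule Qadd)
    then have "lead_coeff M ^ N' * lead_coeff G \<in> Q"
      using arg_cong[OF d'(3), of "\<lambda>p. coeff p (degree G)"] by (simp add: mult.commute)
    with Qp G(3) Qpow[OF lc] show False by blast
  qed
  then have "M = [:coeff M 0:]" using Mn by (intro poly_eqI) (auto simp: coeff_pCons split: nat.splits)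
  with UV Mn \<open>n = 0\<close> that[of U V r "coeff M 0"] show thesis by (auto simp: polys_over_def)
qed

end

locale closed_field_algebra = algebra_map \<kappa>
  for \<kappa> :: "'k :: alg_closed_field \<Rightarrow> 'r :: comm_ring_1"
begin

lemma infinite_ground_field: "infinite (UNIV :: 'k set)"
proof
  assume fin: "finite (UNIV :: 'k set)"
  define p :: "'k poly" where "p = (\<Prod>a\<in>UNIV. [:- a, 1:]) + 1"
  have "degree (\<Prod>a\<in>UNIV. [:- a, 1:] :: 'k poly) = card (UNIV :: 'k set)"
    by (subst degree_prod_eq_sum_degree) auto
  then have "degree p > 0" unfolding p_def
    using fin by (subst degree_add_eq_left) (auto simp: card_gt_0_iff)
  then obtain x where "poly p x = 0" using alg_closed_imp_poly_has_root by blast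
  moreover have "poly (\<Prod>a\<in>UNIV. [:- a, 1:]) x = 0"
    using fin by (auto simp: poly_prod)
  ultimately show False by (simp add: p_def)
qed

text \<open>The element of \<open>A\<close> to avoid: if \<open>y\<close> is transcendental modulo
  \<open>Q\<close>, a coefficient of \<open>b\<close> works and \<open>y\<close> is sent to a
  non-root; if \<open>y\<close> is algebraic, it prevents both a drop in degree of the minimal
  polynomial and a common root with the polynomial that expresses \<open>b\<close>.\<close>

lemma point_on_adjoin:
  assumes A: "subalg A" and Q: "prime_in UNIV Q" and b: "b \<in> adjoin A y" "b \<notin> Q"
  shows "\<exists>a\<in>A. a \<notin> Q \<and> (\<forall>f. point_on Q A f \<longrightarrow> f a \<noteq> 0 \<longrightarrow>
    (\<exists>g. point_on Q (adjoin A y) g \<and> g b \<noteq> 0))"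
proof -
  have Q0: "0 \<in> Q" and Q1: "1 \<notin> Q" and Qadd: "\<And>x y. x \<in> Q \<Longrightarrow> y \<in> Q \<Longrightarrow> x + y \<in> Q"
    and Qmul: "\<And>b x. x \<in> Q \<Longrightarrow> b * x \<in> Q" and Qp: "\<And>x y. x * y \<in> Q \<Longrightarrow> x \<in> Q \<or> y \<in> Q"
    using Q unfolding prime_in_def by auto
  have Qpow: "x ^ n \<notin> Q" if "x \<notin> Q" for x n
    using that Q1 Qp by (induction n) auto
  have Qmin: "x - y \<in> Q" if "x \<in> Q" "y \<in> Q" for x y
    using Qadd[OF that(1) Qmul[OF that(2), of "-1"]] by simp
  obtain P where P: "P \<in> polys_over A" "b = poly P y" using b by (auto simp: adjoin_def)
  show ?thesis
  proof (cases "\<exists>p\<in>polys_over A. poly p y \<in> Q \<and> (\<exists>i. coeff p i \<notin> Q)")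
    case False
    have "\<exists>i. coeff P i \<notin> Q"
    proof (rule ccontr)
      assume "\<not> ?thesis"
      then have "poly P y \<in> Q" using prime_in_poly[OF Q] by blast
      with b P show False by simp
    qed
    then obtain i where i: "coeff P i \<notin> Q" by blast
    show ?thesis
    proof (intro bexI[of _ "coeff P i"] conjI allI impI)
      fix f assume f: "point_on Q A f" and nz: "f (coeff P i) \<noteq> 0"
      have "coeff (map_poly f P) i \<noteq> 0" using nz point_on_zero[OF f] by (simp add: coeff_map_poly)
      then have "map_poly f P \<noteq> 0" by auto
      then have "finite {t. poly (map_poly f P) t = 0}" by (rule poly_roots_finite)
      then obtain t where t: "poly (map_poly f P) t \<noteq> 0"
        using infinite_ground_field by (metis (mono_tags, lifting) UNIV_I finite_subset mem_Collect_eq subsetI)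
      have "poly (map_poly f p) t = 0" if "p \<in> polys_over A" "poly p y \<in> Q" for p
      proof -
        have "coeff p i \<in> A \<inter> Q" for i using that False by (auto simp: polys_over_def)
        then have "map_poly f p = 0"
          using f by (intro poly_eqI) (auto simp: coeff_map_poly point_on_zero[OF f] point_on_def)
        then show ?thesis by simp
      qed
      from point_on_extend[OF A f this Q0] obtain g where "point_on Q (adjoin A y) g"
        "\<And>p. p \<in> polys_over A \<Longrightarrow> g (poly p y) = poly (map_poly f p) t" by blast
      then show "\<exists>g. point_on Q (adjoin A y) g \<and> g b \<noteq> 0" using P t by auto
    qed (use i P in \<open>auto simp: polys_over_def\<close>)
  next
    case True
    then obtain p0 i0 where "p0 \<in> polys_over A" "poly p0 y \<in> Q" "coeff p0 i0 \<notin> Q" by blast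
    from minimal_polynomial[OF A Q this] obtain G where G: "G \<in> polys_over A" "poly G y \<in> Q"
      "lead_coeff G \<notin> Q" "0 < degree G" and
      small: "\<And>P i. P \<in> polys_over A \<Longrightarrow> poly P y \<in> Q \<Longrightarrow> \<forall>i\<ge>degree G. coeff P i = 0 \<Longrightarrow> coeff P i \<in> Q" and
      div: "\<And>P. P \<in> polys_over A \<Longrightarrow> poly P y \<in> Q \<Longrightarrow> \<exists>N. \<exists>q\<in>polys_over A. \<exists>r\<in>polys_over A.
        smult (lead_coeff G ^ N) P = q * G + r \<and> (\<forall>i. coeff r i \<in> Q)"
      by metis
    have gA: "lead_coeff G \<in> A" using G by (auto simp: polys_over_def)
    obtain U V r c where c: "U \<in> polys_over A" "V \<in> polys_over A" "r \<in> polys_over A" "c \<in> A"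
      "c \<notin> Q" "\<And>i. coeff r i \<in> Q" "U * P + V * G = [:c:] + r"
      by (rule coprime_modulo_prime[OF A Q P(1) _ G(1,2,3)]) (use b P(2) small in auto)
    show ?thesis
    proof (intro bexI[of _ "lead_coeff G * c"] conjI allI impI)
      show "lead_coeff G * c \<notin> Q" using Qp G c by blast
      show "lead_coeff G * c \<in> A" using gA c A by (auto intro: subalg_mult)
      fix f assume f: "point_on Q A f" and nz: "f (lead_coeff G * c) \<noteq> 0"
      have nz: "f (lead_coeff G) \<noteq> 0" "f c \<noteq> 0" using nz f gA c by (auto simp: point_on_def)
      have map0: "map_poly f p = 0" if "p \<in> polys_over A" "\<And>i. coeff p i \<in> Q" for p
        using f that by (intro poly_eqI) (auto simp: coeff_map_poly point_on_zero[OF f] point_on_def polys_over_def)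
      have "degree (map_poly f G) = degree G"
        using nz point_on_zero[OF f]
        by (intro antisym degree_le le_degree) (auto simp: coeff_map_poly coeff_eq_0)
      with G alg_closed_imp_poly_has_root[of "map_poly f G"]
      obtain t where t: "poly (map_poly f G) t = 0" by auto
      have "poly (map_poly f p) t = 0" if p: "p \<in> polys_over A" "poly p y \<in> Q" for p
      proof -
        from div[OF p] obtain N q r where d: "q \<in> polys_over A" "r \<in> polys_over A"
          "smult (lead_coeff G ^ N) p = q * G + r" "\<forall>i. coeff r i \<in> Q" by blast
        have fN: "f (lead_coeff G ^ N) \<noteq> 0" for N
        proof (induction N)
          case 0
          then show ?case using f by (auto simp: point_on_def) (metis map_one zero_neq_one)
        next
          case (Suc N)
          have "f (lead_coeff G * lead_coeff G ^ N) = f (lead_coeff G) * f (lead_coeff G ^ N)"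
            using f gA subalg_power[OF A gA] unfolding point_on_def by blast
          with Suc nz show ?case by simp
        qed
        have "map_poly f (smult (lead_coeff G ^ N) p) = smult (f (lead_coeff G ^ N)) (map_poly f p)"
          using p subalg_power[OF A gA] by (intro point_on_poly_smult[OF A f]) auto
        moreover have "map_poly f (q * G + r) = map_poly f q * map_poly f G"
          using d G polys_over_mult[OF A d(1) G(1)]
          by (simp add: point_on_poly_add[OF A f] point_on_poly_mult[OF A f] map0)
        ultimately have "poly (smult (f (lead_coeff G ^ N)) (map_poly f p)) t = 0"
          using d(3) t by (metis mult_zero_right poly_mult)
        then show ?thesis using fN by simp
      qed
      from point_on_extend[OF A f this Q0] obtain g where g: "point_on Q (adjoin A y) g"
        "\<And>p. p \<in> polys_over A \<Longrightarrow> g (poly p y) = poly (map_poly f p) t" by blast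
      have mem: "U * P \<in> polys_over A" "V * G \<in> polys_over A" "[:c:] \<in> polys_over A"
        using c P G A by (auto intro: polys_over_mult)
      have "map_poly f (U * P + V * G) = map_poly f U * map_poly f P + map_poly f V * map_poly f G"
        using c(1,2) P(1) G(1) by (simp add: point_on_poly_add[OF A f mem(1,2)] point_on_poly_mult[OF A f])
      moreover have "map_poly f ([:c:] + r) = map_poly f [:c:]"
        using c(3,6) by (simp only: point_on_poly_add[OF A f mem(3)] map0 add_0_right)
      ultimately have "map_poly f U * map_poly f P + map_poly f V * map_poly f G = map_poly f [:c:]"
        using c(7) by simp
      from arg_cong[OF this, of "\<lambda>p. poly p t"] nz t
      have "poly (map_poly f P) t \<noteq> 0" by (auto simp: map_poly_pCons point_on_zero[OF f])
      then show "\<exists>g. point_on Q (adjoin A y) g \<and> g b \<noteq> 0" using g P by auto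
    qed
  qed
qed

lemma point_on_adjoin_list:
  assumes "subalg A" "prime_in UNIV Q" "b \<in> adjoin_list A ys" "b \<notin> Q"
  shows "\<exists>a\<in>A. a \<notin> Q \<and> (\<forall>f. point_on Q A f \<longrightarrow> f a \<noteq> 0 \<longrightarrow>
    (\<exists>g. point_on Q (adjoin_list A ys) g \<and> g b \<noteq> 0))"
  using assms
proof (induction ys arbitrary: A)
  case Nil
  then show ?case by (auto simp: adjoin_list_def)
next
  case (Cons y ys)
  have eq: "adjoin_list A (y # ys) = adjoin_list (adjoin A y) ys" by (simp add: adjoin_list_def)
  from Cons.IH[OF subalg_adjoin[OF Cons.prems(1)] Cons.prems(2) Cons.prems(3)[unfolded eq] Cons.prems(4)]
  obtain a where a: "a \<in> adjoin A y" "a \<notin> Q" "\<forall>f. point_on Q (adjoin A y) f \<longrightarrow> f a \<noteq> 0 \<longrightarrow>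
    (\<exists>g. point_on Q (adjoin_list A (y # ys)) g \<and> g b \<noteq> 0)" unfolding eq by blast
  from point_on_adjoin[OF Cons.prems(1,2) a(1,2)] obtain a' where a': "a' \<in> A" "a' \<notin> Q"
    "\<And>f. point_on Q A f \<Longrightarrow> f a' \<noteq> 0 \<Longrightarrow> \<exists>g. point_on Q (adjoin A y) g \<and> g a \<noteq> 0" by blast
  show ?case
  proof (intro bexI[of _ a'] conjI allI impI)
    fix f assume "point_on Q A f" "f a' \<noteq> 0"
    from a'(3)[OF this] a(3) show "\<exists>g. point_on Q (adjoin_list A (y # ys)) g \<and> g b \<noteq> 0" by metis
  qed (use a' in auto)
qed

text \<open>The identity point of the ground field is extended over all generators, with 1 as the
  element to be kept nonzero. The kernel of the resulting evaluation is a prime containing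
  \<open>Q\<close>, so maximality identifies the two.\<close>

theorem weak_nullstellensatz:
  assumes Q: "prime_in UNIV Q" and max: "\<And>J. prime_in UNIV J \<Longrightarrow> Q \<subseteq> J \<Longrightarrow> J = Q"
    and fin: "adjoin_list (range \<kappa>) ys = UNIV"
  obtains f :: "'r \<Rightarrow> 'k" where "\<And>x y. f (x + y) = f x + f y" "\<And>x y. f (x * y) = f x * f y"
    "\<And>c. f (\<kappa> c) = c" "\<And>x. f x = 0 \<longleftrightarrow> x \<in> Q"
proof -
  have Q1: "1 \<notin> Q" and Qmul: "\<And>b x. x \<in> Q \<Longrightarrow> b * x \<in> Q" using Q by (auto simp: prime_in_def)
  have inj: "c = d" if "\<kappa> c = \<kappa> d" for c d
  proof (rule ccontr)
    assume "c \<noteq> d"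
    then have "\<kappa> (inverse (c - d) * (c - d)) = 1" by simp
    then have "\<kappa> (inverse (c - d)) * \<kappa> (c - d) = 1" by (simp only: map_mult)
    then have "(1 :: 'r) = 0" using that by (simp add: map_diff)
    with Q show False by (auto simp: prime_in_def)
  qed
  define f0 where "f0 = inv_into UNIV \<kappa>"
  have f0: "f0 (\<kappa> c) = c" for c
    unfolding f0_def by (rule inv_into_f_f) (auto intro: injI inj)
  have "c = 0" if "\<kappa> c \<in> Q" for c
  proof (rule ccontr)
    assume "c \<noteq> 0"
    then have "\<kappa> (inverse c) * \<kappa> c = 1" by (simp add: map_mult[symmetric])
    with Qmul[OF that] Q1 show False by metis
  qed
  then have "point_on Q (range \<kappa>) f0"
    unfolding point_on_def by (auto simp: f0 map_add[symmetric] map_mult[symmetric])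
  moreover obtain a where a: "a \<in> range \<kappa>" "a \<notin> Q" "\<And>f. point_on Q (range \<kappa>) f \<Longrightarrow> f a \<noteq> 0 \<Longrightarrow>
    \<exists>g. point_on Q (adjoin_list (range \<kappa>) ys) g \<and> g 1 \<noteq> 0"
    using point_on_adjoin_list[OF subalg_range Q _ Q1] fin by blast
  moreover have "f0 a \<noteq> 0" using a Q by (auto simp: f0 prime_in_def)
  ultimately obtain g where g: "point_on Q UNIV g" using fin by auto
  then have add: "g (x + y) = g x + g y" and mult: "g (x * y) = g x * g y" and const: "g (\<kappa> c) = c"
    and zero: "x \<in> Q \<Longrightarrow> g x = 0" for x y c
    by (auto simp: point_on_def)
  have "prime_in UNIV {x. g x = 0}"
    unfolding prime_in_def using const[of 0] const[of 1] by (auto simp: add mult)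
  with max[OF this] zero have "{x. g x = 0} = Q" by auto
  then have "g x = 0 \<longleftrightarrow> x \<in> Q" for x by blast
  from that[OF add mult const this] show thesis .
qed

end

section \<open>Counting independent derivations along a tower of generators and along a chain of
  primes\<close>

section \<open>Derivations of subalgebras of a field\<close>

locale field_algebra = algebra_map \<kappa>
  for \<kappa> :: "'k :: Fields.field \<Rightarrow> 'l :: Fields.field"
begin

definition derivation_on :: "'l set \<Rightarrow> ('l \<Rightarrow> 'l) \<Rightarrow> bool"
  where "derivation_on A D \<longleftrightarrow> (\<forall>x\<in>A. \<forall>y\<in>A. D (x + y) = D x + D y) \<and>
    (\<forall>x\<in>A. \<forall>y\<in>A. D (x * y) = D x * y + x * D y) \<and> (\<forall>c. D (\<kappa> c) = 0)"

definition independent_derivations :: "'l set \<Rightarrow> nat set \<Rightarrow> (nat \<Rightarrow> 'l \<Rightarrow> 'l) \<Rightarrow> bool"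
  where "independent_derivations A I D \<longleftrightarrow> (\<forall>i\<in>I. derivation_on A (D i)) \<and>
    (\<forall>l. (\<forall>x\<in>A. (\<Sum>i\<in>I. l i * D i x) = 0) \<longrightarrow> (\<forall>i\<in>I. l i = 0))"

lemma derivation_on_zero: "derivation_on A D \<Longrightarrow> D 0 = 0"
  unfolding derivation_on_def by (metis map_zero)

lemma derivation_on_trivial: "derivation_on A (\<lambda>_. 0)"
  by (simp add: derivation_on_def)

lemma derivation_on_lincomb:
  assumes "derivation_on A D" "derivation_on A E"
  shows "derivation_on A (\<lambda>x. D x - c * E x)"
  using assms by (auto simp: derivation_on_def algebra_simps)

text \<open>The chain rule: the value at \<open>poly p y\<close> forced on an extension of
  \<open>D\<close> that sends \<open>y\<close> to \<open>b\<close>.\<close>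

definition lift_value :: "('l \<Rightarrow> 'l) \<Rightarrow> 'l \<Rightarrow> 'l \<Rightarrow> 'l poly \<Rightarrow> 'l"
  where "lift_value D y b p = poly (map_poly D p) y + poly (pderiv p) y * b"

context
  fixes A D assumes A: "subalg A" and D: "derivation_on A D"
begin

lemma map_poly_derivation_add:
  "p \<in> polys_over A \<Longrightarrow> q \<in> polys_over A \<Longrightarrow> map_poly D (p + q) = map_poly D p + map_poly D q"
  using D by (intro poly_eqI)
    (auto simp: coeff_map_poly derivation_on_zero[OF D] derivation_on_def polys_over_def)

lemma map_poly_derivation_smult:
  "c \<in> A \<Longrightarrow> q \<in> polys_over A \<Longrightarrow>
    map_poly D (smult c q) = smult (D c) q + smult c (map_poly D q)"
  using D by (intro poly_eqI)
    (auto simp: coeff_map_poly derivation_on_zero[OF D] derivation_on_def polys_over_def)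

lemma map_poly_derivation_mult:
  assumes "p \<in> polys_over A" "q \<in> polys_over A"
  shows "map_poly D (p * q) = map_poly D p * q + p * map_poly D q"
  using assms(1)
proof (induction p)
  case 0
  then show ?case by simp
next
  case (pCons a p)
  then have p: "a \<in> A" "p \<in> polys_over A" using A by auto
  then have pq: "smult a q \<in> polys_over A" "pCons 0 (p * q) \<in> polys_over A"
    using assms A by (auto intro: polys_over_smult polys_over_mult)
  show ?case
    using pCons.IH[OF p(2)] p assms(2) derivation_on_zero[OF D]
    by (simp add: mult_pCons_left map_poly_derivation_add[OF pq] map_poly_derivation_smult
        map_poly_pCons algebra_simps)
qed

lemma lift_value_add:
  "p \<in> polys_over A \<Longrightarrow> q \<in> polys_over A \<Longrightarrow>
    lift_value D y b (p + q) = lift_value D y b p + lift_value D y b q"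
  by (simp add: lift_value_def map_poly_derivation_add pderiv_add algebra_simps)

lemma lift_value_mult:
  "p \<in> polys_over A \<Longrightarrow> q \<in> polys_over A \<Longrightarrow>
    lift_value D y b (p * q) = lift_value D y b p * poly q y + poly p y * lift_value D y b q"
  by (simp add: lift_value_def map_poly_derivation_mult pderiv_mult algebra_simps)

lemma derivation_extend:
  assumes well: "\<And>p. p \<in> polys_over A \<Longrightarrow> poly p y = 0 \<Longrightarrow> lift_value D y b p = 0"
  shows "\<exists>E. derivation_on (adjoin A y) E \<and> (\<forall>a\<in>A. E a = D a) \<and> E y = b"
proof -
  define E where "E v = lift_value D y b (SOME p. p \<in> polys_over A \<and> poly p y = v)" for v
  have E: "E (poly p y) = lift_value D y b p" if p: "p \<in> polys_over A" for p
  proof -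
    define q where "q = (SOME q. q \<in> polys_over A \<and> poly q y = poly p y)"
    have q: "q \<in> polys_over A \<and> poly q y = poly p y" unfolding q_def by (rule someI_ex) (use p in auto)
    have mem: "q - p \<in> polys_over A" using q p A by (intro polys_over_diff) auto
    then have "lift_value D y b (q - p) = 0" using q by (intro well) auto
    moreover have "lift_value D y b ((q - p) + p) = lift_value D y b (q - p) + lift_value D y b p"
      using mem p by (rule lift_value_add)
    ultimately show ?thesis by (simp add: E_def q_def[symmetric])
  qed
  have "E (x + z) = E x + E z \<and> E (x * z) = E x * z + x * E z"
    if xz: "x \<in> adjoin A y" "z \<in> adjoin A y" for x z
  proof -
    from xz obtain p q where pq: "p \<in> polys_over A" "q \<in> polys_over A" "x = poly p y" "z = poly q y"
      by (auto simp: adjoin_def)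
    have "p + q \<in> polys_over A" "p * q \<in> polys_over A" using pq A polys_over_add polys_over_mult by blast+
    from E[OF this(1)] E[OF this(2)] show ?thesis
      using pq by (simp add: E lift_value_add lift_value_mult)
  qed
  moreover have const: "E a = D a" if "a \<in> A" for a
    using E[of "[:a:]"] A that derivation_on_zero[OF D] by (simp add: map_poly_pCons lift_value_def pderiv_pCons)
  moreover have "E (\<kappa> c) = 0" for c
    using const[OF subalg_map[OF A, of c]] D by (simp add: derivation_on_def)
  moreover have "E y = b"
    using E[of "[:0, 1:]"] A D derivation_on_zero[OF D] map_one
    by (simp add: map_poly_pCons lift_value_def pderiv_pCons derivation_on_def) (metis map_one add.left_neutral mult_zero_right)
  ultimately show ?thesis unfolding derivation_on_def by blast
qed

text \<open>Checking \<open>G\<close> alone suffices: a power of its leading coefficient turns every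
  relation of \<open>y\<close> into a multiple of \<open>G\<close>, and this factor cancels because
  the values lie in a field.\<close>

lemma derivation_extend_algebraic:
  assumes G: "G \<in> polys_over A" "poly G y = 0" "lead_coeff G \<noteq> 0"
    and div: "\<And>P. P \<in> polys_over A \<Longrightarrow> poly P y = 0 \<Longrightarrow>
      \<exists>N. \<exists>q\<in>polys_over A. smult (lead_coeff G ^ N) P = q * G"
    and b: "lift_value D y b G = 0"
  shows "\<exists>E. derivation_on (adjoin A y) E \<and> (\<forall>a\<in>A. E a = D a) \<and> E y = b"
proof (rule derivation_extend)
  fix p assume p: "p \<in> polys_over A" "poly p y = 0"
  from div[OF this] obtain N q where q: "q \<in> polys_over A" "smult (lead_coeff G ^ N) p = q * G"
    by blast
  have "lead_coeff G \<in> A" using G by (auto simp: polys_over_def)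
  then have c: "[:lead_coeff G ^ N:] \<in> polys_over A" using A by (auto intro: subalg_power)
  have "lift_value D y b ([:lead_coeff G ^ N:] * p) = lift_value D y b (q * G)" using q by simp
  then have "lead_coeff G ^ N * lift_value D y b p = 0"
    using p q G c b by (simp only: lift_value_mult) simp
  then show "lift_value D y b p = 0" using G by simp
qed

end

text \<open>Besides the extensions that kill \<open>y\<close> there is d/dy. Evaluating a relation
  at \<open>y\<close> isolates the coefficient of d/dy, and on \<open>A\<close> the others are
  independent by assumption.\<close>

lemma independent_derivations_adjoin_transcendental:
  assumes A: "subalg A" and D: "independent_derivations A {..<s} D"
    and trans: "\<And>p. p \<in> polys_over A \<Longrightarrow> poly p y = 0 \<Longrightarrow> p = 0"
  shows "\<exists>E. independent_derivations (adjoin A y) {..<Suc s} E"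
proof -
  have der: "derivation_on A (D i)" if "i < s" for i using D that by (auto simp: independent_derivations_def)
  have "\<forall>i. \<exists>E. i < s \<longrightarrow> derivation_on (adjoin A y) E \<and> (\<forall>a\<in>A. E a = D i a) \<and> E y = 0"
    using derivation_extend[OF A der, of _ y 0] trans by (metis lift_value_def map_poly_0 pderiv_0 poly_0 mult_zero_left add_0)
  then obtain E where E: "\<And>i. i < s \<Longrightarrow> derivation_on (adjoin A y) (E i)"
    "\<And>i a. i < s \<Longrightarrow> a \<in> A \<Longrightarrow> E i a = D i a" "\<And>i. i < s \<Longrightarrow> E i y = 0" by metis
  obtain F where F: "derivation_on (adjoin A y) F" "\<forall>a\<in>A. F a = 0" "F y = 1"
    using derivation_extend[OF A derivation_on_trivial, of y 1] trans
    by (metis lift_value_def map_poly_0 pderiv_0 poly_0 mult_zero_left add_0)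
  define H where "H i = (if i < s then E i else F)" for i
  have "\<forall>i\<in>{..<Suc s}. l i = 0" if l: "\<And>x. x \<in> adjoin A y \<Longrightarrow> (\<Sum>i<Suc s. l i * H i x) = 0" for l
  proof -
    have "(\<Sum>i<Suc s. l i * H i y) = l s" using E(3) F(3) by (simp add: H_def)
    then have ls: "l s = 0" using l[OF adjoin_mem[OF A]] by simp
    have "(\<Sum>i<s. l i * D i x) = 0" if "x \<in> A" for x
      using l[of x] that adjoin_subset[OF A, of y] E(2) ls by (auto simp: H_def)
    then show ?thesis using D ls unfolding independent_derivations_def by (auto simp: less_Suc_eq)
  qed
  moreover have "\<forall>i\<in>{..<Suc s}. derivation_on (adjoin A y) (H i)" using E F by (auto simp: H_def)
  ultimately show ?thesis unfolding independent_derivations_def by blast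
qed

text \<open>If \<open>y\<close> is inseparable over \<open>A\<close>, one of the derivations may fail to extend; it is then replaced
  by the new derivation that vanishes on \<open>A\<close> and maps \<open>y\<close> to \<open>1\<close>.\<close>

lemma independent_derivations_adjoin_algebraic:
  assumes A: "subalg A" and D: "independent_derivations A {..<s} D"
    and alg: "p0 \<in> polys_over A" "poly p0 y = 0" "p0 \<noteq> 0"
  shows "\<exists>E. independent_derivations (adjoin A y) {..<s} E"
proof -
  have der: "derivation_on A (D i)" if "i < s" for i using D that by (auto simp: independent_derivations_def)
  have indep: "l i = 0" if "\<And>x. x \<in> A \<Longrightarrow> (\<Sum>i<s. l i * D i x) = 0" "i < s" for l i
    using D that unfolding independent_derivations_def by auto
  have Q: "prime_in UNIV {0 :: 'l}" by (auto simp: prime_in_def)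
  have "coeff p0 (degree p0) \<notin> {0}" "poly p0 y \<in> {0}" using alg by auto
  from minimal_polynomial[OF A Q alg(1) this(2,1)] obtain G where
    G': "G \<in> polys_over A" "poly G y \<in> {0}" "lead_coeff G \<notin> {0}" and
    div': "\<And>P. P \<in> polys_over A \<Longrightarrow> poly P y \<in> {0} \<Longrightarrow> \<exists>N. \<exists>q\<in>polys_over A. \<exists>r\<in>polys_over A.
        smult (lead_coeff G ^ N) P = q * G + r \<and> (\<forall>i. coeff r i \<in> {0})"
    by blast
  from G' have G: "G \<in> polys_over A" "poly G y = 0" "lead_coeff G \<noteq> 0" by auto
  have div: "\<exists>N. \<exists>q\<in>polys_over A. smult (lead_coeff G ^ N) P = q * G"
    if P: "P \<in> polys_over A" "poly P y = 0" for P
  proof -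
    from div'[of P] P obtain N q r where "q \<in> polys_over A" "smult (lead_coeff G ^ N) P = q * G + r"
      "\<forall>i. coeff r i \<in> {0}" by blast
    moreover from this have "r = 0" by (intro poly_eqI) auto
    ultimately show ?thesis by auto
  qed
  \<comment> \<open>When the derivative of \<open>G\<close> vanishes at \<open>y\<close>,
    \<open>g i\<close> is the obstruction to extending \<open>D i\<close>.\<close>
  define g where "g i = poly (map_poly (D i) G) y" for i
  have ext: "\<exists>E. derivation_on (adjoin A y) E \<and> (\<forall>a\<in>A. E a = F a) \<and> E y = b"
    if "derivation_on A F" "poly (map_poly F G) y + poly (pderiv G) y * b = 0" for F b
    using derivation_extend_algebraic[OF A that(1) G div] that(2) by (auto simp: lift_value_def)
  show ?thesis
  proof (cases "poly (pderiv G) y = 0 \<and> (\<exists>i<s. g i \<noteq> 0)")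
    case False
    have "\<exists>E. derivation_on (adjoin A y) E \<and> (\<forall>a\<in>A. E a = D i a)" if i: "i < s" for i
    proof (cases "poly (pderiv G) y = 0")
      case True
      with False i have "g i = 0" by auto
      with True ext[OF der[OF i], of 0] show ?thesis by (auto simp: g_def)
    next
      case nz: False
      from ext[OF der[OF i], of "- g i / poly (pderiv G) y"] nz show ?thesis by (auto simp: g_def)
    qed
    then have "\<forall>i. \<exists>E. i < s \<longrightarrow> derivation_on (adjoin A y) E \<and> (\<forall>a\<in>A. E a = D i a)" by blast
    then obtain E where E: "\<And>i. i < s \<Longrightarrow> derivation_on (adjoin A y) (E i)"
      "\<And>i a. i < s \<Longrightarrow> a \<in> A \<Longrightarrow> E i a = D i a" by metis
    have "l i = 0" if l: "\<And>x. x \<in> adjoin A y \<Longrightarrow> (\<Sum>i<s. l i * E i x) = 0" and "i < s" for l i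
    proof (rule indep[OF _ \<open>i < s\<close>])
      fix x assume "x \<in> A"
      then show "(\<Sum>i<s. l i * D i x) = 0"
        using l[of x] adjoin_subset[OF A, of y] E(2) by auto
    qed
    then show ?thesis unfolding independent_derivations_def using E(1) by (intro exI[of _ E]) auto
  next
    case True
    then obtain i0 where i0: "i0 < s" "g i0 \<noteq> 0" and sep: "poly (pderiv G) y = 0" by blast
    \<comment> \<open>Subtracting a multiple of \<open>D i0\<close> removes every obstruction; it
      makes \<open>D' i0\<close> zero, and that slot goes to the new derivation
      \<open>F\<close>.\<close>
    define D' where "D' i x = D i x - g i / g i0 * D i0 x" for i x
    have D': "derivation_on A (D' i)" if "i < s" for i
      unfolding D'_def using der[OF that] der[OF i0(1)] by (rule derivation_on_lincomb)
    have "poly (map_poly (D' i) G) y = 0" if i: "i < s" for i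
    proof -
      have "map_poly (D' i) G = map_poly (D i) G - smult (g i / g i0) (map_poly (D i0) G)"
        using derivation_on_zero[OF der[OF i]] derivation_on_zero[OF der[OF i0(1)]]
        by (intro poly_eqI) (simp add: coeff_map_poly D'_def)
      then show ?thesis using i0 by (simp add: g_def[symmetric])
    qed
    then have "\<forall>i. \<exists>E. i < s \<longrightarrow> derivation_on (adjoin A y) E \<and> (\<forall>a\<in>A. E a = D' i a) \<and> E y = 0"
      using ext[OF D', of _ 0] by auto
    then obtain E where E: "\<And>i. i < s \<Longrightarrow> derivation_on (adjoin A y) (E i)"
      "\<And>i a. i < s \<Longrightarrow> a \<in> A \<Longrightarrow> E i a = D' i a" "\<And>i. i < s \<Longrightarrow> E i y = 0" by metis
    have "map_poly (\<lambda>_. 0 :: 'l) G = 0" by (intro poly_eqI) (simp add: coeff_map_poly)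
    then obtain F where F: "derivation_on (adjoin A y) F" "\<forall>a\<in>A. F a = 0" "F y = 1"
      using ext[OF derivation_on_trivial, of 1] sep by auto
    define H where "H i = (if i = i0 then F else E i)" for i
    have "l i = 0" if l: "\<And>x. x \<in> adjoin A y \<Longrightarrow> (\<Sum>i<s. l i * H i x) = 0" and "i < s" for l i
    proof -
      have "(\<Sum>i<s. l i * H i y) = l i0 * H i0 y + (\<Sum>i\<in>{..<s} - {i0}. l i * H i y)"
        using i0 by (intro sum.remove) auto
      also have "(\<Sum>i\<in>{..<s} - {i0}. l i * H i y) = 0"
        using E(3) by (intro sum.neutral) (auto simp: H_def)
      finally have l0: "l i0 = 0" using l[OF adjoin_mem[OF A]] F by (simp add: H_def)
      \<comment> \<open>Rewrites a combination of the \<open>D' i\<close> with i different from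
        \<open>i0\<close> as one of the \<open>D i\<close>, to which independence on
        \<open>A\<close> applies.\<close>
      define l' where "l' i = (if i = i0 then - (\<Sum>j\<in>{..<s} - {i0}. l j * (g j / g i0)) else l i)" for i
      have "(\<Sum>i<s. l' i * D i x) = 0" if x: "x \<in> A" for x
      proof -
        have "(\<Sum>i<s. l' i * D i x) = l' i0 * D i0 x + (\<Sum>i\<in>{..<s} - {i0}. l' i * D i x)"
          using i0 by (intro sum.remove) auto
        also have "(\<Sum>i\<in>{..<s} - {i0}. l' i * D i x) = (\<Sum>i\<in>{..<s} - {i0}. l i * D i x)"
          by (rule sum.cong) (auto simp: l'_def)
        also have "l' i0 * D i0 x + \<dots> = (\<Sum>i\<in>{..<s} - {i0}. l i * D' i x)"
          by (simp add: l'_def D'_def sum_distrib_left sum_distrib_right sum_subtractf algebra_simps)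
        also have "\<dots> = (\<Sum>i\<in>{..<s} - {i0}. l i * H i x)"
          using x E(2) by (intro sum.cong) (auto simp: H_def)
        also have "\<dots> = l i0 * H i0 x + \<dots>" using l0 by simp
        also have "\<dots> = (\<Sum>i<s. l i * H i x)"
          using i0 by (intro sum.remove[symmetric]) auto
        also have "\<dots> = 0" using l x adjoin_subset[OF A] by blast
        finally show ?thesis .
      qed
      from indep[of l' i, OF this \<open>i < s\<close>] l0 show ?thesis by (auto simp: l'_def split: if_splits)
    qed
    moreover have "\<forall>i\<in>{..<s}. derivation_on (adjoin A y) (H i)" using E F by (auto simp: H_def)
    ultimately show ?thesis unfolding independent_derivations_def by (intro exI[of _ H]) auto
  qed
qed

lemma independent_derivations_mono:
  assumes "independent_derivations A {..<Suc s} D"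
  shows "independent_derivations A {..<s} D"
proof -
  have "l i = 0" if l: "\<forall>x\<in>A. (\<Sum>i<s. l i * D i x) = 0" and i: "i < s" for l i
  proof -
    have "\<forall>x\<in>A. (\<Sum>i<Suc s. (if i < s then l i else 0) * D i x) = 0" using l by auto
    moreover have all: "\<And>l. \<forall>x\<in>A. (\<Sum>i<Suc s. l i * D i x) = 0 \<Longrightarrow> \<forall>i\<in>{..<Suc s}. l i = 0"
      using assms unfolding independent_derivations_def by blast
    ultimately have "\<forall>i\<in>{..<Suc s}. (if i < s then l i else 0) = 0"
      by (intro all[of "\<lambda>i. if i < s then l i else 0"])
    from bspec[OF this, of i] i show ?thesis by simp
  qed
  moreover have "\<forall>i\<in>{..<s}. derivation_on A (D i)"
    using assms unfolding independent_derivations_def by auto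
  ultimately show ?thesis unfolding independent_derivations_def by (meson lessThan_iff)
qed

lemma independent_derivations_adjoin_list:
  assumes "subalg A" "independent_derivations A {..<s} D"
  shows "\<exists>E. independent_derivations (adjoin_list A ys) {..<s} E"
  using assms
proof (induction ys arbitrary: A D)
  case Nil
  then show ?case by (auto simp: adjoin_list_def)
next
  case (Cons y ys)
  have "\<exists>E. independent_derivations (adjoin A y) {..<s} E"
  proof (cases "\<exists>p\<in>polys_over A. poly p y = 0 \<and> p \<noteq> 0")
    case True
    with independent_derivations_adjoin_algebraic[OF Cons.prems] show ?thesis by blast
  next
    case False
    with independent_derivations_adjoin_transcendental[OF Cons.prems] obtain E where
      "independent_derivations (adjoin A y) {..<Suc s} E" by blast
    then show ?thesis using independent_derivations_mono by blast
  qed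
  then show ?case using Cons.IH[OF subalg_adjoin[OF Cons.prems(1)]] by (auto simp: adjoin_list_def)
qed

text \<open>Elements \<open>z i \<in> P (i + 1) - P i\<close> of a chain of primes are algebraically independent: the
  lowest coefficient of a relation for \<open>z i\<close> over \<open>z (i + 1), \<dots>\<close> would lie in \<open>P (i + 1)\<close>.\<close>

lemma prime_chain_derivations:
  assumes B: "subalg B" and P: "\<And>i. i \<le> s \<Longrightarrow> prime_in B (P i)"
    and chain: "\<And>i. i < s \<Longrightarrow> P i \<subset> P (Suc i)"
  shows "\<exists>A D. subalg A \<and> A \<subseteq> B \<and> independent_derivations A {..<s} D"
proof -
  \<comment> \<open>The subalgebra grows from the top of the chain downwards; meeting the current
    prime only in 0 is what makes the next element transcendental over it.\<close>
  have "\<exists>A D. subalg A \<and> A \<subseteq> B \<and> A \<inter> P (s - n) \<subseteq> {0} \<and> independent_derivations A {..<n} D"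
    if "n \<le> s" for n
    using that
  proof (induction n)
    case 0
    have Ps: "prime_in B (P s)" using P by auto
    have "\<kappa> c = 0" if "\<kappa> c \<in> P s" for c
    proof (rule ccontr)
      assume "\<kappa> c \<noteq> 0"
      then have "c \<noteq> 0" by auto
      then have "\<kappa> (inverse c) * \<kappa> c = 1" by (simp add: map_mult[symmetric])
      moreover have "\<kappa> (inverse c) \<in> B" using B by (rule subalg_map)
      ultimately show False using Ps that unfolding prime_in_def by metis
    qed
    then have "range \<kappa> \<inter> P s \<subseteq> {0}" by auto
    moreover have "range \<kappa> \<subseteq> B" using B by (auto simp: subalg_def)
    moreover have "independent_derivations (range \<kappa>) {..<0} (\<lambda>_ _. 0)"
      by (auto simp: independent_derivations_def)
    ultimately show ?case using subalg_range by (intro exI) auto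
  next
    case (Suc n)
    then obtain A D where IH: "subalg A" "A \<subseteq> B" "A \<inter> P (s - n) \<subseteq> {0}"
      "independent_derivations A {..<n} D" by auto
    define i where "i = s - Suc n"
    have i: "i < s" "s - n = Suc i" using Suc.prems by (auto simp: i_def)
    from chain[OF i(1)] obtain z where z: "z \<in> P (Suc i)" "z \<notin> P i" by blast
    have Pi: "prime_in B (P i)" and PSi: "prime_in B (P (Suc i))" using P i by auto
    have zB: "z \<in> B" using z PSi by (auto simp: prime_in_def)
    have key: "p = 0" if "p \<in> polys_over A" "poly p z \<in> P i" for p
      using that
    proof (induction p)
      case (pCons a p)
      have a: "a \<in> A" and p: "p \<in> polys_over A" using pCons.prems(1) IH(1) by auto
      have pz: "poly p z \<in> B"
        using adjoin_least[OF IH(1) B IH(2) zB] adjoin_poly[OF IH(1) p] by auto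
      have "a + z * poly p z \<in> P i" using pCons.prems by simp
      then have 1: "a + z * poly p z \<in> P (Suc i)" using chain[OF i(1)] by auto
      have "- poly p z \<in> B" using pz B by (rule subalg_minus[rotated])
      then have "(- poly p z) * z \<in> P (Suc i)" using z PSi unfolding prime_in_def by blast
      with 1 have "(a + z * poly p z) + (- poly p z) * z \<in> P (Suc i)"
        using PSi unfolding prime_in_def by blast
      then have "a \<in> P (Suc i)" by simp
      with a IH(3) i have a0: "a = 0" by auto
      with pCons.prems have "z * poly p z \<in> P i" by simp
      with z zB pz Pi have "poly p z \<in> P i" unfolding prime_in_def by blast
      with pCons.IH p a0 show ?case by simp
    qed simp
    have "0 \<in> P i" using Pi by (simp add: prime_in_def)
    then have "\<exists>E. independent_derivations (adjoin A z) {..<Suc n} E"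
      using independent_derivations_adjoin_transcendental[OF IH(1,4)] key by simp
    moreover have "adjoin A z \<inter> P i \<subseteq> {0}"
    proof
      fix x assume "x \<in> adjoin A z \<inter> P i"
      then obtain p where "p \<in> polys_over A" "x = poly p z" "poly p z \<in> P i" by (auto simp: adjoin_def)
      with key[of p] show "x \<in> {0}" by simp
    qed
    moreover have "adjoin A z \<subseteq> B" using IH zB B by (intro adjoin_least)
    moreover have "subalg (adjoin A z)" using IH(1) by (rule subalg_adjoin)
    ultimately show ?case unfolding i_def by blast
  qed
  from this[of s] show ?thesis by auto
qed

end

section \<open>Syntactic polynomials, their differentials and a second-order Taylor formula\<close>

section \<open>Polynomial expressions\<close>

text \<open>One expression has to be evaluated in \<open>'a\<close>, in \<open>'a fps\<close> and in
  the fraction field of the latter, and derivations act on it formally; with syntax all of this is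
  recursion. In the uses below the first variables are the parameters and the next ones the
  dependent generators.\<close>

datatype 'k pexpr = PConst 'k | PVar nat | PAdd "'k pexpr" "'k pexpr" | PMul "'k pexpr" "'k pexpr"

primrec peval :: "('k \<Rightarrow> 'r :: comm_ring_1) \<Rightarrow> (nat \<Rightarrow> 'r) \<Rightarrow> 'k pexpr \<Rightarrow> 'r"
  where
    "peval \<kappa> a (PConst c) = \<kappa> c"
  | "peval \<kappa> a (PVar j) = a j"
  | "peval \<kappa> a (PAdd e f) = peval \<kappa> a e + peval \<kappa> a f"
  | "peval \<kappa> a (PMul e f) = peval \<kappa> a e * peval \<kappa> a f"

text \<open>The differential at \<open>a\<close>, applied to \<open>b\<close>, and the second-order remainder of the Taylor
  expansion at \<open>a + c b\<close>.\<close>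

primrec pdiff :: "('k \<Rightarrow> 'r :: comm_ring_1) \<Rightarrow> (nat \<Rightarrow> 'r) \<Rightarrow> (nat \<Rightarrow> 'r) \<Rightarrow> 'k pexpr \<Rightarrow> 'r"
  where
    "pdiff \<kappa> a b (PConst c) = 0"
  | "pdiff \<kappa> a b (PVar j) = b j"
  | "pdiff \<kappa> a b (PAdd e f) = pdiff \<kappa> a b e + pdiff \<kappa> a b f"
  | "pdiff \<kappa> a b (PMul e f) = pdiff \<kappa> a b e * peval \<kappa> a f + peval \<kappa> a e * pdiff \<kappa> a b f"

primrec premainder ::
    "('k \<Rightarrow> 'r :: comm_ring_1) \<Rightarrow> (nat \<Rightarrow> 'r) \<Rightarrow> (nat \<Rightarrow> 'r) \<Rightarrow> 'r \<Rightarrow> 'k pexpr \<Rightarrow> 'r"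
  where
    "premainder \<kappa> a b c (PConst _) = 0"
  | "premainder \<kappa> a b c (PVar _) = 0"
  | "premainder \<kappa> a b c (PAdd e f) = premainder \<kappa> a b c e + premainder \<kappa> a b c f"
  | "premainder \<kappa> a b c (PMul e f) =
      premainder \<kappa> a b c e * peval \<kappa> a f + peval \<kappa> a e * premainder \<kappa> a b c f
      + pdiff \<kappa> a b e * pdiff \<kappa> a b f
      + c * (premainder \<kappa> a b c e * pdiff \<kappa> a b f)
      + c * (pdiff \<kappa> a b e * premainder \<kappa> a b c f)
      + c\<^sup>2 * (premainder \<kappa> a b c e * premainder \<kappa> a b c f)"

definition unit_vec_fun :: "nat \<Rightarrow> nat \<Rightarrow> 'r :: comm_ring_1"
  where "unit_vec_fun j i = (if i = j then 1 else 0)"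

lemma sum_lessThan_plus:
  fixes f :: "nat \<Rightarrow> 'a :: comm_monoid_add"
  shows "(\<Sum>j<r + m. f j) = (\<Sum>j<r. f j) + (\<Sum>t<m. f (r + t))"
  by (induction m) (simp_all add: add.assoc)

lemma peval_taylor:
  "peval \<kappa> (\<lambda>j. a j + c * b j) e = peval \<kappa> a e + c * pdiff \<kappa> a b e + c\<^sup>2 * premainder \<kappa> a b c e"
  by (induction e) (simp_all add: algebra_simps power2_eq_square)

lemma pdiff_add: "pdiff \<kappa> a (\<lambda>j. b j + b' j) e = pdiff \<kappa> a b e + pdiff \<kappa> a b' e"
  by (induction e) (simp_all add: algebra_simps)

lemma pdiff_scale: "pdiff \<kappa> a (\<lambda>j. c * b j) e = c * pdiff \<kappa> a b e"
  by (induction e) (simp_all add: algebra_simps)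

lemma pdiff_zero: "pdiff \<kappa> a (\<lambda>_. 0) e = 0"
  by (induction e) simp_all

lemma pdiff_partials:
  assumes "\<And>j. n \<le> j \<Longrightarrow> b j = 0"
  shows "pdiff \<kappa> a b e = (\<Sum>j<n. b j * pdiff \<kappa> a (unit_vec_fun j) e)"
proof (induction e)
  case (PVar i)
  have "(\<Sum>j<n. b j * unit_vec_fun j i) = (\<Sum>j<n. if j = i then b j else 0)"
    by (rule sum.cong) (auto simp: unit_vec_fun_def)
  then show ?case using assms[of i] by (auto simp: not_le)
qed (simp_all add: sum.distrib sum_distrib_left sum_distrib_right algebra_simps)

lemma peval_hom:
  assumes "\<And>x y. h (x + y) = h x + h y" "\<And>x y. h (x * y) = h x * h y"
  shows "h (peval \<kappa> a e) = peval (\<lambda>c. h (\<kappa> c)) (\<lambda>j. h (a j)) e"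
  by (induction e) (simp_all add: assms)

lemma pdiff_hom:
  assumes "\<And>x y. h (x + y) = h x + h y" "\<And>x y. h (x * y) = h x * h y"
  shows "h (pdiff \<kappa> a b e) = pdiff (\<lambda>c. h (\<kappa> c)) (\<lambda>j. h (a j)) (\<lambda>j. h (b j)) e"
proof -
  have "h 0 = 0" using assms(1)[of 0 0] by simp
  then show ?thesis by (induction e) (simp_all add: assms peval_hom[of h])
qed

context algebra_map
begin

lemma peval_mem: "subalg A \<Longrightarrow> (\<And>j. a j \<in> A) \<Longrightarrow> peval \<kappa> a e \<in> A"
  by (induction e) (auto intro: subalg_add subalg_mult)

lemma subalg_range_peval: "subalg (range (peval \<kappa> a))"
proof -
  have "peval \<kappa> a e + peval \<kappa> a f \<in> range (peval \<kappa> a)" "peval \<kappa> a e * peval \<kappa> a f \<in> range (peval \<kappa> a)" for e f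
    using rangeI[of "peval \<kappa> a" "PAdd e f"] rangeI[of "peval \<kappa> a" "PMul e f"] by simp_all
  moreover have "\<kappa> c \<in> range (peval \<kappa> a)" for c using rangeI[of "peval \<kappa> a" "PConst c"] by simp
  ultimately show ?thesis unfolding subalg_def by auto
qed

lemma range_peval_mem: "a j \<in> range (peval \<kappa> a)"
  using rangeI[of "peval \<kappa> a" "PVar j"] by simp

end

context field_algebra
begin

lemma derivation_on_peval:
  assumes "subalg A" "derivation_on A D" "\<And>j. a j \<in> A"
  shows "D (peval \<kappa> a e) = pdiff \<kappa> a (\<lambda>j. D (a j)) e"
  using assms by (induction e) (auto simp: derivation_on_def peval_mem)

lemma derivation_on_sum:
  assumes "\<And>i. i \<in> I \<Longrightarrow> derivation_on A (D i)"
  shows "derivation_on A (\<lambda>x. \<Sum>i\<in>I. l i * D i x)"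
  using assms unfolding derivation_on_def
  by (auto simp: sum.distrib sum_distrib_left sum_distrib_right algebra_simps intro!: sum.neutral)

text \<open>The chain provides \<open>s\<close> independent derivations of the whole algebra. If s >
  r, some nontrivial combination \<open>F\<close> kills the first \<open>r\<close> generators;
  applying \<open>F\<close> to w = q(x, w) shows that the vector of the F(w) is annihilated by the
  Jacobian matrix. As \<Delta> is nonzero in a field, \<open>F\<close> kills all generators, which
  contradicts independence.\<close>

lemma prime_chain_length_le:
  assumes a: "\<And>j. r + m \<le> j \<Longrightarrow> a j = 0"
    and q: "\<And>j. j < m \<Longrightarrow> a (r + j) = peval \<kappa> a (q j)"
    and N: "\<And>i j. i < m \<Longrightarrow> j < m \<Longrightarrow>
      (\<Sum>l<m. N i l * ((if l = j then 1 else 0) - pdiff \<kappa> a (unit_vec_fun (r + j)) (q l)))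
        = (if i = j then \<Delta> else 0)"
    and \<Delta>: "\<Delta> \<noteq> 0"
    and P: "\<And>i. i \<le> s \<Longrightarrow> prime_in (range (peval \<kappa> a)) (P i)"
    and chain: "\<And>i. i < s \<Longrightarrow> P i \<subset> P (Suc i)"
  shows "s \<le> r"
proof (rule ccontr)
  assume "\<not> s \<le> r"
  define B where "B = range (peval \<kappa> a)"
  have B: "subalg B" unfolding B_def by (rule subalg_range_peval)
  have aB: "a j \<in> B" for j unfolding B_def by (rule range_peval_mem)
  obtain A D where A: "subalg A" "A \<subseteq> B" "independent_derivations A {..<s} D"
    using prime_chain_derivations[of B s P] B P chain unfolding B_def by blast
  define as where "as = map a [0..<r + m]"
  have AB: "adjoin_list A as = B"
  proof
    show "adjoin_list A as \<subseteq> B"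
      using A B aB by (intro adjoin_list_least) (auto simp: as_def)
    have S: "subalg (adjoin_list A as)" using A(1) by (rule subalg_adjoin_list)
    have "a j \<in> adjoin_list A as" for j
    proof (cases "j < r + m")
      case True
      then have "a j \<in> set as" by (auto simp: as_def)
      then show ?thesis using adjoin_list_mem[OF A(1)] by blast
    next
      case False
      then show ?thesis using a S by simp
    qed
    then show "B \<subseteq> adjoin_list A as" unfolding B_def using peval_mem[OF S] by auto
  qed
  from independent_derivations_adjoin_list[OF A(1,3), of as] obtain E where
    E: "independent_derivations B {..<s} E" unfolding AB by blast
  from nontrivial_linear_relation[of "{..<r}" "{..<s}" "\<lambda>i j. E i (a j)"] \<open>\<not> s \<le> r\<close>
  obtain l where l: "\<exists>i\<in>{..<s}. l i \<noteq> 0" "\<forall>j\<in>{..<r}. (\<Sum>i\<in>{..<s}. l i * E i (a j)) = 0" by auto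
  define F where "F x = (\<Sum>i\<in>{..<s}. l i * E i x)" for x
  have F: "derivation_on B F" unfolding F_def
    using E by (intro derivation_on_sum) (auto simp: independent_derivations_def)
  have F0: "F (a j) = 0" if "j < r" for j using l that by (simp add: F_def)
  have F0': "F (a j) = 0" if "r + m \<le> j" for j
    using a[OF that] derivation_on_zero[OF F] by simp
  have Fw: "(\<Sum>t<m. ((if l = t then 1 else 0) - pdiff \<kappa> a (unit_vec_fun (r + t)) (q l)) * F (a (r + t))) = 0"
    if l: "l < m" for l
  proof -
    have "F (a (r + l)) = pdiff \<kappa> a (\<lambda>j. F (a j)) (q l)"
      using q[OF l] derivation_on_peval[OF B F aB] by simp
    also have "\<dots> = (\<Sum>j<r + m. F (a j) * pdiff \<kappa> a (unit_vec_fun j) (q l))"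
      using F0' by (rule pdiff_partials)
    also have "\<dots> = (\<Sum>j<r. F (a j) * pdiff \<kappa> a (unit_vec_fun j) (q l))
        + (\<Sum>t<m. F (a (r + t)) * pdiff \<kappa> a (unit_vec_fun (r + t)) (q l))"
      by (rule sum_lessThan_plus)
    also have "(\<Sum>j<r. F (a j) * pdiff \<kappa> a (unit_vec_fun j) (q l)) = 0"
      using F0 by simp
    finally have 1: "F (a (r + l)) = (\<Sum>t<m. F (a (r + t)) * pdiff \<kappa> a (unit_vec_fun (r + t)) (q l))" by simp
    have "(\<Sum>t<m. (if l = t then 1 else 0) * F (a (r + t))) = (\<Sum>t<m. if t = l then F (a (r + t)) else 0)"
      by (rule sum.cong) auto
    then have 2: "(\<Sum>t<m. (if l = t then 1 else 0) * F (a (r + t))) = F (a (r + l))"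
      using l by simp
    have "(\<Sum>t<m. ((if l = t then 1 else 0) - pdiff \<kappa> a (unit_vec_fun (r + t)) (q l)) * F (a (r + t))) =
      (\<Sum>t<m. (if l = t then 1 else 0) * F (a (r + t)) - F (a (r + t)) * pdiff \<kappa> a (unit_vec_fun (r + t)) (q l))"
      by (rule sum.cong) (simp_all add: left_diff_distrib)
    also have "\<dots> = F (a (r + l)) - F (a (r + l))"
      unfolding sum_subtractf 1[symmetric] using 2 by simp
    finally show ?thesis by simp
  qed
  have "F (a (r + i)) = 0" if i: "i < m" for i
  proof -
    have "0 = (\<Sum>l<m. N i l *
        (\<Sum>t<m. ((if l = t then 1 else 0) - pdiff \<kappa> a (unit_vec_fun (r + t)) (q l)) * F (a (r + t))))"
      using Fw by simp
    also have "\<dots> = (\<Sum>t<m. (\<Sum>l<m. N i l *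
        ((if l = t then 1 else 0) - pdiff \<kappa> a (unit_vec_fun (r + t)) (q l))) * F (a (r + t)))"
      unfolding sum_distrib_left sum_distrib_right by (subst sum.swap) (simp only: mult.assoc)
    also have "\<dots> = (\<Sum>t<m. (if i = t then \<Delta> else 0) * F (a (r + t)))"
      using N i by (intro sum.cong) auto
    also have "\<dots> = (\<Sum>t<m. if t = i then \<Delta> * F (a (r + t)) else 0)"
      by (rule sum.cong) auto
    also have "\<dots> = \<Delta> * F (a (r + i))" using i by simp
    finally show ?thesis using \<Delta> by simp
  qed
  then have "F (a j) = 0" for j
    using F0[of j] F0'[of j] by (metis add_diff_inverse_nat nat_add_left_cancel_less not_le)
  then have "F x = 0" if "x \<in> B" for x
    using that derivation_on_peval[OF B F aB] by (auto simp: B_def pdiff_zero)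
  with E l(1) show False unfolding independent_derivations_def F_def by blast
qed

end

section \<open>X-adic estimates and a fixed point theorem\<close>

section \<open>Solving equations in power series rings\<close>

text \<open>A lower bound for the order, phrased so that the zero series needs no special
  case.\<close>

definition fps_vanish :: "nat \<Rightarrow> 'r :: comm_ring_1 fps \<Rightarrow> bool"
  where "fps_vanish k f \<longleftrightarrow> (\<forall>n<k. f $ n = 0)"

lemma fps_vanish_0 [simp]: "fps_vanish 0 f" and fps_vanish_zero [simp]: "fps_vanish k 0"
  by (simp_all add: fps_vanish_def)

lemma fps_vanish_mono: "fps_vanish k f \<Longrightarrow> j \<le> k \<Longrightarrow> fps_vanish j f"
  by (simp add: fps_vanish_def)

lemma fps_vanish_add: "fps_vanish k f \<Longrightarrow> fps_vanish k g \<Longrightarrow> fps_vanish k (f + g)"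
  and fps_vanish_diff: "fps_vanish k f \<Longrightarrow> fps_vanish k g \<Longrightarrow> fps_vanish k (f - g)"
  by (simp_all add: fps_vanish_def)

lemma fps_vanish_sum: "(\<And>s. s \<in> S \<Longrightarrow> fps_vanish k (f s)) \<Longrightarrow> fps_vanish k (sum f S)"
  by (induction S rule: infinite_finite_induct) (auto intro: fps_vanish_add)

lemma fps_vanish_mult:
  assumes "fps_vanish j f" "fps_vanish k g"
  shows "fps_vanish (j + k) (f * g)"
  unfolding fps_vanish_def
proof (intro allI impI)
  fix n assume n: "n < j + k"
  have "f $ i * g $ (n - i) = 0" if "i \<le> n" for i
  proof (cases "i < j")
    case True
    then show ?thesis using assms by (simp add: fps_vanish_def)
  next
    case False
    then have "n - i < k" using n that by auto
    then show ?thesis using assms by (simp add: fps_vanish_def)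
  qed
  then show "(f * g) $ n = 0" by (simp add: fps_mult_nth)
qed

lemma fps_vanish_mult_left: "fps_vanish k g \<Longrightarrow> fps_vanish k (f * g)"
  using fps_vanish_mult[of 0 f k g] by simp

lemma fps_vanish_mult_right: "fps_vanish k g \<Longrightarrow> fps_vanish k (g * f)"
  using fps_vanish_mult[of k g 0 f] by simp

lemma fps_vanish_mult_diff:
  assumes "fps_vanish i F" "fps_vanish j G'" "fps_vanish k (F - F')" "fps_vanish l (G - G')"
    and "n \<le> i + l" "n \<le> k + j"
  shows "fps_vanish n (F * G - F' * G')"
proof -
  have "fps_vanish n (F * (G - G'))" "fps_vanish n ((F - F') * G')"
    using fps_vanish_mult[OF assms(1,4)] fps_vanish_mult[OF assms(3,2)] assms(5,6)
    by (auto intro: fps_vanish_mono)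
  then have "fps_vanish n (F * (G - G') + (F - F') * G')" by (rule fps_vanish_add)
  then show ?thesis by (simp add: algebra_simps)
qed

text \<open>Banach's principle in the X-adic topology: each application of \<Psi> gains one order of
  agreement, so coefficient \<open>n\<close> is final from the \<open>n\<close>-th iterate on and
  the limit can be taken coefficientwise.\<close>

lemma fps_contraction_fixpoint:
  fixes \<Psi> :: "(nat \<Rightarrow> 'r :: comm_ring_1 fps) \<Rightarrow> nat \<Rightarrow> 'r fps"
  assumes vanish: "\<And>z i. (\<And>i. fps_vanish 1 (z i)) \<Longrightarrow> fps_vanish 1 (\<Psi> z i)"
    and contraction: "\<And>z z' k i. (\<And>i. fps_vanish 1 (z i)) \<Longrightarrow> (\<And>i. fps_vanish 1 (z' i)) \<Longrightarrow>
      (\<And>i. fps_vanish (Suc k) (z i - z' i)) \<Longrightarrow> fps_vanish (Suc (Suc k)) (\<Psi> z i - \<Psi> z' i)"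
  obtains z where "\<And>i. fps_vanish 1 (z i)" "\<Psi> z = z"
proof -
  define zs where "zs n = (\<Psi> ^^ n) (\<lambda>_. 0)" for n
  have zs_Suc: "zs (Suc n) = \<Psi> (zs n)" for n by (simp add: zs_def)
  have v: "fps_vanish 1 (zs n i)" for n i
    by (induction n arbitrary: i) (simp add: zs_def, metis vanish zs_Suc)
  have step: "fps_vanish (Suc n) (zs (Suc n) i - zs n i)" for n i
  proof (induction n arbitrary: i)
    case 0
    then show ?case using v[of 1 i] by (simp add: zs_def)
  next
    case (Suc n)
    have "fps_vanish (Suc (Suc n)) (\<Psi> (zs (Suc n)) i - \<Psi> (zs n) i)"
      using v v Suc by (rule contraction)
    then show ?case by (simp only: zs_Suc)
  qed
  have stable: "zs (n + k) i $ n = zs n i $ n" for n k i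
  proof (induction k)
    case (Suc k)
    have "n < Suc (n + k)" by simp
    then have "(zs (Suc (n + k)) i - zs (n + k) i) $ n = 0"
      using step[of "n + k" i] unfolding fps_vanish_def by blast
    with Suc show ?case by simp
  qed simp
  define z where "z i = Abs_fps (\<lambda>n. zs n i $ n)" for i
  have zz: "fps_vanish (Suc n) (z i - zs n i)" for n i
    unfolding fps_vanish_def
  proof (intro allI impI)
    fix t assume "t < Suc n"
    then have "zs n i $ t = zs t i $ t" using stable[of t "n - t" i] by simp
    then show "(z i - zs n i) $ t = 0" by (simp add: z_def)
  qed
  have z1: "fps_vanish 1 (z i)" for i
    using zz[of 0 i] by (simp add: zs_def)
  have "\<Psi> z i $ n = z i $ n" for i n
  proof -
    have "fps_vanish (Suc (Suc n)) (\<Psi> z i - zs (Suc n) i)"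
      unfolding zs_Suc using z1 v zz by (rule contraction)
    from this zz[of "Suc n" i] have "fps_vanish (Suc (Suc n)) ((\<Psi> z i - zs (Suc n) i) - (z i - zs (Suc n) i))"
      by (rule fps_vanish_diff)
    then show ?thesis by (simp add: fps_vanish_def)
  qed
  then have "\<Psi> z = z" by (intro ext fps_ext)
  with z1 that show thesis by blast
qed

lemma fps_vanish_pdiff: "(\<And>j. fps_vanish k (b j)) \<Longrightarrow> fps_vanish k (pdiff \<kappa> a b e)"
  by (induction e) (auto intro: fps_vanish_add fps_vanish_mult_left fps_vanish_mult_right)

lemma fps_vanish_pdiff_diff:
  "(\<And>j. fps_vanish k (b j - b' j)) \<Longrightarrow> fps_vanish k (pdiff \<kappa> a b e - pdiff \<kappa> a b' e)"
proof -
  assume "\<And>j. fps_vanish k (b j - b' j)"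
  then have "fps_vanish k (pdiff \<kappa> a (\<lambda>j. b j - b' j) e)" by (rule fps_vanish_pdiff)
  moreover have "pdiff \<kappa> a b e = pdiff \<kappa> a (\<lambda>j. (b j - b' j) + b' j) e" by simp
  ultimately show ?thesis unfolding pdiff_add by simp
qed

lemma fps_vanish_premainder:
  assumes "\<And>j. fps_vanish 1 (b j)"
  shows "fps_vanish 2 (premainder \<kappa> a b c e)"
proof (induction e)
  case (PMul e f)
  have "fps_vanish (1 + 1) (pdiff \<kappa> a b e * pdiff \<kappa> a b f)"
    by (intro fps_vanish_mult fps_vanish_pdiff assms)
  then have "fps_vanish 2 (pdiff \<kappa> a b e * pdiff \<kappa> a b f)"
    by (simp only: one_add_one)
  moreover have "fps_vanish 2 (premainder \<kappa> a b c e * g)" "fps_vanish 2 (g * premainder \<kappa> a b c f)" for g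
    using PMul by (auto intro: fps_vanish_mult_left fps_vanish_mult_right)
  ultimately show ?case unfolding premainder.simps
    by (intro fps_vanish_add) (auto intro: fps_vanish_mult_left)
qed (auto intro: fps_vanish_add)

text \<open>The remainder has no terms of degree below two in \<open>b\<close>; if both arguments
  are divisible by X, a change of \<open>b\<close> in order k changes it only in order k + 1. This
  gain makes the Newton map contracting.\<close>

lemma fps_vanish_premainder_diff:
  assumes b: "\<And>j. fps_vanish 1 (b j)" "\<And>j. fps_vanish 1 (b' j)" "\<And>j. fps_vanish k (b j - b' j)"
  shows "fps_vanish (Suc k) (premainder \<kappa> a b c e - premainder \<kappa> a b' c e)"
proof (induction e)
  case (PAdd e f)
  from fps_vanish_add[OF this] show ?case by (simp add: add_diff_add)
next
  case (PMul e f)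
  note R = fps_vanish_premainder[of b \<kappa> a c, OF b(1)] and R' = fps_vanish_premainder[of b' \<kappa> a c, OF b(2)]
  note D = fps_vanish_pdiff[of 1 b \<kappa> a, OF b(1)] and D' = fps_vanish_pdiff[of 1 b' \<kappa> a, OF b(2)]
  note DD = fps_vanish_pdiff_diff[of k b b' \<kappa> a, OF b(3)]
  let ?R = "premainder \<kappa> a b c" and ?R' = "premainder \<kappa> a b' c"
  let ?D = "pdiff \<kappa> a b" and ?D' = "pdiff \<kappa> a b'"
  have 1: "fps_vanish (Suc k) ((?R e - ?R' e) * peval \<kappa> a f)"
    using PMul(1) by (rule fps_vanish_mult_right)
  have 2: "fps_vanish (Suc k) (peval \<kappa> a e * (?R f - ?R' f))"
    using PMul(2) by (rule fps_vanish_mult_left)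
  have 3: "fps_vanish (Suc k) (?D e * ?D f - ?D' e * ?D' f)"
    using D D' DD DD by (rule fps_vanish_mult_diff) auto
  have 4: "fps_vanish (Suc k) (c * (?R e * ?D f - ?R' e * ?D' f))"
    using R D' PMul(1) DD by (intro fps_vanish_mult_left) (rule fps_vanish_mult_diff, auto)
  have 5: "fps_vanish (Suc k) (c * (?D e * ?R f - ?D' e * ?R' f))"
    using D R' DD PMul(2) by (intro fps_vanish_mult_left) (rule fps_vanish_mult_diff, auto)
  have 6: "fps_vanish (Suc k) (c\<^sup>2 * (?R e * ?R f - ?R' e * ?R' f))"
    using R R' PMul by (intro fps_vanish_mult_left) (rule fps_vanish_mult_diff, auto)
  have *: "premainder \<kappa> a b c (PMul e f) - premainder \<kappa> a b' c (PMul e f) =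
      (?R e - ?R' e) * peval \<kappa> a f + peval \<kappa> a e * (?R f - ?R' f) + (?D e * ?D f - ?D' e * ?D' f)
      + c * (?R e * ?D f - ?R' e * ?D' f) + c * (?D e * ?R f - ?D' e * ?R' f)
      + c\<^sup>2 * (?R e * ?R f - ?R' e * ?R' f)"
    unfolding premainder.simps by (simp only: left_diff_distrib right_diff_distrib) simp
  show ?case unfolding * by (intro fps_vanish_add 1 2 3 4 5 6)
qed simp_all

no_notation vec_index (infixl \<open>$\<close> 100)

section \<open>Integrating tangent vectors\<close>

lemma fps_const_sum: "fps_const (sum f S) = (\<Sum>s\<in>S. fps_const (f s))"
  by (induction S rule: infinite_finite_induct) (simp_all add: fps_const_add[symmetric] del: fps_const_add)

locale domain_algebra = algebra_map \<iota>
  for \<iota> :: "'k :: Fields.field \<Rightarrow> 'a :: idom"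
begin

abbreviation fps_map :: "'k \<Rightarrow> 'a fps"
  where "fps_map c \<equiv> fps_const (\<iota> c)"

text \<open>A Hasse--Schmidt derivation D_0 = id, D_1, D_2, ... is encoded by its generating series,
  which sends f to the sum of the D_n(f) X^n; the product rules become multiplicativity.\<close>

definition hasse_schmidt :: "('a \<Rightarrow> 'a fps) \<Rightarrow> bool"
  where "hasse_schmidt \<phi> \<longleftrightarrow> (\<forall>x y. \<phi> (x + y) = \<phi> x + \<phi> y) \<and> (\<forall>x y. \<phi> (x * y) = \<phi> x * \<phi> y) \<and>
    (\<forall>c. \<phi> (\<iota> c) = fps_map c) \<and> (\<forall>x. \<phi> x $ 0 = x)"

lemma algebra_map_fps: "algebra_map fps_map"
  by unfold_locales (simp_all add: map_add map_mult fps_const_add[symmetric] fps_const_mult[symmetric]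
      del: fps_const_add fps_const_mult)

lemma field_algebra_fract: "field_algebra (\<lambda>c. Fract (fps_map c) 1)"
proof -
  interpret F: algebra_map fps_map by (rule algebra_map_fps)
  show ?thesis
    by unfold_locales (simp_all add: F.map_add F.map_mult One_fract_def del: fps_const_add fps_const_mult)
qed

text \<open>Newton iteration: \<open>x\<close> is moved to \<open>x + \<Delta>\<^sup>2 v X\<close> and \<open>w\<close> to \<open>w + \<Delta> z\<close>, where \<open>\<Delta>\<close> is the Jacobian
  determinant; in this scaling the equation for \<open>z\<close> needs no division.\<close>

lemma lift_solution:
  assumes a: "\<And>j. r + m \<le> j \<Longrightarrow> a j = 0"
    and q: "\<And>j. j < m \<Longrightarrow> a (r + j) = peval \<iota> a (q j)"
    and \<Delta>: "\<Delta> = fun_det m (\<lambda>l j. (if l = j then 1 else 0) - pdiff \<iota> a (unit_vec_fun (r + j)) (q l))"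
  obtains a' where "\<And>j. r + m \<le> j \<Longrightarrow> a' j = 0" "\<And>j. a' j $ 0 = a j"
    "\<And>j. j < m \<Longrightarrow> a' (r + j) = peval fps_map a' (q j)"
    "\<And>i. i < r \<Longrightarrow> a' i $ 1 = \<Delta>\<^sup>2 * \<iota> (v i)"
proof -
  define M where "M l j = (if l = j then 1 else 0) - pdiff \<iota> a (unit_vec_fun (r + j)) (q l)" for l j
  obtain N where N: "\<And>i j. i < m \<Longrightarrow> j < m \<Longrightarrow> (\<Sum>l<m. M i l * N l j) = (if i = j then \<Delta> else 0)"
    using fun_det_adjugate[of m M] unfolding \<Delta> M_def by blast
  define ac where "ac j = fps_const (a j)" for j
  define c where "c = fps_const \<Delta>"
  define bX where "bX j = (if j < r then fps_map (v j) * fps_X else 0)" for j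
  define bz where "bz z j = (if r \<le> j \<and> j < r + m then z (j - r) else 0)" for z :: "nat \<Rightarrow> 'a fps" and j
  define b where "b z j = c * bX j + bz z j" for z j
  \<comment> \<open>With M the identity minus the Jacobian of \<open>q\<close> in the dependent
    variables, Taylor's formula turns the equations into M z = \<Delta> R, where R collects the
    first-order term in \<open>bX\<close> and the remainder. Since M N = \<Delta>, it suffices to
    solve z = N R, whose right-hand side is \<open>\<Psi> z\<close>.\<close>
  define \<Psi> where "\<Psi> z i = (if i < m then \<Sum>l<m. fps_const (N i l) *
    (pdiff fps_map ac bX (q l) + premainder fps_map ac (b z) c (q l)) else 0)" for z i
  have bX: "fps_vanish 1 (bX j)" for j by (simp add: bX_def fps_vanish_def)
  have b1: "fps_vanish 1 (b z j)" if "\<And>i. fps_vanish 1 (z i)" for z j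
    unfolding b_def bz_def using bX that by (auto intro: fps_vanish_add fps_vanish_mult_left)
  have bd: "fps_vanish k (b z j - b z' j)" if "\<And>i. fps_vanish k (z i - z' i)" for k z z' j
    unfolding b_def bz_def using that by auto
  have "fps_vanish 1 (\<Psi> z i)" if z: "\<And>i. fps_vanish 1 (z i)" for z i
  proof -
    have "fps_vanish 1 (premainder fps_map ac (b z) c (q l))" for l
      using fps_vanish_premainder[of "b z", OF b1[OF z]] by (rule fps_vanish_mono) simp
    moreover have "fps_vanish 1 (pdiff fps_map ac bX (q l))" for l
      using bX by (rule fps_vanish_pdiff)
    ultimately show ?thesis unfolding \<Psi>_def
      by (auto intro!: fps_vanish_sum fps_vanish_mult_left fps_vanish_add)
  qed
  moreover have "fps_vanish (Suc (Suc k)) (\<Psi> z i - \<Psi> z' i)"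
    if z: "\<And>i. fps_vanish 1 (z i)" "\<And>i. fps_vanish 1 (z' i)" "\<And>i. fps_vanish (Suc k) (z i - z' i)"
    for z z' k i
  proof (cases "i < m")
    case True
    \<comment> \<open>The terms in \<open>bX\<close> do not depend on \<open>z\<close> and
      cancel.\<close>
    have "\<Psi> z i - \<Psi> z' i = (\<Sum>l<m. fps_const (N i l) *
        (premainder fps_map ac (b z) c (q l) - premainder fps_map ac (b z') c (q l)))"
      using True by (simp add: \<Psi>_def sum_subtractf[symmetric] algebra_simps)
    also have "fps_vanish (Suc (Suc k)) \<dots>"
      using fps_vanish_premainder_diff[of "b z" "b z'" "Suc k", OF b1[OF z(1)] b1[OF z(2)] bd[OF z(3)]]
      by (intro fps_vanish_sum fps_vanish_mult_left)
    finally show ?thesis .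
  qed (simp add: \<Psi>_def)
  ultimately obtain z where z: "\<And>i. fps_vanish 1 (z i)" "\<Psi> z = z"
    using fps_contraction_fixpoint[of \<Psi>] by blast
  define R where "R l = pdiff fps_map ac bX (q l) + premainder fps_map ac (b z) c (q l)" for l
  have zi: "z i = (\<Sum>l<m. fps_const (N i l) * R l)" if "i < m" for i
    using that fun_cong[OF z(2), of i] by (simp add: \<Psi>_def R_def)
  have hom_const: "fps_const (pdiff \<iota> a (unit_vec_fun j) e) = pdiff fps_map ac (unit_vec_fun j) e" for j e
  proof -
    have "(\<lambda>i. fps_const (unit_vec_fun j i :: 'a)) = unit_vec_fun j"
      by (rule ext) (simp add: unit_vec_fun_def)
    then show ?thesis
      using pdiff_hom[of fps_const \<iota> a "unit_vec_fun j" e] by (simp add: ac_def[abs_def])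
  qed
  have Mz: "(\<Sum>t<m. fps_const (M i t) * z t) = c * R i" if i: "i < m" for i
  proof -
    have "(\<Sum>t<m. fps_const (M i t) * z t) = (\<Sum>t<m. \<Sum>l<m. fps_const (M i t * N t l) * R l)"
      using zi by (simp add: sum_distrib_left mult.assoc[symmetric])
    also have "\<dots> = (\<Sum>l<m. fps_const (\<Sum>t<m. M i t * N t l) * R l)"
      by (subst sum.swap) (simp only: fps_const_sum sum_distrib_right)
    also have "\<dots> = (\<Sum>l<m. fps_const (if i = l then \<Delta> else 0) * R l)"
      using i N by (intro sum.cong) auto
    also have "\<dots> = (\<Sum>l<m. if l = i then c * R l else 0)"
      by (rule sum.cong) (auto simp: c_def)
    finally show ?thesis using i by simp
  qed
  define a' where "a' j = ac j + c * b z j" for j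
  have "a' (r + i) = peval fps_map a' (q i)" if i: "i < m" for i
  proof -
    have "pdiff fps_map ac (bz z) (q i) = (\<Sum>j<r + m. bz z j * pdiff fps_map ac (unit_vec_fun j) (q i))"
      by (rule pdiff_partials) (simp add: bz_def)
    also have "\<dots> = (\<Sum>j<r. bz z j * pdiff fps_map ac (unit_vec_fun j) (q i))
        + (\<Sum>t<m. bz z (r + t) * pdiff fps_map ac (unit_vec_fun (r + t)) (q i))"
      by (rule sum_lessThan_plus)
    also have "\<dots> = (\<Sum>t<m. z t * fps_const (pdiff \<iota> a (unit_vec_fun (r + t)) (q i)))"
      by (simp add: bz_def hom_const)
    also have "\<dots> = (\<Sum>t<m. (if i = t then 1 else 0) * z t - fps_const (M i t) * z t)"
      by (intro sum.cong) (auto simp: M_def fps_const_sub[symmetric] algebra_simps simp del: fps_const_sub)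
    also have "\<dots> = (\<Sum>t<m. (if i = t then 1 else 0) * z t) - c * R i"
      unfolding sum_subtractf Mz[OF i] ..
    also have "(\<Sum>t<m. (if i = t then 1 else 0) * z t) = (\<Sum>t<m. if t = i then z t else 0)"
      by (rule sum.cong) auto
    also have "\<dots> = z i" using i by simp
    finally have z_eq: "z i = pdiff fps_map ac (bz z) (q i) + c * R i" by simp
    have "pdiff fps_map ac (b z) (q i) = c * pdiff fps_map ac bX (q i) + pdiff fps_map ac (bz z) (q i)"
      unfolding b_def[abs_def] pdiff_add pdiff_scale ..
    then have "peval fps_map a' (q i) = peval fps_map ac (q i) + c * (c * pdiff fps_map ac bX (q i)
        + pdiff fps_map ac (bz z) (q i)) + c\<^sup>2 * premainder fps_map ac (b z) c (q i)"
      unfolding a'_def[abs_def] peval_taylor by simp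
    also have "\<dots> = peval fps_map ac (q i) + c * z i"
      unfolding z_eq R_def by (simp add: algebra_simps power2_eq_square)
    also have "peval fps_map ac (q i) = ac (r + i)"
      using peval_hom[of fps_const \<iota> a "q i"] q[OF i] by (simp add: ac_def[abs_def])
    finally have "peval fps_map a' (q i) = ac (r + i) + c * z i" .
    moreover have "b z (r + i) = z i" using i by (simp add: b_def bX_def bz_def)
    ultimately show ?thesis unfolding a'_def[of "r + i"] by simp
  qed
  moreover have "a' j = 0" if "r + m \<le> j" for j
    using that a by (simp add: a'_def ac_def b_def bX_def bz_def)
  moreover have "a' j $ 0 = a j" for j
  proof -
    have "fps_vanish 1 (b z j)" using z(1) by (rule b1)
    then show ?thesis by (simp add: a'_def ac_def c_def fps_vanish_def)
  qed
  moreover have "a' i $ 1 = \<Delta>\<^sup>2 * \<iota> (v i)" if "i < r" for i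
    using that by (simp add: a'_def ac_def c_def b_def bX_def bz_def power2_eq_square)
  ultimately show thesis using that[of a'] by blast
qed

text \<open>At the point the differentials of \<open>q\<close> in the dependent variables vanish, so
  the Jacobian evaluates to the identity and \<Delta> to 1; hence the first-order coefficient of the
  image of a parameter evaluates to \<open>v i\<close>. What remains is that the lifted generators
  satisfy every relation of the original ones.\<close>

lemma hasse_schmidt_exists:
  fixes ev :: "'a \<Rightarrow> 'k"
  assumes ev: "\<And>x y. ev (x + y) = ev x + ev y" "\<And>x y. ev (x * y) = ev x * ev y" "\<And>c. ev (\<iota> c) = c"
    and a: "\<And>j. r + m \<le> j \<Longrightarrow> a j = 0"
    and gen: "range (peval \<iota> a) = UNIV"
    and q: "\<And>j. j < m \<Longrightarrow> a (r + j) = peval \<iota> a (q j)"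
    and dq: "\<And>i j. i < m \<Longrightarrow> j < m \<Longrightarrow> ev (pdiff \<iota> a (unit_vec_fun (r + i)) (q j)) = 0"
    and P: "\<And>i. i \<le> d \<Longrightarrow> prime_in (UNIV :: 'a set) (P i)"
    and chain: "\<And>i. i < d \<Longrightarrow> P i \<subset> P (Suc i)"
    and r: "r \<le> d"
  obtains \<phi> where "hasse_schmidt \<phi>" "\<And>i. i < r \<Longrightarrow> ev (\<phi> (a i) $ 1) = v i"
proof -
  have ev0: "ev 0 = 0" and ev1: "ev 1 = 1" using ev(3)[of 0] ev(3)[of 1] by simp_all
  define M where "M l j = (if l = j then 1 else 0) - pdiff \<iota> a (unit_vec_fun (r + j)) (q l)" for l j
  define \<Delta> where "\<Delta> = fun_det m M"
  have evM: "ev (M l j) = (if l = j then 1 else 0)" if "l < m" "j < m" for l j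
  proof -
    have "ev (M l j) + ev (pdiff \<iota> a (unit_vec_fun (r + j)) (q l)) = ev (if l = j then 1 else 0)"
      unfolding ev(1)[symmetric] by (simp add: M_def)
    then show ?thesis using dq[OF that(2,1)] by (simp add: ev0 ev1 split: if_splits)
  qed
  have ev\<Delta>: "ev \<Delta> = 1"
    unfolding \<Delta>_def fun_det_hom[of ev, OF ev(1,2) ev1] using evM by (rule fun_det_one)
  obtain a' where a': "\<And>j. r + m \<le> j \<Longrightarrow> a' j = 0" "\<And>j. a' j $ 0 = a j"
    "\<And>j. j < m \<Longrightarrow> a' (r + j) = peval fps_map a' (q j)"
    "\<And>i. i < r \<Longrightarrow> a' i $ 1 = \<Delta>\<^sup>2 * \<iota> (v i)"
    using lift_solution[OF a q \<Delta>_def[unfolded M_def[abs_def]], of v] by blast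
  have nth0: "peval fps_map a' e $ 0 = peval \<iota> a e" for e
    using peval_hom[of "\<lambda>f. f $ 0" fps_map a' e] a'(2) by simp
  define F where "F s = Fract s (1 :: 'a fps)" for s
  have F_add: "F (s + t) = F s + F t" and F_mult: "F (s * t) = F s * F t" for s t
    by (simp_all add: F_def)
  have F_inj: "F s = F t \<longleftrightarrow> s = t" for s t by (simp add: F_def eq_fract)
  have F0: "F 0 = 0" and F1: "F 1 = 1" by (simp_all add: F_def Zero_fract_def One_fract_def)
  define \<kappa> where "\<kappa> c = F (fps_map c)" for c
  interpret L: field_algebra \<kappa>
    unfolding \<kappa>_def F_def by (rule field_algebra_fract)
  define aL where "aL j = F (a' j)" for j
  have pevalL: "peval \<kappa> aL e = F (peval fps_map a' e)" for e
    using peval_hom[of F fps_map a' e] F_add F_mult by (simp add: \<kappa>_def[abs_def] aL_def[abs_def])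
  have well: "peval fps_map a' e = 0" if e: "peval \<iota> a e = 0" for e
  proof (rule ccontr)
    assume nz: "peval fps_map a' e \<noteq> 0"
    define M' where "M' l j = (if l = j then 1 else 0) - pdiff fps_map a' (unit_vec_fun (r + j)) (q l)" for l j
    define \<Delta>' where "\<Delta>' = fun_det m M'"
    obtain N where N: "\<And>i j. i < m \<Longrightarrow> j < m \<Longrightarrow> (\<Sum>l<m. N i l * M' l j) = (if i = j then \<Delta>' else 0)"
      using fun_det_adjugate[of m M'] unfolding \<Delta>'_def by blast
    have "pdiff fps_map a' (unit_vec_fun j) e $ 0 = pdiff \<iota> a (unit_vec_fun j) e" for j e
    proof -
      have "(\<lambda>i. (unit_vec_fun j i :: 'a fps) $ 0) = unit_vec_fun j"
        by (rule ext) (simp add: unit_vec_fun_def)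
      then show ?thesis
        using pdiff_hom[of "\<lambda>f. f $ 0" fps_map a' "unit_vec_fun j" e] a'(2) by simp
    qed
    then have "M' l j $ 0 = M l j" for l j by (simp add: M'_def M_def)
    then have "\<Delta>' $ 0 = \<Delta>"
      unfolding \<Delta>'_def \<Delta>_def using fun_det_hom[of "\<lambda>f. f $ 0" m M'] by simp
    then have "\<Delta>' \<noteq> 0" using ev\<Delta> ev0 by auto
    then have "F \<Delta>' \<noteq> 0" using F_inj F0 by metis
    have F_sum: "F (\<Sum>l<m. g l) = (\<Sum>l<m. F (g l))" for g
      by (induction m) (simp_all add: F0 F_add)
    have F_M: "F (M' l j) = (if l = j then 1 else 0) - pdiff \<kappa> aL (unit_vec_fun (r + j)) (q l)" for l j
    proof -
      have "F (M' l j) + F (pdiff fps_map a' (unit_vec_fun (r + j)) (q l)) = (if l = j then 1 else 0)"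
        unfolding F_add[symmetric] by (simp add: M'_def F0 F1)
      moreover have "(\<lambda>i. F (unit_vec_fun (r + j) i)) = unit_vec_fun (r + j)"
        by (rule ext) (simp add: unit_vec_fun_def F0 F1)
      then have "F (pdiff fps_map a' (unit_vec_fun (r + j)) (q l)) = pdiff \<kappa> aL (unit_vec_fun (r + j)) (q l)"
        using pdiff_hom[of F fps_map a' "unit_vec_fun (r + j)" "q l"] F_add F_mult
        by (simp add: \<kappa>_def[abs_def] aL_def[abs_def])
      ultimately show ?thesis by (simp add: eq_diff_eq)
    qed
    \<comment> \<open>\<open>PP 0\<close> is zero, and \<open>PP (Suc i)\<close> is the preimage of
      \<open>P i\<close> under the constant-term map. The violated relation lies in
      \<open>PP 1\<close> but not in \<open>PP 0\<close>, which lengthens the chain by one.\<close>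
    define PP where "PP i = (case i of 0 \<Rightarrow> {0} | Suc i \<Rightarrow>
      {F (peval fps_map a' f) | f. peval \<iota> a f \<in> P i})" for i
    have PPS: "F (peval fps_map a' f) \<in> PP (Suc i) \<longleftrightarrow> peval \<iota> a f \<in> P i" for i f
      unfolding PP_def using F_inj nth0 by auto metis
    have prime: "prime_in (range (peval \<kappa> aL)) (PP i)" if i: "i \<le> Suc d" for i
    proof (cases i)
      case 0
      have "0 \<in> range (peval \<kappa> aL)" using L.subalg_zero[OF L.subalg_range_peval] .
      with 0 show ?thesis by (simp add: PP_def prime_in_def)
    next
      case (Suc i')
      with i P have Pi: "prime_in UNIV (P i')" by auto
      have sub: "PP i \<subseteq> range (peval \<kappa> aL)" using Suc by (auto simp: PP_def pevalL[symmetric])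
      have zero: "0 \<in> PP i" using PPS[of "PConst 0" i'] Pi Suc by (simp add: F0 prime_in_def)
      have one: "1 \<notin> PP i" using PPS[of "PConst 1" i'] Pi Suc by (simp add: F1 prime_in_def)
      have add: "x + y \<in> PP i" if "x \<in> PP i" "y \<in> PP i" for x y
      proof -
        from that sub have "x \<in> range (peval \<kappa> aL)" "y \<in> range (peval \<kappa> aL)" by auto
        then obtain f g where "x = F (peval fps_map a' f)" "y = F (peval fps_map a' g)"
          by (auto simp: pevalL)
        with that PPS[of f i'] PPS[of g i'] PPS[of "PAdd f g" i'] Pi Suc show ?thesis
          by (simp add: F_add prime_in_def)
      qed
      have mult: "b * x \<in> PP i" if "b \<in> range (peval \<kappa> aL)" "x \<in> PP i" for b x
      proof -
        from that sub have "b \<in> range (peval \<kappa> aL)" "x \<in> range (peval \<kappa> aL)" by auto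
        then obtain f g where "b = F (peval fps_map a' f)" "x = F (peval fps_map a' g)"
          by (auto simp: pevalL)
        with that PPS[of g i'] PPS[of "PMul f g" i'] Pi Suc show ?thesis
          by (simp add: F_mult prime_in_def)
      qed
      have pr: "x \<in> PP i \<or> y \<in> PP i"
        if "x \<in> range (peval \<kappa> aL)" "y \<in> range (peval \<kappa> aL)" "x * y \<in> PP i" for x y
      proof -
        from that obtain f g where "x = F (peval fps_map a' f)" "y = F (peval fps_map a' g)"
          by (auto simp: pevalL)
        with that PPS[of f i'] PPS[of g i'] PPS[of "PMul f g" i'] Pi Suc show ?thesis
          by (simp add: F_mult prime_in_def)
      qed
      show ?thesis unfolding prime_in_def
      proof (intro conjI ballI impI)
        fix x y assume "x \<in> range (peval \<kappa> aL)" "y \<in> range (peval \<kappa> aL)" "x * y \<in> PP i"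
        then show "x \<in> PP i \<or> y \<in> PP i" by (rule pr)
      qed (fact sub zero one | rule add mult; assumption)+
    qed
    have strict: "PP i \<subset> PP (Suc i)" if i: "i < Suc d" for i
    proof (cases i)
      case 0
      have "0 \<in> P 0" using P[of 0] by (simp add: prime_in_def)
      then have "F (peval fps_map a' e) \<in> PP 1" "0 \<in> PP 1"
        using PPS[of e 0] PPS[of "PConst 0" 0] e by (simp_all add: F0)
      moreover have "F (peval fps_map a' e) \<noteq> 0" using nz F_inj F0 by metis
      ultimately show ?thesis using 0 by (auto simp: PP_def[of 0])
    next
      case (Suc i')
      with i chain[of i'] obtain t where t: "t \<in> P i" "t \<notin> P i'" "P i' \<subseteq> P i" by auto
      from gen obtain f where "t = peval \<iota> a f" by (metis UNIV_I imageE)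
      with t PPS[of f i'] PPS[of f i] Suc have "F (peval fps_map a' f) \<in> PP (Suc i) - PP i" by auto
      moreover have "PP i \<subseteq> PP (Suc i)" using t(3) Suc by (auto simp: PP_def)
      ultimately show ?thesis by blast
    qed
    have "Suc d \<le> r"
    proof (rule L.prime_chain_length_le[where a = aL and m = m and q = q and N = "\<lambda>i l. F (N i l)" and \<Delta> = "F \<Delta>'" and P = PP])
      show "aL j = 0" if "r + m \<le> j" for j using a'(1)[OF that] by (simp add: aL_def F0)
      show "aL (r + j) = peval \<kappa> aL (q j)" if "j < m" for j
        unfolding pevalL using a'(3)[OF that] by (simp add: aL_def)
      show "(\<Sum>l<m. F (N i l) * ((if l = j then 1 else 0) - pdiff \<kappa> aL (unit_vec_fun (r + j)) (q l))) =
          (if i = j then F \<Delta>' else 0)" if "i < m" "j < m" for i j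
        unfolding F_M[symmetric] F_mult[symmetric] F_sum[symmetric] N[OF that] by (simp add: F0)
      show "F \<Delta>' \<noteq> 0" by fact
    qed (use prime strict in blast)+
    with r show False by simp
  qed
  have well': "peval fps_map a' e = peval fps_map a' f" if "peval \<iota> a e = peval \<iota> a f" for e f
  proof -
    have "peval \<iota> a (PAdd e (PMul (PConst (- 1)) f)) = 0" using that by (simp add: map_minus)
    from well[OF this] show ?thesis by (simp add: map_minus eq_neg_iff_add_eq_0[symmetric] fps_const_neg[symmetric] del: fps_const_neg)
  qed
  define \<phi> where "\<phi> x = peval fps_map a' (SOME e. peval \<iota> a e = x)" for x
  have \<phi>: "\<phi> (peval \<iota> a e) = peval fps_map a' e" for e
    unfolding \<phi>_def by (rule well') (rule someI[of _ e], simp)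
  have ex: "\<exists>e. x = peval \<iota> a e" for x using gen by (metis UNIV_I imageE)
  have "\<phi> (x + y) = \<phi> x + \<phi> y \<and> \<phi> (x * y) = \<phi> x * \<phi> y" for x y
  proof -
    obtain e f where "x = peval \<iota> a e" "y = peval \<iota> a f" using ex by blast
    then show ?thesis using \<phi>[of "PAdd e f"] \<phi>[of "PMul e f"] by (simp add: \<phi>)
  qed
  moreover have "\<phi> (\<iota> c) = fps_map c" for c using \<phi>[of "PConst c"] by simp
  moreover have "\<phi> x $ 0 = x" for x using ex[of x] \<phi> nth0 by auto
  ultimately have "hasse_schmidt \<phi>" by (simp add: hasse_schmidt_def)
  moreover have "ev (\<phi> (a i) $ 1) = v i" if "i < r" for i
    using \<phi>[of "PVar i"] a'(4)[OF that] ev\<Delta> by (simp add: ev power2_eq_square)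
  ultimately show thesis by (rule that)
qed

end

section \<open>Powers of an ideal\<close>

lemma type_ring_simps [simp]:
  "carrier (type_ring :: 'a :: comm_ring_1 ring) = UNIV"
  "x \<otimes>\<^bsub>(type_ring :: 'a ring)\<^esub> y = x * y" "x \<oplus>\<^bsub>(type_ring :: 'a ring)\<^esub> y = x + y"
  "\<zero>\<^bsub>(type_ring :: 'a ring)\<^esub> = 0" "\<one>\<^bsub>(type_ring :: 'a ring)\<^esub> = 1"
  by (simp_all add: ring_of_type_algebra_def)

lemma ideal_pow_0: "ideal_pow A J 0 = carrier A"
  and ideal_pow_Suc: "ideal_pow A J (Suc n) = ideal_prod A J (ideal_pow A J n)"
  by (simp_all add: ideal_pow_def)

definition ring_ideal :: "'a :: comm_ring_1 set \<Rightarrow> bool"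
  where "ring_ideal J \<longleftrightarrow> 0 \<in> J \<and> (\<forall>x\<in>J. \<forall>y\<in>J. x + y \<in> J) \<and> (\<forall>r. \<forall>x\<in>J. r * x \<in> J)"

abbreviation powI :: "'a :: comm_ring_1 set \<Rightarrow> nat \<Rightarrow> 'a set"
  where "powI J n \<equiv> ideal_pow type_ring J n"

context
  fixes J :: "'a :: comm_ring_1 set"
begin

lemma powI_0 [simp]: "powI J 0 = UNIV"
  by (simp add: ideal_pow_0)

lemma powI_Suc_induct [consumes 1, case_names prod add]:
  assumes "f \<in> powI J (Suc n)"
    and "\<And>q g. q \<in> J \<Longrightarrow> g \<in> powI J n \<Longrightarrow> P (q * g)"
    and "\<And>f g. P f \<Longrightarrow> P g \<Longrightarrow> f \<in> powI J (Suc n) \<Longrightarrow> g \<in> powI J (Suc n) \<Longrightarrow> P (f + g)"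
  shows "P f"
  using assms(1) unfolding ideal_pow_Suc
proof (induction rule: ideal_prod.induct)
  case (sum f g)
  then show ?case using assms(3)[of f g] by (simp add: ideal_pow_Suc)
qed (simp add: assms(2))

lemma powI_prod: "q \<in> J \<Longrightarrow> g \<in> powI J n \<Longrightarrow> q * g \<in> powI J (Suc n)"
  using ideal_prod.prod[of q J g "powI J n" type_ring] by (simp add: ideal_pow_Suc)

lemma powI_add: "f \<in> powI J n \<Longrightarrow> g \<in> powI J n \<Longrightarrow> f + g \<in> powI J n"
  using ideal_prod.sum[of f type_ring J _ g] by (cases n) (auto simp: ideal_pow_Suc)

context
  assumes J: "ring_ideal J"
begin

lemma powI_mult_left: "f \<in> powI J n \<Longrightarrow> r * f \<in> powI J n"
proof (cases n)
  case (Suc n')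
  assume "f \<in> powI J n"
  then have "f \<in> powI J (Suc n')" using Suc by simp
  then have "r * f \<in> powI J (Suc n')"
  proof (induction rule: powI_Suc_induct)
    case (prod q g)
    then have "(r * q) * g \<in> powI J (Suc n')" using J by (intro powI_prod) (auto simp: ring_ideal_def)
    then show ?case by (simp add: mult.assoc)
  qed (simp add: distrib_left powI_add)
  with Suc show ?thesis by simp
qed simp

lemma powI_zero [simp]: "0 \<in> powI J n"
proof (induction n)
  case (Suc n)
  from powI_prod[OF _ this, of 0] J show ?case by (simp add: ring_ideal_def)
qed simp

lemma powI_minus: "f \<in> powI J n \<Longrightarrow> - f \<in> powI J n"
  using powI_mult_left[of f n "- 1"] by simp

lemma powI_diff: "f \<in> powI J n \<Longrightarrow> g \<in> powI J n \<Longrightarrow> f - g \<in> powI J n"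
  using powI_add[of f n "- g"] powI_minus[of g n] by simp

lemma powI_sum: "(\<And>s. s \<in> S \<Longrightarrow> f s \<in> powI J n) \<Longrightarrow> sum f S \<in> powI J n"
  by (induction S rule: infinite_finite_induct) (auto intro: powI_add)

lemma powI_Suc_subset: "powI J (Suc n) \<subseteq> powI J n"
proof
  fix f assume "f \<in> powI J (Suc n)"
  then show "f \<in> powI J n"
    by (induction rule: powI_Suc_induct) (auto intro: powI_mult_left powI_add)
qed

lemma powI_mono: "m \<le> n \<Longrightarrow> f \<in> powI J n \<Longrightarrow> f \<in> powI J m"
  using lift_Suc_antimono_le[of "powI J", OF powI_Suc_subset] by blast

lemma powI_1: "powI J (Suc 0) = J"
proof
  show "powI J (Suc 0) \<subseteq> J"
  proof
    fix f assume "f \<in> powI J (Suc 0)"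
    then show "f \<in> J"
    proof (induction rule: powI_Suc_induct)
      case (prod q g)
      then have "g * q \<in> J" using J by (simp add: ring_ideal_def)
      then show ?case by (simp add: mult.commute)
    qed (use J in \<open>simp add: ring_ideal_def\<close>)
  qed
  show "J \<subseteq> powI J (Suc 0)" using powI_prod[of _ 1 0] by auto
qed

lemma powI_mult:
  assumes "f \<in> powI J m" "g \<in> powI J n"
  shows "f * g \<in> powI J (m + n)"
  using assms(1)
proof (induction m arbitrary: f)
  case 0
  then show ?case using assms(2) by (simp add: powI_mult_left)
next
  case (Suc m)
  from Suc.prems show ?case
  proof (induction rule: powI_Suc_induct)
    case (prod q h)
    then show ?case using powI_prod[OF prod(1) Suc.IH[OF prod(2)]] by (simp add: mult.assoc)
  qed (simp add: distrib_right powI_add)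
qed

lemma powI_power: "f \<in> powI J m \<Longrightarrow> f ^ n \<in> powI J (m * n)"
  by (induction n) (auto intro: powI_mult)

end

end

section \<open>Differential operators\<close>

lemma diff_op_k_linear: "diff_op \<iota> t D \<Longrightarrow> k_linear \<iota> D"
  by (cases t) auto

lemma diff_op_zero: "diff_op \<iota> t (\<lambda>_. 0)"
  by (induction t) (auto simp: k_linear_def)

lemma diff_op_mono_Suc: "diff_op \<iota> t D \<Longrightarrow> diff_op \<iota> (Suc t) D"
  by (induction t arbitrary: D) (auto simp: diff_op_zero)

lemma diff_op_mono: "diff_op \<iota> s D \<Longrightarrow> s \<le> t \<Longrightarrow> diff_op \<iota> t D"
  by (induction t) (metis le_zero_eq, metis diff_op_mono_Suc le_Suc_eq)

lemma k_linear_add: "k_linear \<iota> D \<Longrightarrow> k_linear \<iota> E \<Longrightarrow> k_linear \<iota> (\<lambda>x. D x + E x)"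
  by (simp add: k_linear_def algebra_simps)

lemma diff_op_add: "diff_op \<iota> t D \<Longrightarrow> diff_op \<iota> t E \<Longrightarrow> diff_op \<iota> t (\<lambda>x. D x + E x)"
proof (induction t arbitrary: D E)
  case 0
  then show ?case by (auto simp: k_linear_add algebra_simps)
next
  case (Suc t)
  have "diff_op \<iota> t (\<lambda>x. (D (a * x) - a * D x) + (E (a * x) - a * E x))" for a
    using Suc.prems by (intro Suc.IH) auto
  moreover have "(D (a * x) - a * D x) + (E (a * x) - a * E x) = D (a * x) + E (a * x) - a * (D x + E x)" for a x
    by (simp add: algebra_simps)
  ultimately show ?case using Suc.prems by (auto simp: k_linear_add)
qed

lemma diff_op_sum: "(\<And>s. s \<in> S \<Longrightarrow> diff_op \<iota> t (D s)) \<Longrightarrow> diff_op \<iota> t (\<lambda>x. \<Sum>s\<in>S. D s x)"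
  by (induction S rule: infinite_finite_induct) (auto simp: diff_op_zero intro: diff_op_add)

lemma diff_op_mult_left: "diff_op \<iota> t D \<Longrightarrow> diff_op \<iota> t (\<lambda>x. r * D x)"
proof (induction t arbitrary: D)
  case 0
  then have "D (a * x) = a * D x" for a x by simp
  then show ?case using diff_op_k_linear[OF 0] by (simp add: k_linear_def distrib_left mult.left_commute)
next
  case (Suc t)
  have "diff_op \<iota> t (\<lambda>x. r * (D (a * x) - a * D x))" for a
    using Suc.prems by (intro Suc.IH) auto
  moreover have "r * (D (a * x) - a * D x) = r * D (a * x) - a * (r * D x)" for a x
    by (simp add: algebra_simps)
  moreover have "k_linear \<iota> (\<lambda>x. r * D x)" using diff_op_k_linear[OF Suc.prems]
    by (auto simp: k_linear_def algebra_simps)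
  ultimately show ?case by simp
qed

text \<open>The commutator with a splits as [DE, a] = D [E, a] + [D, a] E, and either summand has
  total order one less or is zero.\<close>

lemma diff_op_comp: "diff_op \<iota> s D \<Longrightarrow> diff_op \<iota> t E \<Longrightarrow> diff_op \<iota> (s + t) (\<lambda>x. D (E x))"
proof (induction "s + t" arbitrary: s t D E)
  case 0
  have "k_linear \<iota> (\<lambda>x. D (E x))" using 0 by (auto simp: k_linear_def)
  with 0 show ?case by auto
next
  case (Suc n)
  have D: "k_linear \<iota> D" and E: "k_linear \<iota> E" using Suc.prems diff_op_k_linear by blast+
  have D0: "D 0 = 0" using D unfolding k_linear_def by (metis add_cancel_right_right)
  have split: "D (E (a * x)) - a * D (E x) = D (E (a * x) - a * E x) + (D (a * E x) - a * D (E x))" for a x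
    using D unfolding k_linear_def by (metis diff_add_cancel diff_add_eq add_diff_eq)
  have "diff_op \<iota> n (\<lambda>x. D (E (a * x) - a * E x))" for a
  proof (cases t)
    case 0
    with Suc.prems D0 show ?thesis by (simp add: diff_op_zero)
  next
    case (Suc t')
    with Suc.prems Suc.hyps(1)[of s t' D "\<lambda>x. E (a * x) - a * E x"] Suc.hyps(2) show ?thesis by auto
  qed
  moreover have "diff_op \<iota> n (\<lambda>x. D (a * E x) - a * D (E x))" for a
  proof (cases s)
    case 0
    with Suc.prems show ?thesis by (simp add: diff_op_zero)
  next
    case (Suc s')
    with Suc.prems Suc.hyps(1)[of s' t "\<lambda>x. D (a * x) - a * D x" E] Suc.hyps(2) show ?thesis by auto
  qed
  ultimately have "diff_op \<iota> n (\<lambda>x. D (E (a * x)) - a * D (E x))" for a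
    unfolding split by (rule diff_op_add)
  moreover have "k_linear \<iota> (\<lambda>x. D (E x))" using D E by (simp add: k_linear_def)
  ultimately show ?case unfolding Suc.hyps(2)[symmetric] by simp
qed

context domain_algebra
begin

text \<open>By multiplicativity the commutator of the m-th coefficient with a is a combination of
  the coefficients of index below m, so induction on m applies.\<close>

lemma hasse_schmidt_diff_op:
  assumes "hasse_schmidt \<phi>"
  shows "diff_op \<iota> m (\<lambda>f. \<phi> f $ m)"
proof (induction m rule: less_induct)
  case (less m)
  have lin: "k_linear \<iota> (\<lambda>f. \<phi> f $ m)"
    using assms by (simp add: hasse_schmidt_def k_linear_def)
  have comm: "\<phi> (a * x) $ m - a * \<phi> x $ m = (\<Sum>j<m. \<phi> a $ (m - j) * \<phi> x $ j)" for a x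
  proof -
    have "\<phi> (a * x) $ m = (\<Sum>j=0..m. \<phi> x $ j * \<phi> a $ (m - j))"
      using assms by (simp add: hasse_schmidt_def mult.commute[of "\<phi> a"] fps_mult_nth)
    also have "{0..m} = insert m {..<m}" by auto
    finally show ?thesis using assms by (simp add: hasse_schmidt_def mult.commute)
  qed
  show ?case
  proof (cases m)
    case 0
    with lin comm show ?thesis by simp
  next
    case (Suc m')
    have "diff_op \<iota> m' (\<lambda>x. \<phi> x $ j)" if "j < m" for j
      using less[OF that] by (rule diff_op_mono) (use that Suc in simp)
    then have "diff_op \<iota> m' (\<lambda>x. \<Sum>j<m. \<phi> a $ (m - j) * \<phi> x $ j)" for a
      by (intro diff_op_sum diff_op_mult_left) auto
    then have "\<forall>a. diff_op \<iota> m' (\<lambda>x. \<phi> (a * x) $ m - a * \<phi> x $ m)" unfolding comm by blast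
    then show ?thesis using lin Suc by simp
  qed
qed

end

section \<open>The associated graded ring in coordinates and the action of divided powers on
  it\<close>

section \<open>Leading forms at a closed point\<close>

definition multi_indices :: "nat \<Rightarrow> nat \<Rightarrow> (nat \<Rightarrow> nat) set"
  where "multi_indices d n = {a. (\<forall>i\<ge>d. a i = 0) \<and> (\<Sum>i<d. a i) = n}"

lemma multi_indices_le: "a \<in> multi_indices d n \<Longrightarrow> a i \<le> n"
proof (cases "i < d")
  case True
  assume "a \<in> multi_indices d n"
  then show ?thesis using True member_le_sum[of i "{..<d}" a] by (auto simp: multi_indices_def)
qed (simp add: multi_indices_def)

lemma finite_multi_indices [simp]: "finite (multi_indices d n)"
proof (rule finite_subset)
  show "multi_indices d n \<subseteq> {f. \<forall>x. (x \<in> {..<d} \<longrightarrow> f x \<in> {..n}) \<and> (x \<notin> {..<d} \<longrightarrow> f x = 0)}"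
    using multi_indices_le by (auto simp: multi_indices_def)
  show "finite {f. \<forall>x. (x \<in> {..<d} \<longrightarrow> f x \<in> {..n}) \<and> (x \<notin> {..<d} \<longrightarrow> f x = (0::nat))}"
    by (rule finite_set_of_finite_funs) auto
qed

lemma multi_indices_0 [simp]: "multi_indices d 0 = {\<lambda>_. 0}"
  by (auto simp: multi_indices_def fun_eq_iff) (meson lessThan_iff not_le)

lemma sum_upd:
  fixes a :: "nat \<Rightarrow> nat"
  assumes "i < d"
  shows "(\<Sum>j<d. (a(i := k)) j) + a i = (\<Sum>j<d. a j) + k"
proof -
  have "(\<Sum>j<d. (a(i := k)) j) = k + (\<Sum>j\<in>{..<d} - {i}. a j)"
    using assms by (subst sum.remove[of _ i]) (auto intro!: sum.cong)
  moreover have "(\<Sum>j<d. a j) = a i + (\<Sum>j\<in>{..<d} - {i}. a j)"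
    using assms by (intro sum.remove) auto
  ultimately show ?thesis by simp
qed

text \<open>The filtration in which X has weight one. The truncated difference leaves the
  coefficients from index n on unrestricted.\<close>

definition fps_filt :: "'a :: comm_ring_1 set \<Rightarrow> nat \<Rightarrow> 'a fps set"
  where "fps_filt J n = {s. \<forall>m. s $ m \<in> powI J (n - m)}"

context
  fixes J :: "'a :: comm_ring_1 set" assumes J: "ring_ideal J"
begin

lemma fps_filt_zero: "0 \<in> fps_filt J n"
  and fps_filt_add: "s \<in> fps_filt J n \<Longrightarrow> t \<in> fps_filt J n \<Longrightarrow> s + t \<in> fps_filt J n"
  by (auto simp: fps_filt_def powI_add powI_zero[OF J])

lemma fps_filt_mult:
  assumes "s \<in> fps_filt J m" "t \<in> fps_filt J n"
  shows "s * t \<in> fps_filt J (m + n)"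
  unfolding fps_filt_def
proof (intro CollectI allI)
  fix k
  have "s $ i * t $ (k - i) \<in> powI J (m + n - k)" if "i \<le> k" for i
  proof -
    have "s $ i * t $ (k - i) \<in> powI J ((m - i) + (n - (k - i)))"
      using assms by (intro powI_mult[OF J]) (auto simp: fps_filt_def)
    then show ?thesis by (rule powI_mono[OF J, rotated]) (use that in simp)
  qed
  then show "(s * t) $ k \<in> powI J (m + n - k)"
    unfolding fps_mult_nth by (intro powI_sum[OF J]) auto
qed

lemma fps_filt_one: "1 \<in> fps_filt J 0"
  by (auto simp: fps_filt_def)

text \<open>Equality of leading forms of degree n for the weighted filtration.\<close>

definition fps_cong :: "nat \<Rightarrow> 'a fps \<Rightarrow> 'a fps \<Rightarrow> bool"
  where "fps_cong n s t \<longleftrightarrow> s \<in> fps_filt J n \<and> t \<in> fps_filt J n \<and> s - t \<in> fps_filt J (Suc n)"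

lemma fps_cong_mult:
  assumes "fps_cong m s s'" "fps_cong n t t'"
  shows "fps_cong (m + n) (s * t) (s' * t')"
proof -
  have "s * (t - t') \<in> fps_filt J (m + Suc n)" "(s - s') * t' \<in> fps_filt J (Suc m + n)"
    using assms by (auto simp: fps_cong_def simp del: add_Suc add_Suc_right intro!: fps_filt_mult)
  then have "s * (t - t') + (s - s') * t' \<in> fps_filt J (Suc (m + n))" by (intro fps_filt_add) auto
  moreover have "s * (t - t') + (s - s') * t' = s * t - s' * t'" by (simp add: algebra_simps)
  ultimately show ?thesis using assms by (auto simp: fps_cong_def intro: fps_filt_mult)
qed

lemma fps_cong_one: "fps_cong 0 1 1"
  by (simp add: fps_cong_def fps_filt_one fps_filt_zero)

lemma fps_cong_power: "fps_cong (Suc 0) s t \<Longrightarrow> fps_cong n (s ^ n) (t ^ n)"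
  by (induction n) (auto simp: fps_cong_one dest: fps_cong_mult)

lemma fps_cong_prod:
  "finite S \<Longrightarrow> (\<And>j. j \<in> S \<Longrightarrow> fps_cong (n j) (f j) (g j)) \<Longrightarrow>
    fps_cong (\<Sum>j\<in>S. n j) (\<Prod>j\<in>S. f j) (\<Prod>j\<in>S. g j)"
  by (induction S rule: finite_induct) (auto simp: fps_cong_one intro: fps_cong_mult)

end

text \<open>Coordinates at the closed point with evaluation map \<open>ev\<close>, together with Hasse--Schmidt
  derivations that integrate the dual basis of the tangent space.\<close>

locale local_coordinates = domain_algebra \<iota>
  for \<iota> :: "'k :: Fields.field \<Rightarrow> 'a :: idom" +
  fixes d :: nat and ev :: "'a \<Rightarrow> 'k" and x :: "nat \<Rightarrow> 'a" and \<phi> :: "nat \<Rightarrow> 'a \<Rightarrow> 'a fps"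
  assumes ev_add: "ev (f + g) = ev f + ev g" and ev_mult: "ev (f * g) = ev f * ev g"
    and ev_map [simp]: "ev (\<iota> c) = c"
    and ev_x: "i < d \<Longrightarrow> ev (x i) = 0"
    and x_span: "ev f = 0 \<Longrightarrow> \<exists>c. f - (\<Sum>i<d. \<iota> (c i) * x i) \<in> powI {f. ev f = 0} 2"
    and hs: "i < d \<Longrightarrow> hasse_schmidt (\<phi> i)"
    and hs_dual: "i < d \<Longrightarrow> j < d \<Longrightarrow> ev (\<phi> i (x j) $ 1) = (if i = j then 1 else 0)"
begin

definition Q :: "'a set" where "Q = {f. ev f = 0}"

lemma ev_0 [simp]: "ev 0 = 0" and ev_1 [simp]: "ev 1 = 1"
  using ev_map[of 0] ev_map[of 1] by (simp_all del: ev_map)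

lemma ev_minus: "ev (- f) = - ev f"
  using ev_add[of f "- f"] by (simp add: eq_neg_iff_add_eq_0 add.commute)

lemma ev_diff: "ev (f - g) = ev f - ev g"
  using ev_add[of f "- g"] by (simp add: ev_minus)

lemma ev_sum: "ev (sum f S) = (\<Sum>s\<in>S. ev (f s))"
  by (induction S rule: infinite_finite_induct) (auto simp: ev_add)

lemma ev_power: "ev (f ^ n) = ev f ^ n"
  by (induction n) (auto simp: ev_mult)

lemma ring_ideal_Q: "ring_ideal Q"
  by (auto simp: ring_ideal_def Q_def ev_add ev_mult)

lemmas pw_mult_left = powI_mult_left[OF ring_ideal_Q]
  and pw_zero [simp] = powI_zero[OF ring_ideal_Q]
  and pw_add = powI_add[of _ Q]
  and pw_diff = powI_diff[OF ring_ideal_Q]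
  and pw_sum = powI_sum[OF ring_ideal_Q]
  and pw_mono = powI_mono[OF ring_ideal_Q]
  and pw_1 = powI_1[OF ring_ideal_Q]
  and pw_mult = powI_mult[OF ring_ideal_Q]

definition mon :: "(nat \<Rightarrow> nat) \<Rightarrow> 'a"
  where "mon a = (\<Prod>i<d. x i ^ a i)"

definition form :: "nat \<Rightarrow> ((nat \<Rightarrow> nat) \<Rightarrow> 'k) \<Rightarrow> 'a"
  where "form n c = (\<Sum>a\<in>multi_indices d n. \<iota> (c a) * mon a)"

text \<open>\<open>c\<close> lists the coefficients of the degree n form of \<open>f\<close> in the
  associated graded ring.\<close>

definition rep :: "nat \<Rightarrow> ((nat \<Rightarrow> nat) \<Rightarrow> 'k) \<Rightarrow> 'a \<Rightarrow> bool"
  where "rep n c f \<longleftrightarrow> f - form n c \<in> powI Q (Suc n)"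

lemma x_mem: "i < d \<Longrightarrow> x i \<in> Q"
  by (simp add: Q_def ev_x)

lemma form_add: "form n (\<lambda>a. c a + c' a) = form n c + form n c'"
  by (simp add: form_def map_add distrib_right sum.distrib)

lemma form_scale: "form n (\<lambda>a. s * c a) = \<iota> s * form n c"
  by (simp add: form_def map_mult sum_distrib_left mult.assoc)

lemma form_zero [simp]: "form n (\<lambda>_. 0) = 0"
  by (simp add: form_def)

lemma rep_add: "rep n c f \<Longrightarrow> rep n c' g \<Longrightarrow> rep n (\<lambda>a. c a + c' a) (f + g)"
  unfolding rep_def form_add using pw_add by (metis add_diff_add)

lemma rep_scale: "rep n c f \<Longrightarrow> rep n (\<lambda>a. s * c a) (\<iota> s * f)"
  unfolding rep_def form_scale using pw_mult_left[of "f - form n c" "Suc n" "\<iota> s"]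
  by (simp add: right_diff_distrib)

lemma rep_higher: "f \<in> powI Q (Suc n) \<Longrightarrow> rep n (\<lambda>_. 0) f"
  by (simp add: rep_def)

lemma rep_sum:
  "(\<And>s. s \<in> S \<Longrightarrow> rep n (c s) (f s)) \<Longrightarrow> rep n (\<lambda>a. \<Sum>s\<in>S. c s a) (\<Sum>s\<in>S. f s)"
  by (induction S rule: infinite_finite_induct) (auto intro: rep_add rep_higher)

lemma rep_cong:
  "(\<And>a. a \<in> multi_indices d n \<Longrightarrow> c a = c' a) \<Longrightarrow> rep n c f \<longleftrightarrow> rep n c' f"
  by (simp add: rep_def form_def)

lemma rep_mon:
  assumes "b \<in> multi_indices d n"
  shows "rep n (\<lambda>a. if a = b then 1 else 0) (mon b)"
proof -
  have "form n (\<lambda>a. if a = b then 1 else 0) = (\<Sum>a\<in>multi_indices d n. if a = b then mon b else 0)"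
    unfolding form_def by (rule sum.cong) auto
  then show ?thesis using assms by (simp add: rep_def)
qed

lemma mon_upd:
  assumes "i < d" shows "mon (a(i := Suc (a i))) = x i * mon a"
proof -
  have "mon b = x i ^ b i * (\<Prod>j\<in>{..<d} - {i}. x j ^ b j)" for b
    unfolding mon_def using assms by (intro prod.remove) auto
  moreover have "(\<Prod>j\<in>{..<d} - {i}. x j ^ (a(i := Suc (a i))) j) = (\<Prod>j\<in>{..<d} - {i}. x j ^ a j)"
    by (rule prod.cong) auto
  ultimately show ?thesis by (simp add: mult.assoc)
qed

text \<open>In a product of an element of \<open>Q\<close> and one of a power of \<open>Q\<close>,
  the first factor may be replaced by its linear part and the second by its leading form; both
  errors lie one power deeper.\<close>

lemma rep_exists: "f \<in> powI Q n \<Longrightarrow> \<exists>c. rep n c f"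
proof (induction n arbitrary: f)
  case 0
  have "mon (\<lambda>_. 0) = 1" by (simp add: mon_def)
  then have "rep 0 (\<lambda>_. ev f) f"
    by (simp add: rep_def form_def pw_1) (simp add: Q_def ev_diff)
  then show ?case by blast
next
  case (Suc n)
  from Suc.prems show ?case
  proof (induction rule: powI_Suc_induct)
    case (prod q g)
    from prod have q: "ev q = 0" by (simp add: Q_def)
    then obtain s where s: "q - (\<Sum>i<d. \<iota> (s i) * x i) \<in> powI Q 2"
      using x_span[OF q] unfolding Q_def by blast
    from Suc.IH[OF prod(2)] obtain c where c: "g - form n c \<in> powI Q (Suc n)" unfolding rep_def ..
    have *: "\<exists>e. rep (Suc n) e (x i * mon a)" if "i < d" "a \<in> multi_indices d n" for i a
    proof -
      have "(\<Sum>j<d. (a(i := Suc (a i))) j) = Suc n"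
        using sum_upd[OF that(1), of a "Suc (a i)"] that(2) by (simp add: multi_indices_def)
      then have "a(i := Suc (a i)) \<in> multi_indices d (Suc n)"
        using that by (auto simp: multi_indices_def)
      from rep_mon[OF this] show ?thesis using mon_upd[OF that(1)] by auto
    qed
    have "\<exists>e. \<forall>i a. i < d \<and> a \<in> multi_indices d n \<longrightarrow> rep (Suc n) (e i a) (x i * mon a)"
      using * by metis
    then obtain e where e: "\<And>i a. i < d \<Longrightarrow> a \<in> multi_indices d n \<Longrightarrow> rep (Suc n) (e i a) (x i * mon a)"
      by blast
    have "rep (Suc n) (\<lambda>b. \<Sum>i<d. s i * (\<Sum>a\<in>multi_indices d n. c a * e i a b))
        (\<Sum>i<d. \<iota> (s i) * (\<Sum>a\<in>multi_indices d n. \<iota> (c a) * (x i * mon a)))"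
      by (intro rep_sum rep_scale e) auto
    also have "(\<Sum>i<d. \<iota> (s i) * (\<Sum>a\<in>multi_indices d n. \<iota> (c a) * (x i * mon a))) =
        (\<Sum>i<d. \<iota> (s i) * x i) * form n c"
      by (simp add: form_def sum_distrib_left sum_distrib_right mult_ac) (rule sum.swap)
    finally obtain e' where e': "rep (Suc n) e' ((\<Sum>i<d. \<iota> (s i) * x i) * form n c)" by blast
    have sx: "(\<Sum>i<d. \<iota> (s i) * x i) \<in> powI Q (Suc 0)"
      using x_mem by (intro pw_sum pw_mult_left) (simp add: pw_1)
    have "(\<Sum>i<d. \<iota> (s i) * x i) * (g - form n c) \<in> powI Q (Suc 0 + Suc n)"
      using sx c by (rule pw_mult)
    moreover have "(q - (\<Sum>i<d. \<iota> (s i) * x i)) * g \<in> powI Q (2 + n)"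
      using s prod(2) by (rule pw_mult)
    ultimately have "(\<Sum>i<d. \<iota> (s i) * x i) * (g - form n c) + (q - (\<Sum>i<d. \<iota> (s i) * x i)) * g
        \<in> powI Q (Suc (Suc n))"
      by (intro pw_add) simp_all
    from rep_add[OF e' rep_higher[OF this]]
    have "rep (Suc n) (\<lambda>a. e' a + 0) (q * g)" by (simp add: algebra_simps)
    then show ?case by blast
  qed (use rep_add in blast)
qed

lemma hs_add: "i < d \<Longrightarrow> \<phi> i (f + g) = \<phi> i f + \<phi> i g"
  and hs_mult: "i < d \<Longrightarrow> \<phi> i (f * g) = \<phi> i f * \<phi> i g"
  and hs_map: "i < d \<Longrightarrow> \<phi> i (\<iota> c) = fps_const (\<iota> c)"
  and hs_nth_0: "i < d \<Longrightarrow> \<phi> i f $ 0 = f"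
  using hs[of i] by (simp_all add: hasse_schmidt_def)

lemma hs_0: "i < d \<Longrightarrow> \<phi> i 0 = 0" and hs_1: "i < d \<Longrightarrow> \<phi> i 1 = 1"
  using hs_map[of i 0] hs_map[of i 1] by simp_all

lemma hs_sum: "i < d \<Longrightarrow> \<phi> i (sum f S) = (\<Sum>s\<in>S. \<phi> i (f s))"
  by (induction S rule: infinite_finite_induct) (auto simp: hs_0 hs_add)

lemma hs_power: "i < d \<Longrightarrow> \<phi> i (f ^ n) = \<phi> i f ^ n"
  by (induction n) (auto simp: hs_1 hs_mult)

lemma hs_prod: "i < d \<Longrightarrow> \<phi> i (prod f S) = (\<Prod>s\<in>S. \<phi> i (f s))"
  by (induction S rule: infinite_finite_induct) (auto simp: hs_1 hs_mult)

text \<open>The series of an element of \<open>Q\<close> has its constant term in \<open>Q\<close>,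
  hence weight one; multiplicativity does the rest.\<close>

lemma hs_filt:
  assumes i: "i < d" shows "f \<in> powI Q n \<Longrightarrow> \<phi> i f \<in> fps_filt Q n"
proof (induction n arbitrary: f)
  case 0
  then show ?case by (simp add: fps_filt_def)
next
  case (Suc n)
  from Suc.prems show ?case
  proof (induction rule: powI_Suc_induct)
    case (prod q g)
    have "\<phi> i q \<in> fps_filt Q (Suc 0)"
      using prod(1) hs_nth_0[OF i] unfolding fps_filt_def
      by (auto simp: pw_1) (metis One_nat_def Suc_diff_1 diff_Suc_Suc diff_is_0_eq' diff_zero not_less_eq_eq powI_0 UNIV_I pw_1 zero_less_iff_neq_zero)
    from fps_filt_mult[OF ring_ideal_Q this Suc.IH[OF prod(2)]] show ?case
      by (simp add: hs_mult[OF i])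
  qed (simp add: hs_add[OF i] fps_filt_add[OF ring_ideal_Q])
qed

lemma hs_mem: "i < d \<Longrightarrow> f \<in> powI Q n \<Longrightarrow> \<phi> i f $ m \<in> powI Q (n - m)"
  using hs_filt by (auto simp: fps_filt_def)

text \<open>On leading forms \<open>\<phi> i\<close> is the substitution of x_i + X for x_i, and the
  coefficient of X^m follows from the binomial theorem.\<close>

lemma hs_mon:
  assumes i: "i < d" and a: "a \<in> multi_indices d n"
  shows "\<phi> i (mon a) $ m - (if m \<le> a i then of_nat (a i choose m) * mon (a(i := a i - m)) else 0)
    \<in> powI Q (Suc n - m)"
proof -
  \<comment> \<open>The leading form of \<open>\<phi> i (x j)\<close>, by
    \<open>hs_dual\<close>.\<close>
  define t where "t j = fps_const (x j) + (if i = j then fps_X else 0)" for j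
  have tx: "t j $ k = (if k = 0 then x j else if k = 1 \<and> i = j then 1 else 0)" for j k
    by (auto simp: t_def)
  have cong: "fps_cong Q (Suc 0) (\<phi> i (x j)) (t j)" if j: "j < d" for j
  proof -
    have 1: "\<phi> i (x j) \<in> fps_filt Q (Suc 0)"
      using x_mem[OF j] by (intro hs_filt[OF i]) (simp add: pw_1)
    have 2: "t j $ m \<in> powI Q (Suc 0 - m)" for m
      using x_mem[OF j] by (cases m) (simp_all add: tx pw_1)
    have 3: "(\<phi> i (x j) - t j) $ m \<in> powI Q (Suc (Suc 0) - m)" for m
    proof (cases m)
      case 0
      then show ?thesis using hs_nth_0[OF i] by (simp add: tx)
    next
      case (Suc m')
      show ?thesis
      proof (cases m')
        case 0
        with Suc show ?thesis using hs_dual[OF i j] by (auto simp: tx pw_1) (auto simp: Q_def ev_diff split: if_splits)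
      qed (use Suc in simp)
    qed
    from 1 2 3 show ?thesis by (auto simp: fps_cong_def[OF ring_ideal_Q] fps_filt_def)
  qed
  define T where "T = (\<Prod>j<d. t j ^ a j)"
  have "fps_cong Q (\<Sum>j<d. a j) (\<Prod>j<d. \<phi> i (x j) ^ a j) T"
    unfolding T_def using cong
    by (intro fps_cong_prod[OF ring_ideal_Q] fps_cong_power[OF ring_ideal_Q]) auto
  then have "(\<Prod>j<d. \<phi> i (x j) ^ a j) - T \<in> fps_filt Q (Suc n)"
    using a by (simp add: fps_cong_def[OF ring_ideal_Q] multi_indices_def)
  then have main: "\<phi> i (mon a) $ m - T $ m \<in> powI Q (Suc n - m)"
    by (simp add: mon_def hs_prod[OF i] hs_power[OF i] fps_filt_def)
  have remove: "mon b = x i ^ b i * (\<Prod>j\<in>{..<d} - {i}. x j ^ b j)" for b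
    unfolding mon_def using i by (intro prod.remove) auto
  have const_prod: "(\<Prod>j\<in>S. fps_const (x j) ^ a j) = fps_const (\<Prod>j\<in>S. x j ^ a j)" for S
    by (induction S rule: infinite_finite_induct) (simp_all add: fps_const_power)
  have "T = t i ^ a i * (\<Prod>j\<in>{..<d} - {i}. t j ^ a j)"
    unfolding T_def using i by (intro prod.remove) auto
  also have "(\<Prod>j\<in>{..<d} - {i}. t j ^ a j) = (\<Prod>j\<in>{..<d} - {i}. fps_const (x j) ^ a j)"
    by (rule prod.cong) (auto simp: t_def)
  also have "\<dots> = fps_const (\<Prod>j\<in>{..<d} - {i}. x j ^ a j)" by (rule const_prod)
  finally have T: "T $ m = (t i ^ a i) $ m * (\<Prod>j\<in>{..<d} - {i}. x j ^ a j)" by simp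
  have "t i ^ a i = (\<Sum>k\<le>a i. of_nat (a i choose k) * fps_X ^ k * fps_const (x i) ^ (a i - k))"
    by (simp add: t_def add.commute[of _ fps_X] binomial_ring)
  then have "(t i ^ a i) $ m = (\<Sum>k\<le>a i. (of_nat (a i choose k) * fps_X ^ k * fps_const (x i) ^ (a i - k)) $ m)"
    by (simp add: fps_sum_nth)
  also have "\<dots> = (\<Sum>k\<le>a i. if k = m then of_nat (a i choose m) * x i ^ (a i - m) else 0)"
  proof (rule sum.cong)
    fix k
    have "of_nat (a i choose k) * fps_X ^ k * fps_const (x i) ^ (a i - k) =
        fps_const (of_nat (a i choose k) * x i ^ (a i - k)) * fps_X ^ k"
      by (simp add: fps_const_power fps_of_nat[symmetric] mult_ac fps_const_mult[symmetric] del: fps_const_mult)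
    then show "(of_nat (a i choose k) * fps_X ^ k * fps_const (x i) ^ (a i - k)) $ m =
        (if k = m then of_nat (a i choose m) * x i ^ (a i - m) else 0)"
      by (auto simp: fps_X_power_iff)
  qed simp
  also have "\<dots> = (if m \<le> a i then of_nat (a i choose m) * x i ^ (a i - m) else 0)" by simp
  finally have "T $ m = (if m \<le> a i then of_nat (a i choose m) * mon (a(i := a i - m)) else 0)"
    unfolding T by (auto simp: remove mult.assoc)
  with main show ?thesis by simp
qed

text \<open>The m-th divided derivative in direction i on coefficient vectors: the coefficient of
  x^b comes from that of x^b x_i^m. This formula turns saturation into closure of the leading forms
  under divided derivatives.\<close>

lemma rep_hs:
  assumes i: "i < d" and f: "rep n c f" and m: "m \<le> n"
  shows "rep (n - m) (\<lambda>b. of_nat (b i + m choose m) * c (b(i := b i + m))) (\<phi> i f $ m)"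
proof -
  define S where "S = {a \<in> multi_indices d n. m \<le> a i}"
  have "\<phi> i f = \<phi> i (form n c) + \<phi> i (f - form n c)"
    unfolding hs_add[OF i, symmetric] by simp
  also have "\<phi> i (form n c) = (\<Sum>a\<in>multi_indices d n. fps_const (\<iota> (c a)) * \<phi> i (mon a))"
    by (simp add: form_def hs_sum[OF i] hs_mult[OF i] hs_map[OF i])
  finally have f_eq: "\<phi> i f $ m = (\<Sum>a\<in>multi_indices d n. \<iota> (c a) * \<phi> i (mon a) $ m) + \<phi> i (f - form n c) $ m"
    by (simp add: fps_sum_nth)
  have rest: "\<phi> i (f - form n c) $ m \<in> powI Q (Suc n - m)"
    using f by (intro hs_mem[OF i]) (simp add: rep_def)
  define g where "g a = (if m \<le> a i then of_nat (a i choose m) * mon (a(i := a i - m)) else 0)" for a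
  have "(\<Sum>a\<in>multi_indices d n. \<iota> (c a) * (\<phi> i (mon a) $ m - g a)) \<in> powI Q (Suc n - m)"
    unfolding g_def using hs_mon[OF i] by (intro pw_sum pw_mult_left)
  from pw_add[OF this rest]
  have 1: "\<phi> i f $ m - (\<Sum>a\<in>multi_indices d n. \<iota> (c a) * g a) \<in> powI Q (Suc n - m)"
    unfolding f_eq by (simp add: right_diff_distrib sum_subtractf algebra_simps)
  have "(\<Sum>a\<in>multi_indices d n. \<iota> (c a) * g a) = (\<Sum>a\<in>S. \<iota> (c a) * g a)"
    unfolding S_def by (rule sum.mono_neutral_right) (auto simp: g_def)
  also have "\<dots> = (\<Sum>b\<in>multi_indices d (n - m). \<iota> (of_nat (b i + m choose m) * c (b(i := b i + m))) * mon b)"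
  proof (rule sum.reindex_bij_witness[where i = "\<lambda>b. b(i := b i + m)" and j = "\<lambda>a. a(i := a i - m)"])
    fix a assume a: "a \<in> S"
    then have ai: "m \<le> a i" and an: "a \<in> multi_indices d n" by (auto simp: S_def)
    show "(a(i := a i - m))(i := (a(i := a i - m)) i + m) = a" using ai by auto
    have "(\<Sum>j<d. (a(i := a i - m)) j) = n - m"
      using sum_upd[OF i, of a "a i - m"] an ai by (auto simp: multi_indices_def)
    then show "a(i := a i - m) \<in> multi_indices d (n - m)" using an i by (auto simp: multi_indices_def)
    show "\<iota> (of_nat ((a(i := a i - m)) i + m choose m) * c ((a(i := a i - m))(i := (a(i := a i - m)) i + m)))
        * mon (a(i := a i - m)) = \<iota> (c a) * g a"
      using ai by (simp add: g_def map_mult map_of_nat mult_ac)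
  next
    fix b assume b: "b \<in> multi_indices d (n - m)"
    show "(b(i := b i + m))(i := (b(i := b i + m)) i - m) = b" by auto
    have "(\<Sum>j<d. (b(i := b i + m)) j) = n"
      using sum_upd[OF i, of b "b i + m"] b m by (auto simp: multi_indices_def)
    then show "b(i := b i + m) \<in> S" using b i by (auto simp: multi_indices_def S_def)
  qed
  finally have 2: "(\<Sum>a\<in>multi_indices d n. \<iota> (c a) * g a) =
      form (n - m) (\<lambda>b. of_nat (b i + m choose m) * c (b(i := b i + m)))" by (simp add: form_def)
  from 1 m show ?thesis unfolding rep_def 2 by (simp add: Suc_diff_le)
qed

text \<open>The composite of the divided derivatives of order \<open>a i\<close> in direction i: a
  differential operator of order |a| that is dual to the monomial x^a.\<close>

primrec hs_iter :: "(nat \<Rightarrow> nat) \<Rightarrow> nat \<Rightarrow> 'a \<Rightarrow> 'a"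
  where "hs_iter a 0 f = f" | "hs_iter a (Suc k) f = \<phi> k (hs_iter a k f) $ a k"

lemma diff_op_hs_iter: "k \<le> d \<Longrightarrow> diff_op \<iota> (\<Sum>i<k. a i) (hs_iter a k)"
proof (induction k)
  case 0
  have "hs_iter a 0 = (\<lambda>f. f)" by (rule ext) simp
  then show ?case by (simp add: k_linear_def)
next
  case (Suc k)
  have eq: "hs_iter a (Suc k) = (\<lambda>f. \<phi> k (hs_iter a k f) $ a k)" by (rule ext) simp
  have "diff_op \<iota> (a k + (\<Sum>i<k. a i)) (\<lambda>f. \<phi> k (hs_iter a k f) $ a k)"
    using Suc hasse_schmidt_diff_op[OF hs[of k], of "a k"]
    by (intro diff_op_comp[where D = "\<lambda>f. \<phi> k f $ a k"]) auto
  then show ?case unfolding eq by (simp add: add.commute)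
qed

lemma rep_hs_iter:
  assumes "rep n c f" "k \<le> d" "(\<Sum>i<k. a i) \<le> n"
  shows "rep (n - (\<Sum>i<k. a i)) (\<lambda>b. of_nat (\<Prod>i<k. b i + a i choose a i) *
    c (\<lambda>i. if i < k then b i + a i else b i)) (hs_iter a k f)"
  using assms(2,3)
proof (induction k)
  case 0
  then show ?case using assms(1) by simp
next
  case (Suc k)
  define c' where "c' b = of_nat (\<Prod>i<k. b i + a i choose a i) * c (\<lambda>i. if i < k then b i + a i else b i)" for b
  have k: "k < d" "a k \<le> n - (\<Sum>i<k. a i)" using Suc.prems by auto
  have "rep (n - (\<Sum>i<k. a i)) c' (hs_iter a k f)" unfolding c'_def using Suc by simp
  from rep_hs[OF k(1) this k(2)]
  have "rep (n - (\<Sum>i<Suc k. a i)) (\<lambda>b. of_nat (b k + a k choose a k) * c' (b(k := b k + a k)))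
      (hs_iter a (Suc k) f)" by (simp add: diff_diff_add)
  moreover have "of_nat (b k + a k choose a k) * c' (b(k := b k + a k)) =
      of_nat (\<Prod>i<Suc k. b i + a i choose a i) * c (\<lambda>i. if i < Suc k then b i + a i else b i)" for b
  proof -
    have "(\<Prod>i<k. (b(k := b k + a k)) i + a i choose a i) = (\<Prod>i<k. b i + a i choose a i)"
      by (rule prod.cong) auto
    moreover have "(\<lambda>i. if i < k then (b(k := b k + a k)) i + a i else (b(k := b k + a k)) i) =
        (\<lambda>i. if i < Suc k then b i + a i else b i)" by (auto simp: fun_eq_iff less_Suc_eq)
    ultimately show ?thesis by (simp add: c'_def mult_ac)
  qed
  ultimately show ?case by simp
qed

text \<open>On a form of the same degree only the coefficient at \<open>a\<close> survives, with
  factors \<open>a i\<close> over \<open>a i\<close>, that is 1. So these operators read off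
  coefficients, and the monomials are linearly independent in the graded ring.\<close>

lemma ev_hs_iter:
  assumes "rep n c f" "a \<in> multi_indices d n"
  shows "ev (hs_iter a d f) = c a"
proof -
  have an: "(\<Sum>i<d. a i) = n" using assms(2) by (simp add: multi_indices_def)
  have "(\<lambda>i. if i < d then 0 + a i else 0) = a"
    using assms(2) by (auto simp: multi_indices_def fun_eq_iff)
  moreover have "mon (\<lambda>_. 0) = 1" by (simp add: mon_def)
  moreover have "rep 0 (\<lambda>b. of_nat (\<Prod>i<d. b i + a i choose a i) *
      c (\<lambda>i. if i < d then b i + a i else b i)) (hs_iter a d f)"
    using rep_hs_iter[OF assms(1), of d a] an by simp
  ultimately have "hs_iter a d f - \<iota> (c a) \<in> Q"
    unfolding rep_def form_def multi_indices_0 pw_1 by simp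
  then show ?thesis by (simp add: Q_def ev_diff)
qed

lemma rep_unique: "rep n c f \<Longrightarrow> rep n c' f \<Longrightarrow> a \<in> multi_indices d n \<Longrightarrow> c a = c' a"
  using ev_hs_iter by metis

lemma rep_zero_imp_higher:
  "rep n c f \<Longrightarrow> (\<And>a. a \<in> multi_indices d n \<Longrightarrow> c a = 0) \<Longrightarrow> f \<in> powI Q (Suc n)"
  using rep_cong[of n c "\<lambda>_. 0" f] by (simp add: rep_def)

end

section \<open>Saturation restricts leading forms to admissible monomials\<close>

section \<open>The leading algebra of a saturated filtration\<close>

lemma filtrationD:
  assumes "idealistic_filtration (type_ring :: 'a :: comm_ring_1 ring) \<I>"
  shows filtration_add: "f \<in> level \<I> u \<Longrightarrow> g \<in> level \<I> u \<Longrightarrow> f + g \<in> level \<I> u"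
    and filtration_mult_left: "f \<in> level \<I> u \<Longrightarrow> r * f \<in> level \<I> u"
    and filtration_zero: "0 \<in> level \<I> u"
    and filtration_nonpos: "u \<le> 0 \<Longrightarrow> f \<in> level \<I> u"
    and filtration_mult: "f \<in> level \<I> u \<Longrightarrow> g \<in> level \<I> v \<Longrightarrow> f * g \<in> level \<I> (u + v)"
    and filtration_mono: "f \<in> level \<I> u \<Longrightarrow> v \<le> u \<Longrightarrow> f \<in> level \<I> v"
proof -
  have I: "ideal (level \<I> u) type_ring" for u using assms by (auto simp: idealistic_filtration_def)
  show "f \<in> level \<I> u \<Longrightarrow> g \<in> level \<I> u \<Longrightarrow> f + g \<in> level \<I> u"
    using additive_subgroup.a_closed[OF ideal.axioms(1)[OF I[of u]]] by simp
  show "f \<in> level \<I> u \<Longrightarrow> r * f \<in> level \<I> u"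
    using ideal.I_l_closed[OF I[of u], of f r] by simp
  show "0 \<in> level \<I> u"
    using additive_subgroup.zero_closed[OF ideal.axioms(1)[OF I[of u]]] by simp
  show "u \<le> 0 \<Longrightarrow> f \<in> level \<I> u"
    using assms by (simp add: idealistic_filtration_def)
  show "f \<in> level \<I> u \<Longrightarrow> g \<in> level \<I> v \<Longrightarrow> f * g \<in> level \<I> (u + v)"
    "f \<in> level \<I> u \<Longrightarrow> v \<le> u \<Longrightarrow> f \<in> level \<I> v"
    using assms by (auto simp: idealistic_filtration_def level_def)
qed

lemma filtration_power:
  assumes "idealistic_filtration (type_ring :: 'a :: comm_ring_1 ring) \<I>" "f \<in> level \<I> u"
  shows "f ^ n \<in> level \<I> (real n * u)"
proof (induction n)
  case 0
  then show ?case using filtration_nonpos[OF assms(1)] by simp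
next
  case (Suc n)
  have "f * f ^ n \<in> level \<I> (u + real n * u)"
    using assms(2) Suc by (rule filtration_mult[OF assms(1)])
  then show ?case by (simp add: distrib_right)
qed

lemma filtration_sum:
  assumes "idealistic_filtration (type_ring :: 'a :: comm_ring_1 ring) \<I>"
    "\<And>s. s \<in> S \<Longrightarrow> f s \<in> level \<I> u"
  shows "sum f S \<in> level \<I> u"
  using assms(2) by (induction S rule: infinite_finite_induct)
    (auto intro: filtration_zero[OF assms(1)] filtration_add[OF assms(1)])

lemma D_saturated_level:
  "D_saturated \<iota> \<I> \<Longrightarrow> f \<in> level \<I> u \<Longrightarrow> diff_op \<iota> t D \<Longrightarrow> D f \<in> level \<I> (u - real t)"
  by (auto simp: D_saturated_def level_def)

lemma powI_mult_cong:
  assumes "ring_ideal J" "f - f' \<in> powI J (Suc m)" "g - g' \<in> powI J (Suc n)"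
    "f' \<in> powI J m" "g' \<in> powI J n"
  shows "f * g - f' * g' \<in> powI J (Suc (m + n))"
proof -
  have "f - f' \<in> powI J m" using assms(1,2) powI_mono[of J m "Suc m"] by auto
  then have f: "f \<in> powI J m" using powI_add[of "f - f'" J m f'] assms(4) by simp
  have "f * (g - g') \<in> powI J (m + Suc n)" "(f - f') * g' \<in> powI J (Suc m + n)"
    using assms f by (auto intro!: powI_mult simp del: add_Suc add_Suc_right)
  from powI_add[of "f * (g - g')" J "Suc (m + n)" "(f - f') * g'"] this
  show ?thesis by (simp add: algebra_simps)
qed

lemma powI_power_cong:
  assumes "ring_ideal J" "f - f' \<in> powI J (Suc m)" "f' \<in> powI J m"
  shows "f ^ n - f' ^ n \<in> powI J (Suc (m * n))"
proof (induction n)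
  case 0
  then show ?case using assms(1) by (simp add: powI_zero)
next
  case (Suc n)
  from powI_mult_cong[OF assms(1,2) this assms(3)] powI_power[OF assms(1,3)] show ?case by simp
qed

text \<open>For q in \<open>J\<close> the commutator of D with q has order one less, and q D(g) lies
  in \<open>J\<close>; induction on the order therefore strips off one factor at a time.\<close>

lemma diff_op_powI:
  assumes J: "ring_ideal J"
  shows "diff_op \<iota> t D \<Longrightarrow> f \<in> powI J (Suc t) \<Longrightarrow> D f \<in> J"
proof (induction t arbitrary: D f)
  case 0
  from 0(1) have "\<And>a x. D (a * x) = a * D x" by simp
  from this[of f 1] have "D f = D 1 * f" by (simp add: mult.commute[of "D 1"])
  moreover have "f \<in> J" using 0(2) powI_1[OF J] by simp
  then have "D 1 * f \<in> J" using J by (simp add: ring_ideal_def)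
  ultimately show ?case by simp
next
  case (Suc t)
  from Suc.prems(2) show ?case
  proof (induction rule: powI_Suc_induct)
    case (prod q g)
    have "D (q * g) - q * D g \<in> J"
      using Suc.IH[of "\<lambda>x. D (q * x) - q * D x" g] Suc.prems(1) prod(2) by simp
    moreover have "D g * q \<in> J" using prod(1) J by (simp add: ring_ideal_def)
    ultimately have "(D (q * g) - q * D g) + D g * q \<in> J" using J unfolding ring_ideal_def by blast
    then show ?case by (simp add: mult.commute)
  next
    case (add f g)
    then show ?case using J diff_op_k_linear[OF Suc.prems(1)] by (simp add: k_linear_def ring_ideal_def)
  qed
qed

text \<open>With q = p^s the freshman's dream gives (1 + X)^n = (1 + X^q)^u. Comparing the
  coefficients of X^q yields u, which is nonzero in \<open>'k\<close>.\<close>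

lemma of_nat_choose_prime_power_nonzero:
  assumes p: "prime CHAR('k :: Fields.field)" and n: "n = CHAR('k) ^ s * u" "\<not> CHAR('k) dvd u"
  shows "of_nat (n choose CHAR('k) ^ s) \<noteq> (0 :: 'k)"
proof -
  define q where "q = CHAR('k) ^ s"
  have q: "q > 0" using p prime_gt_0_nat by (simp add: q_def)
  have "(1 + fps_X :: 'k fps) ^ q = 1 ^ q + fps_X ^ q"
    using p unfolding q_def by (intro freshmans_dream') simp_all
  then have "(1 + fps_X :: 'k fps) ^ n = (1 + fps_X ^ q) ^ u"
    using n by (simp add: q_def[symmetric] power_mult)
  also have "\<dots> = (\<Sum>k\<le>u. of_nat (u choose k) * fps_X ^ (q * k))"
    by (simp add: add.commute[of 1] binomial_ring power_mult)
  finally have eq: "(1 + fps_X :: 'k fps) ^ n $ q = (\<Sum>k\<le>u. of_nat (u choose k) * fps_X ^ (q * k)) $ q"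
    by simp
  have coeff: "(of_nat c * fps_X ^ k :: 'k fps) $ m = (if m = k then of_nat c else 0)" for c k m
    by (simp add: fps_of_nat[symmetric] fps_X_power_iff)
  have "(1 + fps_X :: 'k fps) ^ n = (\<Sum>k\<le>n. of_nat (n choose k) * fps_X ^ k)"
    by (simp add: add.commute[of 1] binomial_ring)
  then have "(1 + fps_X :: 'k fps) ^ n $ q = (\<Sum>k\<le>n. (of_nat (n choose k) * fps_X ^ k) $ q)"
    by (simp only: fps_sum_nth)
  also have "\<dots> = (\<Sum>k\<le>n. if k = q then of_nat (n choose q) else 0)"
    by (rule sum.cong) (auto simp: coeff)
  also have "\<dots> = of_nat (n choose q)" by (simp add: binomial_eq_0)
  finally have "of_nat (n choose q) = (\<Sum>k\<le>u. (of_nat (u choose k) * fps_X ^ (q * k) :: 'k fps) $ q)"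
    using eq by (simp only: fps_sum_nth)
  also have "\<dots> = (\<Sum>k\<le>u. if k = 1 then of_nat u else (0::'k))"
    using q by (intro sum.cong) (auto simp: coeff)
  also have "\<dots> = of_nat u" by (cases u) simp_all
  finally show ?thesis using n(2) unfolding q_def by (simp add: of_nat_eq_0_iff_char_dvd)
qed

lemma exponents_cases:
  assumes "e \<in> exponents TYPE('k :: Fields.field)"
  obtains "e = 0" "CHAR('k) = 0" | "prime CHAR('k)"
  using assms prime_CHAR_semidom[where ?'a = 'k] by (auto simp: exponents_def split: if_splits)

locale closed_point_coordinates = local_coordinates \<iota> d ev x \<phi>
  for \<iota> :: "'k :: alg_closed_field \<Rightarrow> 'a :: idom" and d ev x \<phi>
begin

lemma inj_structure_map: "\<iota> c = \<iota> c' \<longleftrightarrow> c = c'"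
  using ev_map by metis

lemma char_eq: "CHAR('a) = CHAR('k)"
proof -
  have "of_nat n = (0 :: 'a) \<longleftrightarrow> of_nat n = (0 :: 'k)" for n
    using inj_structure_map[of "of_nat n" 0] by (simp add: map_of_nat)
  then show ?thesis by (intro dvd_antisym) (metis of_nat_eq_0_iff_char_dvd dvd_refl)+
qed

lemma frobenius_sum:
  assumes "e \<in> exponents TYPE('k)"
  shows "(sum f S :: 'a) ^ (CHAR('k) ^ e) = (\<Sum>s\<in>S. f s ^ (CHAR('k) ^ e))"
  using assms by (cases rule: exponents_cases) (auto simp: char_eq intro!: freshmans_dream_sum')

text \<open>If the leading form had degree m < n, an operator of order m that reads off one of its
  coefficients would carry \<open>f\<close> to level n - m > 0, which \<open>supp\<close> places in
  \<open>Q\<close>; so every coefficient vanishes.\<close>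

lemma supported_level_subset:
  assumes F: "idealistic_filtration type_ring \<I>" and D: "D_saturated \<iota> \<I>"
    and supp: "\<And>u. u > 0 \<Longrightarrow> level \<I> u \<subseteq> Q" and f: "f \<in> level \<I> (real n)"
  shows "f \<in> powI Q n"
proof -
  have "f \<in> powI Q m" if "m \<le> n" for m
    using that
  proof (induction m)
    case (Suc m)
    then obtain c where c: "rep m c f" using rep_exists by fastforce
    have "c a = 0" if a: "a \<in> multi_indices d m" for a
    proof -
      have "diff_op \<iota> m (hs_iter a d)"
        using diff_op_hs_iter[of d a] a by (simp add: multi_indices_def)
      from D_saturated_level[OF D f this] supp[of "real n - real m"] Suc.prems
      have "hs_iter a d f \<in> Q" by auto
      then show ?thesis using ev_hs_iter[OF c a] by (simp add: Q_def)
    qed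
    then show ?case using rep_zero_imp_higher[OF c] by blast
  qed simp
  then show ?thesis by simp
qed

end

text \<open>Coordinates in which the first \<open>r j\<close> of them span the space of \<open>v\<close> whose power \<open>v ^ CHAR ^ j\<close>
  is a leading form of the filtration, for all \<open>j \<le> E\<close>.\<close>

locale adapted_coordinates = closed_point_coordinates \<iota> d ev x \<phi>
  for \<iota> :: "'k :: alg_closed_field \<Rightarrow> 'a :: idom" and d ev x \<phi> +
  fixes \<I> :: "('a \<times> real) set" and E :: nat and r :: "nat \<Rightarrow> nat"
  assumes filtration: "idealistic_filtration type_ring \<I>"
    and saturated: "D_saturated \<iota> \<I>"
    and support: "u > 0 \<Longrightarrow> level \<I> u \<subseteq> Q"
    and E: "E \<in> exponents TYPE('k)"
    and r_mono: "i \<le> j \<Longrightarrow> j \<le> E \<Longrightarrow> r i \<le> r j"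
    and r_le: "j \<le> E \<Longrightarrow> r j \<le> d"
    and pure: "j \<le> E \<Longrightarrow> i < r j \<Longrightarrow>
      \<exists>h\<in>level \<I> (real (CHAR('k) ^ j)). h - x i ^ (CHAR('k) ^ j) \<in> powI Q (Suc (CHAR('k) ^ j))"
    and pure_only: "j \<le> E \<Longrightarrow> f \<in> level \<I> (real (CHAR('k) ^ j)) \<Longrightarrow>
      f - (\<Sum>i<d. \<iota> (c i) * x i) ^ (CHAR('k) ^ j) \<in> powI Q (Suc (CHAR('k) ^ j)) \<Longrightarrow>
      r j \<le> i \<Longrightarrow> i < d \<Longrightarrow> c i = 0"
begin

lemma level_powI: "f \<in> level \<I> (real n) \<Longrightarrow> f \<in> powI Q n"
  using supported_level_subset[OF filtration saturated support] .

lemma exponents_le: "j \<le> E \<Longrightarrow> j \<in> exponents TYPE('k)"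
  using E by (auto simp: exponents_def split: if_splits)

text \<open>If e_i is the least index with i < r e_i, the condition asks that p^(e_i) divide
  \<open>a i\<close>, so x^a is a monomial in the powers whose classes lie in the leading algebra.
  For i at least \<open>r E\<close>, divisibility by p^(E + 1) forces \<open>a i\<close> to vanish
  in degrees up to p^E; in characteristic 0 it is divisibility by 0.\<close>

definition admissible :: "(nat \<Rightarrow> nat) \<Rightarrow> bool"
  where "admissible a \<longleftrightarrow> (\<forall>i<d. \<forall>j\<le>E. r j \<le> i \<longrightarrow> CHAR('k) ^ Suc j dvd a i)"

lemma admissible_power_lift:
  assumes i: "i < d" and n: "n \<le> CHAR('k) ^ E" and adm: "\<And>j. j \<le> E \<Longrightarrow> r j \<le> i \<Longrightarrow> CHAR('k) ^ Suc j dvd n"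
  shows "\<exists>h\<in>level \<I> (real n). h - x i ^ n \<in> powI Q (Suc n)"
proof (cases "n = 0")
  case True
  then show ?thesis using filtration_nonpos[OF filtration, of 0 1] by (intro bexI[of _ 1]) auto
next
  case False
  have ex: "\<exists>j\<le>E. i < r j"
  proof (rule ccontr)
    assume "\<not> ?thesis"
    then have "r E \<le> i" by (meson le_refl not_le)
    then have dvd: "CHAR('k) ^ Suc E dvd n" using adm by blast
    from E show False
    proof (cases rule: exponents_cases)
      case 1
      with dvd False show ?thesis by simp
    next
      case 2
      have "CHAR('k) ^ Suc E \<le> n" using dvd False by (auto dest: dvd_imp_le)
      with n have "CHAR('k) ^ Suc E \<le> CHAR('k) ^ E" by linarith
      with prime_gt_1_nat[OF 2] show ?thesis by (simp add: power_increasing_iff)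
    qed
  qed
  \<comment> \<open>For the least such \<open>j\<close>, the preceding index still imposes that p^j
    divide n, so x_i^n is a power of the liftable element x_i^(p^j).\<close>
  define j where "j = (LEAST j. j \<le> E \<and> i < r j)"
  have j: "j \<le> E" "i < r j" using LeastI_ex[OF ex] unfolding j_def by auto
  have "CHAR('k) ^ j dvd n"
  proof (cases j)
    case (Suc j')
    then have "\<not> (j' \<le> E \<and> i < r j')" unfolding j_def by (intro not_less_Least) simp
    with Suc j adm[of j'] show ?thesis by auto
  qed simp
  then obtain u where u: "n = CHAR('k) ^ j * u" by blast
  from pure[OF j] obtain h where h: "h \<in> level \<I> (real (CHAR('k) ^ j))" "h - x i ^ (CHAR('k) ^ j) \<in> powI Q (Suc (CHAR('k) ^ j))"
    by blast
  have "x i ^ (CHAR('k) ^ j) \<in> powI Q (Suc 0 * CHAR('k) ^ j)"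
    using x_mem[OF i] by (intro powI_power[OF ring_ideal_Q]) (simp add: pw_1)
  from powI_power_cong[OF ring_ideal_Q h(2)] this
  have "h ^ u - (x i ^ (CHAR('k) ^ j)) ^ u \<in> powI Q (Suc (CHAR('k) ^ j * u))" by simp
  then have "h ^ u - x i ^ n \<in> powI Q (Suc n)" by (simp add: u power_mult)
  moreover have "h ^ u \<in> level \<I> (real n)"
    using filtration_power[OF filtration h(1), of u] by (simp add: u mult.commute)
  ultimately show ?thesis by blast
qed

lemma admissible_mon_lift:
  assumes a: "a \<in> multi_indices d n" and n: "n \<le> CHAR('k) ^ E" and adm: "admissible a"
  shows "\<exists>h\<in>level \<I> (real n). h - mon a \<in> powI Q (Suc n)"
proof -
  have "\<exists>h\<in>level \<I> (real (\<Sum>i<k. a i)). h - (\<Prod>i<k. x i ^ a i) \<in> powI Q (Suc (\<Sum>i<k. a i)) \<and>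
      (\<Prod>i<k. x i ^ a i) \<in> powI Q (\<Sum>i<k. a i)" if "k \<le> d" for k
    using that
  proof (induction k)
    case 0
    then show ?case using filtration_nonpos[OF filtration, of 0 1] by (intro bexI[of _ 1]) auto
  next
    case (Suc k)
    then obtain h where h: "h \<in> level \<I> (real (\<Sum>i<k. a i))"
      "h - (\<Prod>i<k. x i ^ a i) \<in> powI Q (Suc (\<Sum>i<k. a i))" "(\<Prod>i<k. x i ^ a i) \<in> powI Q (\<Sum>i<k. a i)"
      by auto
    have k: "k < d" using Suc.prems by simp
    have "a k \<le> CHAR('k) ^ E" using multi_indices_le[OF a, of k] n by simp
    moreover have "CHAR('k) ^ Suc j dvd a k" if "j \<le> E" "r j \<le> k" for j
      using adm k that unfolding admissible_def by blast
    ultimately obtain g where g: "g \<in> level \<I> (real (a k))" "g - x k ^ a k \<in> powI Q (Suc (a k))"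
      using admissible_power_lift[OF k] by blast
    have xk: "x k ^ a k \<in> powI Q (a k)"
      using powI_power[OF ring_ideal_Q, of "x k" "Suc 0" "a k"] x_mem[OF k] by (simp add: pw_1)
    have "h * g - (\<Prod>i<k. x i ^ a i) * x k ^ a k \<in> powI Q (Suc ((\<Sum>i<k. a i) + a k))"
      by (rule powI_mult_cong[OF ring_ideal_Q h(2) g(2) h(3) xk])
    moreover have "h * g \<in> level \<I> (real ((\<Sum>i<k. a i) + a k))"
      using filtration_mult[OF filtration h(1) g(1)] by simp
    moreover have "(\<Prod>i<k. x i ^ a i) * x k ^ a k \<in> powI Q ((\<Sum>i<k. a i) + a k)"
      using pw_mult[OF h(3) xk] .
    ultimately show ?case by (intro bexI[of _ "h * g"]) auto
  qed
  from this[of d] a show ?thesis by (auto simp: multi_indices_def mon_def)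
qed

lemma frobenius_root: "j \<le> E \<Longrightarrow> \<exists>b. b ^ (CHAR('k) ^ j) = (c :: 'k)"
proof -
  assume j: "j \<le> E"
  have pos: "CHAR('k) ^ j > 0" using exponents_le[OF j] by (cases rule: exponents_cases) (auto intro: prime_gt_0_nat)
  show ?thesis using nth_root_exists[OF pos, of c] by blast
qed

text \<open>If the binomial coefficient is nonzero, the m-th divided derivative carries x^a to a
  term that really occurs in a leading form at level n - m, where the hypothesis of the main
  induction applies.\<close>

lemma level_coeff_admissible_aux:
  assumes f: "f \<in> level \<I> (real n)" "rep n c f" and a: "a \<in> multi_indices d n" "c a \<noteq> 0"
    and i: "i < d" and m: "0 < m" "m \<le> a i" "of_nat (a i choose m) \<noteq> (0 :: 'k)"
    and IH: "\<And>f c. f \<in> level \<I> (real (n - m)) \<Longrightarrow> rep (n - m) c f \<Longrightarrow>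
      (\<And>a. a \<in> multi_indices d (n - m) \<Longrightarrow> c a \<noteq> 0 \<Longrightarrow> admissible a)"
  shows "admissible (a(i := a i - m))"
proof -
  have mn: "m \<le> n" using multi_indices_le[OF a(1), of i] m by simp
  have "\<phi> i f $ m \<in> level \<I> (real n - real m)"
    using hasse_schmidt_diff_op[OF hs[OF i], of m] by (rule D_saturated_level[OF saturated f(1)])
  then have lev: "\<phi> i f $ m \<in> level \<I> (real (n - m))" using mn by (simp add: of_nat_diff)
  have "(\<Sum>j<d. (a(i := a i - m)) j) = n - m"
    using sum_upd[OF i, of a "a i - m"] a(1) m by (auto simp: multi_indices_def)
  then have "a(i := a i - m) \<in> multi_indices d (n - m)" using a(1) i by (auto simp: multi_indices_def)
  moreover have "(a(i := a i - m))(i := (a(i := a i - m)) i + m) = a" using m by auto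
  ultimately show ?thesis
    using IH[OF lev rep_hs[OF i f(2) mn], of "a(i := a i - m)"] m a(2) by simp
qed

text \<open>Induction on the degree. A mixed monomial is settled by differentiating one variable
  away completely, for two different variables. A pure power x_i^n with n not a power of p is
  settled by the divided derivatives of orders p^s and n - p^s, where p^s is the exact power of p in
  n. For n = p^t no derivative helps: the admissible terms are lifted and subtracted, and what is
  left is the p^t-th power of a linear form in the coordinates from \<open>r t\<close> on, which
  \<open>pure_only\<close> makes zero.\<close>

lemma level_coeff_admissible:
  assumes "f \<in> level \<I> (real n)" "rep n c f" "n \<le> CHAR('k) ^ E" "a \<in> multi_indices d n" "c a \<noteq> 0"
  shows "admissible a"
  using assms
proof (induction n arbitrary: f c a rule: less_induct)
  case (less n)
  \<comment> \<open>Removing the entry at l costs the binomial coefficient of \<open>b l\<close>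
    over itself, which is 1; two choices of l together control all entries.\<close>
  have mixed: "admissible b"
    if b: "b \<in> multi_indices d n" "c b \<noteq> 0" and ij: "i < d" "i' < d" "i \<noteq> i'" "b i \<noteq> 0" "b i' \<noteq> 0" for b i i'
  proof -
    have *: "admissible (b(l := 0))" if l: "l < d" "b l \<noteq> 0" for l
    proof -
      have "admissible (b(l := b l - b l))"
      proof (rule level_coeff_admissible_aux[OF less.prems(1,2) b l(1)])
        have "b l \<le> n" using multi_indices_le[OF b(1)] .
        then show "admissible a" if "f \<in> level \<I> (real (n - b l))" "rep (n - b l) c f"
          "a \<in> multi_indices d (n - b l)" "c a \<noteq> 0" for f c a
          using less.IH[OF _ that(1,2) _ that(3,4)] less.prems(3) l by simp
      qed (use l in auto)
      then show ?thesis by simp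
    qed
    from *[of i] *[of i'] ij show ?thesis unfolding admissible_def by (metis fun_upd_other)
  qed
  have single_upd: "(\<lambda>_. 0)(i := n) \<in> multi_indices d n" if "i < d" for i
    using sum_upd[OF that, of "\<lambda>_. 0" n] that by (simp add: multi_indices_def)
  show ?case
  proof (cases "\<exists>i i'. i < d \<and> i' < d \<and> i \<noteq> i' \<and> a i \<noteq> 0 \<and> a i' \<noteq> 0")
    case True
    with mixed less.prems show ?thesis by blast
  next
    case False
    show ?thesis
    proof (cases "\<exists>i<d. a i \<noteq> 0")
      case False
      then show ?thesis by (simp add: admissible_def)
    next
      case True
      then obtain i0 where i0: "i0 < d" "a i0 \<noteq> 0" by blast
      have rest: "a l = 0" if "l \<noteq> i0" for l
      proof (cases "l < d")
        case True
        with False i0 that show ?thesis by blast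
      qed (use less.prems(4) in \<open>simp add: multi_indices_def\<close>)
      have an: "a = (\<lambda>_. 0)(i0 := a i0)" using rest by auto
      have "(\<Sum>j<d. a j) = a i0"
        using sum_upd[OF i0(1), of "\<lambda>_. 0" "a i0"] unfolding an[symmetric] by simp
      then have ai: "a i0 = n" using less.prems(4) by (simp add: multi_indices_def)
      have n0: "n > 0" using i0 ai by simp
      show ?thesis
      proof (cases "\<exists>t. n = CHAR('k) ^ t")
        case False
        have prime: "prime CHAR('k)"
          using E False n0 less.prems(3)
        proof (cases rule: exponents_cases)
          case 1
          then have "n = CHAR('k) ^ 0" using less.prems(3) n0 by simp
          with False show ?thesis by blast
        qed
        define s where "s = multiplicity CHAR('k) n"
        have "n \<noteq> 0" "\<not> is_unit CHAR('k)" using n0 prime not_prime_unit by auto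
        from multiplicity_decompose'[OF this] obtain u where u: "n = CHAR('k) ^ s * u" "\<not> CHAR('k) dvd u"
          unfolding s_def by blast
        have "u \<noteq> 0" using u(1) n0 by auto
        moreover have "u \<noteq> 1" using u(1) False by auto
        ultimately have u1: "u > 1" by simp
        have ps: "CHAR('k) ^ s > 0" using prime prime_gt_0_nat by simp
        have lt: "CHAR('k) ^ s < n" using u u1 ps by simp
        have nz: "of_nat (n choose CHAR('k) ^ s) \<noteq> (0 :: 'k)"
          using of_nat_choose_prime_power_nonzero[OF prime u] .
        have *: "admissible (a(i0 := n - m))" if m: "0 < m" "m < n" "of_nat (n choose m) \<noteq> (0 :: 'k)" for m
        proof -
          have "admissible (a(i0 := a i0 - m))"
          proof (rule level_coeff_admissible_aux[OF less.prems(1,2,4,5) i0(1)])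
            show "admissible a" if "f \<in> level \<I> (real (n - m))" "rep (n - m) c f"
              "a \<in> multi_indices d (n - m)" "c a \<noteq> 0" for f c a
              using less.IH[OF _ that(1,2) _ that(3,4)] less.prems(3) m by simp
          qed (use m ai in auto)
          then show ?thesis using ai by simp
        qed
        have "of_nat (n choose (n - CHAR('k) ^ s)) \<noteq> (0 :: 'k)"
          using nz lt binomial_symmetric[of "CHAR('k) ^ s" n] by simp
        from *[OF ps lt nz] *[OF _ _ this] lt ps
        have adm: "admissible (a(i0 := n - CHAR('k) ^ s))" "admissible (a(i0 := CHAR('k) ^ s))" by simp_all
        have "CHAR('k) ^ Suc j dvd a i" if "i < d" "j \<le> E" "r j \<le> i" for i j
        proof (cases "i = i0")
          case True
          with adm that have "CHAR('k) ^ Suc j dvd n - CHAR('k) ^ s" "CHAR('k) ^ Suc j dvd CHAR('k) ^ s"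
            unfolding admissible_def by (metis fun_upd_same)+
          then have "CHAR('k) ^ Suc j dvd (n - CHAR('k) ^ s) + CHAR('k) ^ s" by (rule dvd_add)
          then show ?thesis using True ai lt by simp
        qed (use rest in simp)
        then show ?thesis unfolding admissible_def by blast
      next
        case True
        then obtain t' where t': "n = CHAR('k) ^ t'" by blast
        obtain t where t: "n = CHAR('k) ^ t" "t \<le> E"
          using E
        proof (cases rule: exponents_cases)
          case 1
          with less.prems(3) n0 have "n = CHAR('k) ^ 0" by simp
          then show thesis using that[of 0] by simp
        next
          case 2
          from t' less.prems(3) have "t' \<le> E"
            using prime_gt_1_nat[OF 2] by simp
          with t' that show thesis by blast
        qed
        define single where "single i = (\<lambda>_. 0)(i := n)" for i :: nat
        \<comment> \<open>The pure powers that should not occur; every other exponent of the form is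
          admissible by \<open>low\<close>.\<close>
        define B where "B = single ` {r t..<d}"
        have low: "admissible b" if b: "b \<in> multi_indices d n" "c b \<noteq> 0" "b \<notin> B" for b
        proof (cases "\<exists>i i'. i < d \<and> i' < d \<and> i \<noteq> i' \<and> b i \<noteq> 0 \<and> b i' \<noteq> 0")
          case True
          with mixed b show ?thesis by blast
        next
          case False
          have "\<exists>i<d. b i \<noteq> 0"
          proof (rule ccontr)
            assume "\<not> ?thesis"
            then have "(\<Sum>i<d. b i) = 0" by simp
            with b(1) n0 show False by (simp add: multi_indices_def)
          qed
          then obtain i where i: "i < d" "b i \<noteq> 0" by blast
          have "b l = 0" if "l \<noteq> i" for l
          proof (cases "l < d")
            case True
            with False i that show ?thesis by blast
          qed (use b(1) in \<open>simp add: multi_indices_def\<close>)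
          then have bs: "b = (\<lambda>_. 0)(i := b i)" by auto
          have "(\<Sum>j<d. b j) = b i"
            using sum_upd[OF i(1), of "\<lambda>_. 0" "b i"] unfolding bs[symmetric] by simp
          then have "b i = n" using b(1) by (simp add: multi_indices_def)
          then have "b = single i" using bs by (simp add: single_def)
          have ir: "i < r t"
          proof (rule ccontr)
            assume "\<not> i < r t"
            then have "single i \<in> B" using i by (simp add: B_def)
            with b(3) \<open>b = single i\<close> show False by simp
          qed
          have "CHAR('k) ^ Suc j dvd b l" if "l < d" "j \<le> E" "r j \<le> l" for l j
          proof (cases "l = i")
            case True
            have "j < t"
            proof (rule ccontr)
              assume "\<not> j < t"
              with r_mono[of t j] that(2) have "r t \<le> r j" by simp
              with ir that True show False by simp
            qed
            then show ?thesis
              using True \<open>b i = n\<close> t(1) le_imp_power_dvd[of "Suc j" t "CHAR('k)"] by simp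
          qed (use bs in \<open>metis fun_upd_other dvd_0_right\<close>)
          then show ?thesis unfolding admissible_def by blast
        qed
        have "\<forall>b. \<exists>h. b \<in> multi_indices d n \<and> c b \<noteq> 0 \<and> b \<notin> B \<longrightarrow>
            h \<in> level \<I> (real n) \<and> h - mon b \<in> powI Q (Suc n)"
          using admissible_mon_lift[OF _ less.prems(3) low] by blast
        then obtain h where h: "\<And>b. b \<in> multi_indices d n \<Longrightarrow> c b \<noteq> 0 \<Longrightarrow> b \<notin> B \<Longrightarrow> h b \<in> level \<I> (real n)"
          "\<And>b. b \<in> multi_indices d n \<Longrightarrow> c b \<noteq> 0 \<Longrightarrow> b \<notin> B \<Longrightarrow> h b - mon b \<in> powI Q (Suc n)" by metis
        define S where "S = {b \<in> multi_indices d n. c b \<noteq> 0 \<and> b \<notin> B}"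
        define g where "g = f + (\<Sum>b\<in>S. (- \<iota> (c b)) * h b)"
        have g: "g \<in> level \<I> (real (CHAR('k) ^ t))"
          unfolding g_def t(1)[symmetric] using h(1) less.prems(1)
          by (intro filtration_add[OF filtration] filtration_sum[OF filtration]
              filtration_mult_left[OF filtration]) (auto simp: S_def)
        have BS: "B \<subseteq> multi_indices d n"
          using single_upd by (auto simp: B_def single_def)
        have inj: "inj_on single {r t..<d}"
          using n0 by (intro inj_onI) (auto simp: single_def fun_eq_iff split: if_splits)
        have "form n c = (\<Sum>b\<in>S \<union> B. \<iota> (c b) * mon b)"
          unfolding form_def using BS by (intro sum.mono_neutral_right) (auto simp: S_def)
        also have "\<dots> = (\<Sum>b\<in>S. \<iota> (c b) * mon b) + (\<Sum>b\<in>B. \<iota> (c b) * mon b)"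
          by (rule sum.union_disjoint) (auto simp: S_def B_def)
        also have "(\<Sum>b\<in>B. \<iota> (c b) * mon b) = (\<Sum>i\<in>{r t..<d}. \<iota> (c (single i)) * mon (single i))"
          unfolding B_def using inj by (simp add: sum.reindex)
        finally have fm: "form n c = (\<Sum>b\<in>S. \<iota> (c b) * mon b)
            + (\<Sum>i\<in>{r t..<d}. \<iota> (c (single i)) * mon (single i))" .
        have "(\<Sum>b\<in>S. \<iota> (c b) * (h b - mon b)) \<in> powI Q (Suc n)"
          by (rule pw_sum, rule pw_mult_left) (use h(2) in \<open>simp add: S_def\<close>)
        from pw_diff[OF less.prems(2)[unfolded rep_def] this]
        have g1: "g - (\<Sum>i\<in>{r t..<d}. \<iota> (c (single i)) * mon (single i)) \<in> powI Q (Suc n)"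
          unfolding fm g_def by (simp add: right_diff_distrib sum_subtractf sum_negf algebra_simps)
        \<comment> \<open>Coefficients have p^t-th roots and the power map is additive, so the
          remaining pure powers combine into the p^t-th power of one linear form.\<close>
        have "\<forall>i. \<exists>b. b ^ (CHAR('k) ^ t) = c (single i)" using frobenius_root[OF t(2)] by blast
        then obtain e where e: "\<And>i. e i ^ (CHAR('k) ^ t) = c (single i)" by metis
        define e' where "e' i = (if r t \<le> i then e i else 0)" for i
        have mon_single: "mon (single i) = x i ^ n" if "i < d" for i
        proof -
          have "mon (single i) = (\<Prod>j<d. if j = i then x i ^ n else 1)"
            unfolding mon_def by (rule prod.cong) (auto simp: single_def)
          then show ?thesis using that by simp
        qed
        have "(\<Sum>i<d. \<iota> (e' i) * x i) = (\<Sum>i\<in>{r t..<d}. \<iota> (e i) * x i)"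
          by (rule sum.mono_neutral_cong_right) (auto simp: e'_def)
        then have "(\<Sum>i<d. \<iota> (e' i) * x i) ^ (CHAR('k) ^ t) = (\<Sum>i\<in>{r t..<d}. (\<iota> (e i) * x i) ^ (CHAR('k) ^ t))"
          using frobenius_sum[OF exponents_le[OF t(2)]] by simp
        also have "\<dots> = (\<Sum>i\<in>{r t..<d}. \<iota> (c (single i)) * mon (single i))"
          using mon_single by (intro sum.cong) (auto simp: power_mult_distrib map_power[symmetric] e t(1))
        finally have "g - (\<Sum>i<d. \<iota> (e' i) * x i) ^ (CHAR('k) ^ t) \<in> powI Q (Suc (CHAR('k) ^ t))"
          using g1 t(1) by simp
        from pure_only[OF t(2) g this] have e0: "e' i = 0" if "r t \<le> i" "i < d" for i
          using that .
        have zero: "c (single i) = 0" if "r t \<le> i" "i < d" for i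
        proof -
          have "e i ^ n = c (single i)" unfolding t(1) by (rule e)
          moreover have "e i = 0" using e0[OF that] that(1) by (simp add: e'_def)
          ultimately show ?thesis using zero_power[OF n0] by metis
        qed
        have "a = single i0" using an ai by (simp add: single_def)
        with zero[of i0] i0 less.prems(5) have "i0 < r t" by (metis not_le)
        then have "a \<notin> B" using \<open>a = single i0\<close> n0 by (auto simp: B_def single_def fun_eq_iff split: if_splits)
        with low less.prems show ?thesis by blast
      qed
    qed
  qed
qed

end

section \<open>Semicontinuity along adapted coordinates\<close>

context adapted_coordinates
begin

text \<open>The admissible monomials of degree p^E are lifted to the filtration; applying their dual
  operators to the lifts gives a matrix that evaluates to the identity at the given point, and
  \<open>g\<close> is its determinant. Were \<open>r' E\<close> smaller at another point with equal
  earlier entries, fewer monomials would be admissible there. Some combination of the lifts would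
  then fall into the next power of the new maximal ideal, and operators of order p^E map it to 0 at
  the new point, so the matrix would be singular there. All admissible monomials are counted because
  a lift of a pure power need not have a pure leading form at the other point.\<close>

lemma semicontinuity_at:
  "\<exists>g. ev g \<noteq> 0 \<and> (\<forall>ev' x' \<phi>' r'. adapted_coordinates \<iota> d ev' x' \<phi>' \<I> E r' \<longrightarrow> ev' g \<noteq> 0 \<longrightarrow>
    (\<forall>j<E. r' j = r j) \<longrightarrow> r E \<le> r' E)"
proof -
  define n where "n = CHAR('k) ^ E"
  define N where "N = {a \<in> multi_indices d n. admissible a}"
  have finN: "finite N" by (simp add: N_def)
  obtain b where b: "bij_betw b {0..<card N} N" using ex_bij_betw_nat_finite[OF finN] by blast
  define M where "M = card N"
  have bN: "b s \<in> N" if "s < M" for s using b that by (auto simp: bij_betw_def M_def)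
  have binj: "b s = b t \<longleftrightarrow> s = t" if "s < M" "t < M" for s t
    using b that by (auto simp: bij_betw_def M_def inj_on_def)
  have "\<forall>a. \<exists>h. a \<in> N \<longrightarrow> h \<in> level \<I> (real n) \<and> h - mon a \<in> powI Q (Suc n)"
    using admissible_mon_lift[of _ n] by (auto simp: N_def n_def)
  then obtain h where h: "\<And>a. a \<in> N \<Longrightarrow> h a \<in> level \<I> (real n)" "\<And>a. a \<in> N \<Longrightarrow> h a - mon a \<in> powI Q (Suc n)"
    by metis
  define A where "A s t = hs_iter (b s) d (h (b t))" for s t
  have evA: "ev (A s t) = (if s = t then 1 else 0)" if "s < M" "t < M" for s t
  proof -
    have bt: "b t \<in> multi_indices d n" and bs: "b s \<in> multi_indices d n" using bN that by (auto simp: N_def)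
    have "rep n (\<lambda>a. (if a = b t then 1 else 0) + 0) (mon (b t) + (h (b t) - mon (b t)))"
      by (rule rep_add[OF rep_mon[OF bt] rep_higher[OF h(2)[OF bN[OF that(2)]]]])
    then have "rep n (\<lambda>a. if a = b t then 1 else 0) (h (b t))" by simp
    from ev_hs_iter[OF this bs] show ?thesis using binj[OF that] by (simp add: A_def)
  qed
  obtain B where B: "\<And>s t. s < M \<Longrightarrow> t < M \<Longrightarrow> (\<Sum>l<M. B s l * A l t) = (if s = t then fun_det M A else 0)"
    using fun_det_adjugate[of M A] by blast
  have "ev (fun_det M A) = 1"
    unfolding fun_det_hom[of ev, OF ev_add ev_mult ev_1] using evA by (rule fun_det_one)
  moreover have "r E \<le> r' E"
    if ad: "adapted_coordinates \<iota> d ev' x' \<phi>' \<I> E r'" and nz: "ev' (fun_det M A) \<noteq> 0"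
      and eq: "\<forall>j<E. r' j = r j" for ev' x' \<phi>' r'
  proof (rule ccontr)
    assume "\<not> r E \<le> r' E"
    then have less: "r' E < r E" by simp
    interpret N: adapted_coordinates \<iota> d ev' x' \<phi>' \<I> E r' by (rule ad)
    define N' where "N' = {a \<in> multi_indices d n. N.admissible a}"
    have finN': "finite N'" by (simp add: N'_def)
    have ppos: "CHAR('k) ^ E > 0" using E by (cases rule: exponents_cases) (auto intro: prime_gt_0_nat)
    have "N' \<subset> N"
    proof
      have "r' j \<le> i" if "j \<le> E" "r j \<le> i" for i j
        using that eq less by (cases "j = E") auto
      then show "N' \<subseteq> N" by (auto simp: N'_def N_def N.admissible_def admissible_def)
      \<comment> \<open>The p^E-th power of the coordinate with index \<open>r' E\<close> is
        admissible at the old point but not at the new one.\<close>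
      define a where "a = (\<lambda>_. 0)(r' E := CHAR('k) ^ E)"
      have rd: "r' E < d" using less r_le[of E] by simp
      have "a \<in> multi_indices d n"
        using sum_upd[OF rd, of "\<lambda>_. 0" "CHAR('k) ^ E"] rd by (simp add: multi_indices_def a_def n_def)
      moreover have "CHAR('k) ^ Suc j dvd a i" if "i < d" "j \<le> E" "r j \<le> i" for i j
      proof (cases "i = r' E")
        case True
        with less that have "j \<noteq> E" by auto
        with that(2) True show ?thesis
          using le_imp_power_dvd[of "Suc j" E "CHAR('k)"] by (simp add: a_def)
      qed (simp add: a_def)
      then have "admissible a" by (simp add: admissible_def)
      moreover have "\<not> N.admissible a"
      proof
        assume "N.admissible a"
        then have "CHAR('k) ^ Suc E dvd a (r' E)" using rd unfolding N.admissible_def by blast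
        then have "CHAR('k) ^ Suc E dvd CHAR('k) ^ E" by (simp add: a_def)
        from E this show False
        proof (cases rule: exponents_cases)
          case 2
          have "CHAR('k) ^ Suc E \<le> CHAR('k) ^ E" using \<open>CHAR('k) ^ Suc E dvd CHAR('k) ^ E\<close> ppos by (rule dvd_imp_le)
          with prime_gt_1_nat[OF 2] show ?thesis by (simp add: power_increasing_iff)
        qed simp
      qed
      ultimately show "N' \<noteq> N" by (auto simp: N'_def N_def)
    qed
    then have "card N' < card N" using finN by (rule psubset_card_mono[rotated])
    have "\<exists>c. N.rep n c (h a)" if "a \<in> N" for a
      using N.rep_exists[OF N.level_powI[OF h(1)[OF that]]] .
    then obtain c where c: "\<And>a. a \<in> N \<Longrightarrow> N.rep n (c a) (h a)" by metis
    \<comment> \<open>At the new point the leading forms of the lifts have nonzero coefficients only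
      on \<open>N'\<close>, which is smaller than the number of lifts.\<close>
    from nontrivial_linear_relation[of N' "{..<M}" "\<lambda>s a. c (b s) a"] finN' \<open>card N' < card N\<close>
    obtain l where l: "\<exists>s<M. l s \<noteq> 0" "\<And>a. a \<in> N' \<Longrightarrow> (\<Sum>s<M. l s * c (b s) a) = 0"
      by (auto simp: M_def)
    define f where "f = (\<Sum>s<M. \<iota> (l s) * h (b s))"
    have "N.rep n (\<lambda>a. \<Sum>s<M. l s * c (b s) a) f"
      unfolding f_def using c bN by (intro N.rep_sum N.rep_scale) auto
    moreover have "(\<Sum>s<M. l s * c (b s) a) = 0" if a: "a \<in> multi_indices d n" for a
    proof (cases "a \<in> N'")
      case False
      have "c (b s) a = 0" if "s < M" for s
        using N.level_coeff_admissible[OF h(1)[OF bN[OF that]] c[OF bN[OF that]] _ a] False a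
        by (auto simp: n_def N'_def)
      then show ?thesis by simp
    qed (rule l(2))
    ultimately have f: "f \<in> powI N.Q (Suc n)" by (rule N.rep_zero_imp_higher)
    have "(\<Sum>t<M. ev' (A s t) * l t) = 0" if s: "s < M" for s
    proof -
      have "diff_op \<iota> n (hs_iter (b s) d)"
        using diff_op_hs_iter[of d "b s"] bN[OF s] by (simp add: N_def multi_indices_def)
      from diff_op_powI[OF N.ring_ideal_Q this f] diff_op_k_linear[OF this]
      have 0: "ev' (hs_iter (b s) d f) = 0" and lin: "k_linear \<iota> (hs_iter (b s) d)"
        by (auto simp: N.Q_def)
      have z: "hs_iter (b s) d 0 = 0" using lin unfolding k_linear_def by (metis add_cancel_right_right)
      have "hs_iter (b s) d (\<Sum>t\<in>S. \<iota> (l t) * h (b t)) = (\<Sum>t\<in>S. \<iota> (l t) * hs_iter (b s) d (h (b t)))" for S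
        using lin z by (induction S rule: infinite_finite_induct) (auto simp: k_linear_def)
      from this[of "{..<M}"] 0 show ?thesis
        by (simp add: f_def A_def N.ev_sum N.ev_mult mult.commute)
    qed
    then have "l s = 0" if s: "s < M" for s
    proof -
      have "ev' (fun_det M A) * l s = (\<Sum>t<M. if s = t then ev' (fun_det M A) * l t else 0)"
        using s by simp
      also have "\<dots> = (\<Sum>t<M. ev' (\<Sum>i<M. B s i * A i t) * l t)"
        using B[OF s] by (intro sum.cong) auto
      also have "\<dots> = (\<Sum>i<M. ev' (B s i) * (\<Sum>t<M. ev' (A i t) * l t))"
        unfolding N.ev_sum N.ev_mult sum_distrib_left sum_distrib_right
        by (subst sum.swap) (simp only: mult.assoc)
      also have "\<dots> = 0" using \<open>\<And>s. s < M \<Longrightarrow> (\<Sum>t<M. ev' (A s t) * l t) = 0\<close> by simp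
      finally show ?thesis using nz by simp
    qed
    with l(1) show False by blast
  qed
  ultimately show ?thesis by (intro exI[of _ "fun_det M A"]) auto
qed

end

section \<open>Existence of local coordinates\<close>

context domain_algebra
begin

text \<open>Each generator of \<open>'a\<close>, minus its value and its linear part in the
  \<open>x i\<close>, becomes some \<open>w j\<close> in the square of the maximal ideal. Written as
  a sum of products of elements of that ideal, it yields an equation w = q(x, w) whose differential
  vanishes at the point, as the Newton iteration requires.\<close>

lemma local_coordinates_exist:
  fixes ev :: "'a \<Rightarrow> 'k"
  assumes ev: "\<And>f g. ev (f + g) = ev f + ev g" "\<And>f g. ev (f * g) = ev f * ev g" "\<And>c. ev (\<iota> c) = c"
    and gen: "adjoin_list (range \<iota>) ys = UNIV"
    and P: "\<And>i. i \<le> d \<Longrightarrow> prime_in (UNIV :: 'a set) (P i)"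
    and chain: "\<And>i. i < d \<Longrightarrow> P i \<subset> P (Suc i)"
    and x: "\<And>i. i < d \<Longrightarrow> ev (x i) = 0"
    and span: "\<And>f. ev f = 0 \<Longrightarrow> \<exists>c. f - (\<Sum>i<d. \<iota> (c i) * x i) \<in> powI {f. ev f = 0} 2"
  shows "\<exists>\<phi>. local_coordinates \<iota> d ev x \<phi>"
proof -
  define Q where "Q = {f. ev f = 0}"
  have ev0: "ev 0 = 0" using ev(3)[of 0] by simp
  have Q: "ring_ideal Q" by (auto simp: ring_ideal_def Q_def ev ev0)
  define m where "m = length ys"
  define u where "u j = ys ! j - \<iota> (ev (ys ! j))" for j
  have evu: "ev (u j) = 0" for j
    using ev(1)[of "u j" "\<iota> (ev (ys ! j))"] by (simp add: u_def ev(3))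
  obtain c where c: "\<And>j. u j - (\<Sum>i<d. \<iota> (c j i) * x i) \<in> powI Q 2"
    using span[OF evu] unfolding Q_def by metis
  define w where "w j = u j - (\<Sum>i<d. \<iota> (c j i) * x i)" for j
  define a where "a t = (if t < d then x t else if t < d + m then w (t - d) else 0)" for t
  have "range (peval \<iota> a) = UNIV"
  proof -
    define B where "B = range (peval \<iota> a)"
    have B: "subalg B" unfolding B_def by (rule subalg_range_peval)
    have aB: "a t \<in> B" for t unfolding B_def by (rule range_peval_mem)
    have xB: "x i \<in> B" if "i < d" for i using aB[of i] that by (simp add: a_def)
    have wB: "w j \<in> B" if "j < m" for j using aB[of "d + j"] that by (simp add: a_def)
    have "ys ! j \<in> B" if "j < m" for j
    proof -
      have "ys ! j = w j + ((\<Sum>i<d. \<iota> (c j i) * x i) + \<iota> (ev (ys ! j)))" by (simp add: w_def u_def)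
      also have "\<dots> \<in> B" using B xB wB that
        by (intro subalg_add subalg_sum subalg_mult subalg_map) auto
      finally show ?thesis .
    qed
    then have "set ys \<subseteq> B" by (auto simp: in_set_conv_nth m_def)
    then have "adjoin_list (range \<iota>) ys \<subseteq> B"
      using B by (intro adjoin_list_least subalg_range) (auto simp: subalg_def)
    then show ?thesis using gen by (auto simp: B_def)
  qed
  then have ex: "\<exists>e. peval \<iota> a e = f" for f by (metis UNIV_I imageE)
  \<comment> \<open>The expression is chosen as a sum of products of factors vanishing at the point;
    by the product rule its differential vanishes there.\<close>
  have quadratic: "\<exists>q. peval \<iota> a q = f \<and> (\<forall>j. ev (pdiff \<iota> a (unit_vec_fun j) q) = 0)" if "f \<in> powI Q 2" for f
  proof -
    from that have "f \<in> powI Q (Suc (Suc 0))" by (simp add: numeral_2_eq_2)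
    then show ?thesis
    proof (induction rule: powI_Suc_induct)
      case (prod q g)
      then have z: "ev q = 0" "ev g = 0" by (auto simp: powI_1[OF Q]) (auto simp: Q_def)
      obtain e e' where e: "peval \<iota> a e = q" "peval \<iota> a e' = g" using ex by metis
      show ?case
        by (intro exI[of _ "PMul e e'"]) (simp add: e z ev)
    next
      case (add f g)
      then obtain q q' where "peval \<iota> a q = f" "\<forall>j. ev (pdiff \<iota> a (unit_vec_fun j) q) = 0"
        "peval \<iota> a q' = g" "\<forall>j. ev (pdiff \<iota> a (unit_vec_fun j) q') = 0" by blast
      then show ?case by (intro exI[of _ "PAdd q q'"]) (simp add: ev)
    qed
  qed
  have "\<exists>q. peval \<iota> a q = w j \<and> (\<forall>i. ev (pdiff \<iota> a (unit_vec_fun i) q) = 0)" for j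
    using quadratic c by (simp add: w_def)
  then obtain q where q: "\<And>j. peval \<iota> a (q j) = w j"
    "\<And>i j. ev (pdiff \<iota> a (unit_vec_fun i) (q j)) = 0" by metis
  have "\<exists>\<phi>. hasse_schmidt \<phi> \<and> (\<forall>j<d. ev (\<phi> (x j) $ 1) = (if i = j then 1 else 0))" for i
  proof -
    obtain \<phi> where "hasse_schmidt \<phi>" "\<And>j. j < d \<Longrightarrow> ev (\<phi> (a j) $ 1) = (if i = j then 1 else 0)"
      using hasse_schmidt_exists[of ev d m a q d P "\<lambda>j. if i = j then 1 else 0"]
        ev q \<open>range (peval \<iota> a) = UNIV\<close> P chain by (auto simp: a_def)
    then show ?thesis by (intro exI[of _ \<phi>]) (auto simp: a_def)
  qed
  then obtain \<phi> where \<phi>: "\<And>i. hasse_schmidt (\<phi> i)"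
    "\<And>i j. j < d \<Longrightarrow> ev (\<phi> i (x j) $ 1) = (if i = j then 1 else 0)" by metis
  have "local_coordinates \<iota> d ev x \<phi>"
    by unfold_locales (use ev x span \<phi> in auto)
  then show ?thesis by blast
qed

end

section \<open>Local rings as sets of fractions: ideals, their powers and regularity\<close>

section \<open>Local rings\<close>

lemma (in cring) idealI_cring:
  assumes "J \<subseteq> carrier R" "\<zero> \<in> J" "\<And>a b. a \<in> J \<Longrightarrow> b \<in> J \<Longrightarrow> a \<oplus> b \<in> J"
    "\<And>x a. x \<in> carrier R \<Longrightarrow> a \<in> J \<Longrightarrow> x \<otimes> a \<in> J"
  shows "ideal J R"
proof (rule idealI)
  show "subgroup J (add_monoid R)"
  proof (rule add.subgroupI)
    fix a assume a: "a \<in> J"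
    have "(\<ominus> \<one>) \<otimes> a \<in> J" using a by (intro assms(4)) auto
    then show "\<ominus> a \<in> J" using a assms(1) by (simp add: l_minus subsetD)
  qed (use assms in auto)
  show "a \<otimes> x \<in> J" if "a \<in> J" "x \<in> carrier R" for a x
    using that assms(1,4) m_comm by (metis subsetD)
qed (use assms ring_axioms in auto)

lemma type_ring_uminus: "\<ominus>\<^bsub>(type_ring :: 'a :: comm_ring_1 ring)\<^esub> x = - x"
proof -
  interpret cring "type_ring :: 'a ring" by (rule cring_from_type_algebra)
  show ?thesis by (rule minus_equality) simp_all
qed

lemma ideal_type_ring_iff: "ideal J (type_ring :: 'a :: comm_ring_1 ring) \<longleftrightarrow> ring_ideal J"
proof -
  interpret cring "type_ring :: 'a ring" by (rule cring_from_type_algebra)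
  show ?thesis
  proof
    assume J: "ideal J (type_ring :: 'a ring)"
    show "ring_ideal J"
      using additive_subgroup.zero_closed[OF ideal.axioms(1)[OF J]]
        additive_subgroup.a_closed[OF ideal.axioms(1)[OF J]] ideal.I_l_closed[OF J]
      by (auto simp: ring_ideal_def)
  next
    assume "ring_ideal J"
    then show "ideal J (type_ring :: 'a ring)" by (intro idealI_cring) (auto simp: ring_ideal_def)
  qed
qed

lemma prime_in_ring_ideal: "prime_in UNIV P \<Longrightarrow> ring_ideal P"
  by (auto simp: prime_in_def ring_ideal_def)

lemma primeideal_type_ring_iff:
  "primeideal J (type_ring :: 'a :: comm_ring_1 ring) \<longleftrightarrow> prime_in UNIV J"
proof
  assume "primeideal J (type_ring :: 'a ring)"
  then interpret primeideal J "type_ring :: 'a ring" .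
  have "ring_ideal J" using is_ideal by (simp add: ideal_type_ring_iff)
  moreover have "1 \<notin> J" using I_notcarr one_imp_carrier by auto
  moreover have "x \<in> J \<or> y \<in> J" if "x * y \<in> J" for x y using I_prime[of x y] that by simp
  ultimately show "prime_in UNIV J" by (auto simp: prime_in_def ring_ideal_def)
next
  assume J: "prime_in UNIV J"
  show "primeideal J (type_ring :: 'a ring)"
  proof (rule primeidealI)
    show "ideal J (type_ring :: 'a ring)" using J by (simp add: ideal_type_ring_iff prime_in_ring_ideal)
  qed (use J in \<open>auto simp: prime_in_def cring_from_type_algebra\<close>)
qed

lemma local_ring_simps [simp]:
  "carrier (local_ring P) = {Fract a b | a b. b \<notin> P}"
  "x \<otimes>\<^bsub>local_ring P\<^esub> y = x * y" "x \<oplus>\<^bsub>local_ring P\<^esub> y = x + y"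
  "\<zero>\<^bsub>local_ring P\<^esub> = 0" "\<one>\<^bsub>local_ring P\<^esub> = 1"
  by (simp_all add: local_ring_def ring_of_type_algebra_def)

lemma local_ring_pow: "x [^]\<^bsub>local_ring P\<^esub> (n :: nat) = x ^ n"
  by (induction n) (simp_all add: nat_pow_def mult.commute)

locale prime_localization =
  fixes P :: "'a :: idom set"
  assumes prime: "prime_in UNIV P"
begin

lemma zero_mem: "0 \<in> P" and one_nmem: "1 \<notin> P"
  and add_mem: "x \<in> P \<Longrightarrow> y \<in> P \<Longrightarrow> x + y \<in> P"
  and mult_mem: "x \<in> P \<Longrightarrow> r * x \<in> P" and mult_mem': "x \<in> P \<Longrightarrow> x * r \<in> P"
  using prime by (auto simp: prime_in_def mult.commute)

lemma denom_nonzero: "s \<notin> P \<Longrightarrow> s \<noteq> 0"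
  using zero_mem by auto

lemma denom_mult: "s \<notin> P \<Longrightarrow> t \<notin> P \<Longrightarrow> s * t \<notin> P"
  using prime by (auto simp: prime_in_def)

lemma denom_power: "s \<notin> P \<Longrightarrow> s ^ n \<notin> P"
  by (induction n) (auto simp: one_nmem denom_mult)

lemma cring_local_ring: "cring (local_ring P)"
proof -
  interpret K: cring "type_ring :: 'a fract ring" by (rule cring_from_type_algebra)
  define C where "C = {Fract a b | a b. b \<notin> P}"
  have "subring C (type_ring :: 'a fract ring)"
  proof (rule K.subringI)
    show "\<one>\<^bsub>type_ring\<^esub> \<in> C"
      unfolding C_def type_ring_simps One_fract_def using one_nmem by blast
  next
    fix h1 h2 assume "h1 \<in> C" "h2 \<in> C"
    then obtain a b c e where *: "h1 = Fract a b" "h2 = Fract c e" "b \<notin> P" "e \<notin> P" by (auto simp: C_def)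
    then show "h1 \<otimes>\<^bsub>type_ring\<^esub> h2 \<in> C" "h1 \<oplus>\<^bsub>type_ring\<^esub> h2 \<in> C"
      using denom_mult denom_nonzero unfolding C_def by (auto intro!: exI)
  next
    fix h assume "h \<in> C"
    then obtain a b where "h = Fract a b" "b \<notin> P" by (auto simp: C_def)
    then have "- h = Fract (- a) b" "b \<notin> P" by simp_all
    then show "\<ominus>\<^bsub>type_ring\<^esub> h \<in> C" unfolding C_def type_ring_uminus by blast
  qed simp
  then have "subcring C (type_ring :: 'a fract ring)" by (rule K.subcringI')
  then show ?thesis using K.subcring_iff[of C] by (simp add: local_ring_def C_def)
qed

lemma local_carrierI: "s \<notin> P \<Longrightarrow> Fract f s \<in> carrier (local_ring P)"
  by auto

lemma Fract_one_mem: "Fract f 1 \<in> carrier (local_ring P)"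
  using one_nmem by auto

definition fractions :: "'a set \<Rightarrow> 'a fract set"
  where "fractions J = {Fract f s | f s. f \<in> J \<and> s \<notin> P}"

lemma fractionsI: "f \<in> J \<Longrightarrow> s \<notin> P \<Longrightarrow> Fract f s \<in> fractions J"
  by (auto simp: fractions_def)

lemma local_max_eq: "local_max P = fractions P"
  by (simp add: local_max_def fractions_def)

lemma ideal_fractions:
  assumes J: "ring_ideal J"
  shows "ideal (fractions J) (local_ring P)"
proof -
  interpret cring "local_ring P" by (rule cring_local_ring)
  show ?thesis
  proof (rule idealI_cring)
    show "fractions J \<subseteq> carrier (local_ring P)" by (auto simp: fractions_def)
    have "Fract 0 1 \<in> fractions J" using J one_nmem by (intro fractionsI) (auto simp: ring_ideal_def)
    then show "\<zero>\<^bsub>local_ring P\<^esub> \<in> fractions J" by (simp add: Zero_fract_def)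
  next
    fix x y assume "x \<in> fractions J" "y \<in> fractions J"
    then obtain f s g t where *: "x = Fract f s" "y = Fract g t" "f \<in> J" "g \<in> J" "s \<notin> P" "t \<notin> P"
      by (auto simp: fractions_def)
    have "t * f + s * g \<in> J" using J * by (auto simp: ring_ideal_def)
    then have "Fract (t * f + s * g) (s * t) \<in> fractions J" using * denom_mult by (intro fractionsI) auto
    then show "x \<oplus>\<^bsub>local_ring P\<^esub> y \<in> fractions J" using * denom_nonzero by (simp add: mult.commute)
  next
    fix x y assume "x \<in> carrier (local_ring P)" "y \<in> fractions J"
    then obtain f s g t where *: "x = Fract f s" "y = Fract g t" "g \<in> J" "s \<notin> P" "t \<notin> P"
      by (auto simp: fractions_def)
    then have "Fract (f * g) (s * t) \<in> fractions J"
      using J denom_mult by (intro fractionsI) (auto simp: ring_ideal_def)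
    then show "x \<otimes>\<^bsub>local_ring P\<^esub> y \<in> fractions J" using * by simp
  qed
qed

lemma genideal_local:
  assumes J: "ring_ideal J"
  shows "Idl\<^bsub>local_ring P\<^esub> ((\<lambda>f. Fract f 1) ` J) = fractions J"
proof
  have "(\<lambda>f. Fract f 1) ` J \<subseteq> fractions J" using one_nmem by (auto intro: fractionsI)
  then show "Idl\<^bsub>local_ring P\<^esub> ((\<lambda>f. Fract f 1) ` J) \<subseteq> fractions J"
    unfolding genideal_def using ideal_fractions[OF J] by blast
  show "fractions J \<subseteq> Idl\<^bsub>local_ring P\<^esub> ((\<lambda>f. Fract f 1) ` J)"
    unfolding genideal_def
  proof (intro subsetI InterI)
    fix x I assume "x \<in> fractions J" "I \<in> {I. ideal I (local_ring P) \<and> (\<lambda>f. Fract f 1) ` J \<subseteq> I}"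
    then obtain f s where *: "x = Fract f s" "f \<in> J" "s \<notin> P" and I: "ideal I (local_ring P)" "Fract f 1 \<in> I"
      by (auto simp: fractions_def)
    from ideal.I_l_closed[OF I, of "Fract 1 s"] * show "x \<in> I" by auto
  qed
qed

lemma ideal_pow_local: "ideal_pow (local_ring P) (local_max P) n = fractions (powI P n)"
proof (induction n)
  case 0
  then show ?case by (auto simp: ideal_pow_0 fractions_def)
next
  case (Suc n)
  note P = prime_in_ring_ideal[OF prime]
  have eq: "ideal_pow (local_ring P) (local_max P) (Suc n) =
      ideal_prod (local_ring P) (fractions P) (fractions (powI P n))"
    unfolding ideal_pow_Suc Suc by (simp only: local_max_eq)
  show ?case unfolding eq
  proof
    show "ideal_prod (local_ring P) (fractions P) (fractions (powI P n)) \<subseteq> fractions (powI P (Suc n))"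
    proof
      fix x assume "x \<in> ideal_prod (local_ring P) (fractions P) (fractions (powI P n))"
      then show "x \<in> fractions (powI P (Suc n))"
      proof (induction rule: ideal_prod.induct)
        case (prod x y)
        then obtain q s g t where *: "x = Fract q s" "y = Fract g t" "q \<in> P" "g \<in> powI P n" "s \<notin> P" "t \<notin> P"
          by (auto simp: fractions_def)
        then have "Fract (q * g) (s * t) \<in> fractions (powI P (Suc n))"
          using denom_mult powI_prod by (intro fractionsI) auto
        with * show ?case by simp
      next
        case (sum x y)
        have "ring_ideal (powI P (Suc n))"
          using powI_zero[OF P] powI_add powI_mult_left[OF P] by (auto simp: ring_ideal_def)
        from additive_subgroup.a_closed[OF ideal.axioms(1)[OF ideal_fractions[OF this]] sum.IH]
        show ?case .
      qed
    qed
    show "fractions (powI P (Suc n)) \<subseteq> ideal_prod (local_ring P) (fractions P) (fractions (powI P n))"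
    proof
      fix x assume "x \<in> fractions (powI P (Suc n))"
      then obtain f s where *: "x = Fract f s" "f \<in> powI P (Suc n)" "s \<notin> P" by (auto simp: fractions_def)
      from *(2) have "Fract f s \<in> ideal_prod (local_ring P) (fractions P) (fractions (powI P n))"
      proof (induction rule: powI_Suc_induct)
        case (prod q g)
        have "Fract q 1 \<otimes>\<^bsub>local_ring P\<^esub> Fract g s \<in> ideal_prod (local_ring P) (fractions P) (fractions (powI P n))"
          using prod *(3) one_nmem by (intro ideal_prod.prod fractionsI)
        then show ?case by simp
      next
        case (add f g)
        have "Fract f s + Fract g s = Fract (f + g) s"
          using denom_nonzero[OF *(3)] by (simp add: eq_fract algebra_simps)
        with ideal_prod.sum[OF add(1,2)] show ?case by (simp only: local_ring_simps)
      qed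
      with * show "x \<in> ideal_prod (local_ring P) (fractions P) (fractions (powI P n))" by simp
    qed
  qed
qed

text \<open>Primes of the local ring contract to primes of \<open>'a\<close>, and strict inclusions
  survive because a fraction and its numerator lie in the same ideals.\<close>

lemma krull_dim_local_le: "krull_dim (local_ring P) \<le> krull_dim (type_ring :: 'a ring)"
  unfolding krull_dim_def
proof (rule Sup_subset_mono, safe)
  fix n \<pp> assume \<pp>: "\<forall>i\<le>n. primeideal (\<pp> i) (local_ring P)" "\<forall>i<n. \<pp> i \<subset> \<pp> (Suc i)"
  define \<qq> where "\<qq> i = {a. Fract a 1 \<in> \<pp> i}" for i
  have "prime_in UNIV (\<qq> i)" if "i \<le> n" for i
  proof -
    interpret primeideal "\<pp> i" "local_ring P" using \<pp> that by blast
    have F: "Fract f 1 \<in> carrier (local_ring P)" for f using one_nmem by auto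
    have "0 \<in> \<pp> i" using additive_subgroup.zero_closed[OF is_additive_subgroup] by simp
    moreover have "1 \<notin> \<pp> i" using I_notcarr one_imp_carrier by auto
    moreover have "Fract (f + g) 1 \<in> \<pp> i" if "Fract f 1 \<in> \<pp> i" "Fract g 1 \<in> \<pp> i" for f g
      using additive_subgroup.a_closed[OF is_additive_subgroup that] by simp
    moreover have "Fract (f * g) 1 \<in> \<pp> i" if "Fract g 1 \<in> \<pp> i" for f g
      using I_l_closed[OF that F[of f]] by simp
    moreover have "Fract f 1 \<in> \<pp> i \<or> Fract g 1 \<in> \<pp> i" if "Fract (f * g) 1 \<in> \<pp> i" for f g
      using I_prime[OF F[of f] F[of g]] that by simp
    ultimately show ?thesis
      unfolding prime_in_def \<qq>_def by (auto simp: Zero_fract_def[symmetric] One_fract_def[symmetric])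
  qed
  moreover have "\<qq> i \<subset> \<qq> (Suc i)" if i: "i < n" for i
  proof -
    have sub: "\<pp> i \<subset> \<pp> (Suc i)" using \<pp>(2) i by blast
    have "primeideal (\<pp> i) (local_ring P)" "primeideal (\<pp> (Suc i)) (local_ring P)"
      using \<pp>(1) i by simp_all
    then interpret I: ideal "\<pp> i" "local_ring P" + J: ideal "\<pp> (Suc i)" "local_ring P"
      by (simp_all add: primeideal.axioms(1))
    obtain y where y: "y \<in> \<pp> (Suc i)" "y \<notin> \<pp> i" using sub by blast
    then obtain a b where ab: "y = Fract a b" "b \<notin> P" using J.Icarr[of y] by auto
    have "Fract b 1 \<in> carrier (local_ring P)" using one_nmem by auto
    from J.I_l_closed[OF y(1) this] have "Fract b 1 * Fract a b \<in> \<pp> (Suc i)" using ab by simp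
    moreover have "Fract b 1 * Fract a b = Fract a 1"
      using denom_nonzero[OF ab(2)] by (simp add: eq_fract mult.commute)
    ultimately have "Fract a 1 \<in> \<pp> (Suc i)" by (simp only:)
    moreover have "Fract a 1 \<notin> \<pp> i"
    proof
      assume "Fract a 1 \<in> \<pp> i"
      from I.I_l_closed[OF this, of "Fract 1 b"] ab y show False by auto
    qed
    ultimately show ?thesis using sub by (auto simp: \<qq>_def)
  qed
  ultimately have "(\<forall>i\<le>n. primeideal (\<qq> i) (type_ring :: 'a ring)) \<and> (\<forall>i<n. \<qq> i \<subset> \<qq> (Suc i))"
    by (simp add: primeideal_type_ring_iff)
  then show "\<exists>m. enat n = enat m \<and> (\<exists>\<pp>. (\<forall>i\<le>m. primeideal (\<pp> i) (type_ring :: 'a ring)) \<and>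
      (\<forall>i<m. \<pp> i \<subset> \<pp> (Suc i)))"
    by blast
qed

end

declare local_ring_simps(1) [simp del]

text \<open>Numerators of generators of the local maximal ideal span the cotangent space: in an
  equation between w f and the sum of the g_i a_i with w outside \<open>P\<close>, replacing w and
  the g_i by their values changes either side only within the square of \<open>P\<close>, and the
  value of w is invertible.\<close>

lemma (in domain_algebra) regular_cotangent_span:
  fixes ev :: "'a \<Rightarrow> 'k" and P :: "'a set"
  assumes ev: "\<And>f g. ev (f + g) = ev f + ev g" "\<And>f g. ev (f * g) = ev f * ev g" "\<And>c. ev (\<iota> c) = c"
    and P: "P = {f. ev f = 0}"
    and reg: "regular_local (local_ring P) (local_max P)"
    and dim: "krull_dim (local_ring P) \<le> enat d"
  shows "\<exists>x. (\<forall>i<d. ev (x i) = 0) \<and> (\<forall>f. ev f = 0 \<longrightarrow> (\<exists>c. f - (\<Sum>i<d. \<iota> (c i) * x i) \<in> powI P 2))"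
proof -
  have ev0: "ev 0 = 0" and ev1: "ev 1 = 1" using ev(3)[of 0] ev(3)[of 1] by simp_all
  have evd: "ev (f - g) = ev f - ev g" for f g
    using ev(1)[of "f - g" g] by (simp add: algebra_simps)
  interpret prime_localization P
    by unfold_locales (auto simp: prime_in_def P ev ev0 ev1)
  interpret L: cring "local_ring P" by (rule cring_local_ring)
  note RI = prime_in_ring_ideal[OF prime]
  obtain S where S: "finite S" "enat (card S) = krull_dim (local_ring P)" "Idl\<^bsub>local_ring P\<^esub> S = local_max P"
    "S \<subseteq> carrier (local_ring P)" using reg unfolding regular_local_def by blast
  define r where "r = card S"
  have rd: "r \<le> d" using S(2) dim unfolding r_def by (metis enat_ord_simps(1))
  obtain s where s: "bij_betw s {0..<r} S" using ex_bij_betw_nat_finite[OF S(1)] unfolding r_def by blast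
  have SM: "S \<subseteq> local_max P" using L.genideal_self[OF S(4)] S(3) by simp
  have "\<forall>i. \<exists>a b. i < r \<longrightarrow> s i = Fract a b \<and> a \<in> P \<and> b \<notin> P"
  proof (intro allI)
    fix i
    show "\<exists>a b. i < r \<longrightarrow> s i = Fract a b \<and> a \<in> P \<and> b \<notin> P"
    proof (cases "i < r")
      case True
      then have "s i \<in> local_max P" using s SM by (auto simp: bij_betw_def)
      then show ?thesis by (auto simp: local_max_def)
    qed simp
  qed
  then obtain a b where ab: "\<And>i. i < r \<Longrightarrow> s i = Fract (a i) (b i)" "\<And>i. i < r \<Longrightarrow> a i \<in> P"
    "\<And>i. i < r \<Longrightarrow> b i \<notin> P" by metis
  \<comment> \<open>The elements that some denominator carries to a combination of the numerators.
    They form an ideal containing the generators, hence the whole maximal ideal.\<close>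
  define T where "T = {z. z \<in> carrier (local_ring P) \<and>
    (\<exists>w g. w \<notin> P \<and> Fract w 1 * z = Fract (\<Sum>i<r. g i * a i) 1)}"
  have sum_lin: "(\<Sum>i<r. (u * g i + v * h i) * a i) = u * (\<Sum>i<r. g i * a i) + v * (\<Sum>i<r. h i * a i)" for u v g h
    by (simp add: sum_distrib_left sum.distrib distrib_right mult.assoc)
  have F_add: "Fract (u + v) 1 = Fract u 1 + Fract v 1" and F_mult: "Fract (u * v) 1 = Fract u 1 * Fract v 1"
    for u v :: 'a by simp_all
  have "ideal T (local_ring P)"
  proof (rule L.idealI_cring)
    show "T \<subseteq> carrier (local_ring P)" by (auto simp: T_def)
    show "\<zero>\<^bsub>local_ring P\<^esub> \<in> T"
      unfolding T_def using one_nmem L.zero_closed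
      by (auto intro!: exI[of _ 1] exI[of _ "\<lambda>_. 0"] simp: Zero_fract_def)
  next
    fix z z' assume z: "z \<in> T" "z' \<in> T"
    then obtain w g w' g' where w: "w \<notin> P" "Fract w 1 * z = Fract (\<Sum>i<r. g i * a i) 1"
      "w' \<notin> P" "Fract w' 1 * z' = Fract (\<Sum>i<r. g' i * a i) 1" by (auto simp: T_def)
    have "Fract (w * w') 1 * (z + z') = Fract w' 1 * (Fract w 1 * z) + Fract w 1 * (Fract w' 1 * z')"
      unfolding F_mult by (simp only: distrib_left mult_ac)
    also have "\<dots> = Fract (\<Sum>i<r. (w' * g i + w * g' i) * a i) 1"
      unfolding w sum_lin F_add F_mult ..
    finally have "\<exists>w g. w \<notin> P \<and> Fract w 1 * (z + z') = Fract (\<Sum>i<r. g i * a i) 1"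
      using denom_mult[OF w(1,3)] by (intro exI conjI)
    moreover have "z + z' \<in> carrier (local_ring P)" using L.a_closed[of z z'] z by (simp add: T_def)
    ultimately show "z \<oplus>\<^bsub>local_ring P\<^esub> z' \<in> T" unfolding T_def by simp
  next
    fix y z assume y: "y \<in> carrier (local_ring P)" and z: "z \<in> T"
    then obtain u v where uv: "y = Fract u v" "v \<notin> P" by (auto simp: local_ring_simps(1))
    obtain w g where w: "w \<notin> P" "Fract w 1 * z = Fract (\<Sum>i<r. g i * a i) 1" using z by (auto simp: T_def)
    have "Fract v 1 * y = Fract u 1" using uv denom_nonzero by (simp add: eq_fract)
    then have "Fract (w * v) 1 * (y * z) = Fract u 1 * (Fract w 1 * z)"
      unfolding F_mult by (metis mult.assoc mult.commute)
    also have "\<dots> = Fract (\<Sum>i<r. (u * g i + 0 * g i) * a i) 1"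
      unfolding w sum_lin F_add F_mult by (simp add: Zero_fract_def[symmetric])
    finally have "\<exists>w g. w \<notin> P \<and> Fract w 1 * (y * z) = Fract (\<Sum>i<r. g i * a i) 1"
      using denom_mult[OF w(1) uv(2)] by (intro exI conjI)
    moreover have "y * z \<in> carrier (local_ring P)" using L.m_closed[of y z] y z by (simp add: T_def)
    ultimately show "y \<otimes>\<^bsub>local_ring P\<^esub> z \<in> T" unfolding T_def by simp
  qed
  moreover have "S \<subseteq> T"
  proof
    fix z assume "z \<in> S"
    then obtain i where i: "i < r" "z = s i" using s by (auto simp: bij_betw_def)
    have "(\<Sum>j<r. (if j = i then 1 else 0) * a j) = (\<Sum>j<r. if j = i then a j else 0)"
      by (rule sum.cong) auto
    then have "(\<Sum>j<r. (if j = i then 1 else 0) * a j) = a i" using i by simp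
    moreover have "Fract (b i) 1 * z = Fract (a i) 1"
      using i ab denom_nonzero by (simp add: eq_fract)
    ultimately have "Fract (b i) 1 * z = Fract (\<Sum>j<r. (if j = i then 1 else 0) * a j) 1" by simp
    then show "z \<in> T" unfolding T_def using ab(3)[OF i(1)] \<open>z \<in> S\<close> S(4)
      by (intro CollectI conjI exI[of _ "b i"] exI[of _ "\<lambda>j. if j = i then 1 else 0"]) auto
  qed
  ultimately have "local_max P \<subseteq> T" unfolding S(3)[symmetric] genideal_def by blast
  \<comment> \<open>Padding with zeros, since only \<open>r\<close> \<le> \<open>d\<close> is known
    here. The dual Hasse--Schmidt derivations exclude zero coordinates afterwards.\<close>
  define x where "x i = (if i < r then a i else 0)" for i
  have "\<exists>c. f - (\<Sum>i<d. \<iota> (c i) * x i) \<in> powI P 2" if f: "ev f = 0" for f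
  proof -
    have "Fract f 1 \<in> local_max P" using f one_nmem by (auto simp: local_max_def P)
    then have "Fract f 1 \<in> T" using \<open>local_max P \<subseteq> T\<close> by blast
    then obtain w g where w: "w \<notin> P" "Fract w 1 * Fract f 1 = Fract (\<Sum>i<r. g i * a i) 1"
      by (auto simp: T_def)
    then have wf: "w * f = (\<Sum>i<r. g i * a i)" by (simp add: eq_fract)
    have evw: "ev w \<noteq> 0" using w P by simp
    have prod2: "u * v \<in> powI P 2" if "ev u = 0" "ev v = 0" for u v
      using powI_mult[OF RI, of u "Suc 0" v "Suc 0"] that unfolding powI_1[OF RI]
      by (simp add: P numeral_2_eq_2)
    \<comment> \<open>Up to a unit, the error of replacing \<open>w\<close> and the
      \<open>g i\<close> by their values: a sum of products of two elements vanishing at the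
      point.\<close>
    define t where "t = \<iota> (inverse (ev w)) * ((\<iota> (ev w) - w) * f + (\<Sum>i<r. (g i - \<iota> (ev (g i))) * a i))"
    have "t \<in> powI P 2"
      unfolding t_def using f ab(2)
      by (intro powI_mult_left[OF RI] powI_add powI_sum[OF RI] prod2) (auto simp: evd ev P)
    define c where "c i = inverse (ev w) * ev (g i)" for i
    have "t = \<iota> (inverse (ev w)) * (\<iota> (ev w) * f - (\<Sum>i<r. \<iota> (ev (g i)) * a i))"
      unfolding t_def using wf by (simp add: left_diff_distrib sum_subtractf)
    also have "\<dots> = f - (\<Sum>i<r. \<iota> (c i) * a i)"
      using evw by (simp add: right_diff_distrib mult.assoc[symmetric] map_mult[symmetric] c_def sum_distrib_left)
    also have "(\<Sum>i<r. \<iota> (c i) * a i) = (\<Sum>i<d. \<iota> (c i) * x i)"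
      using rd by (intro sum.mono_neutral_cong_left) (auto simp: x_def)
    finally show ?thesis using \<open>t \<in> powI P 2\<close> by auto
  qed
  moreover have "\<forall>i<d. ev (x i) = 0" using ab(2) by (auto simp: x_def P ev0)
  ultimately show ?thesis by (intro exI[of _ x]) blast
qed

section \<open>Linear algebra in P / P^2, carried out on representatives\<close>

section \<open>Bases adapted to a flag\<close>

context domain_algebra
begin

definition cotangent_independent :: "'a set \<Rightarrow> 'a list \<Rightarrow> bool"
  where "cotangent_independent P xs \<longleftrightarrow> (\<forall>c. (\<Sum>i<length xs. \<iota> (c i) * xs ! i) \<in> powI P 2 \<longrightarrow>
    (\<forall>i<length xs. c i = 0))"

definition cotangent_span :: "'a set \<Rightarrow> nat \<Rightarrow> (nat \<Rightarrow> 'a) \<Rightarrow> 'a set"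
  where "cotangent_span P n x = {v. \<exists>c. v - (\<Sum>i<n. \<iota> (c i) * x i) \<in> powI P 2}"

definition cotangent_subspace :: "'a set \<Rightarrow> 'a set \<Rightarrow> bool"
  where "cotangent_subspace P U \<longleftrightarrow> powI P 2 \<subseteq> U \<and> U \<subseteq> P \<and> (\<forall>u\<in>U. \<forall>v\<in>U. u + v \<in> U) \<and>
    (\<forall>c. \<forall>u\<in>U. \<iota> c * u \<in> U)"

context
  fixes P d z
  assumes P: "ring_ideal P" and span: "P \<subseteq> cotangent_span P d z"
begin

lemma cotangent_independent_length:
  assumes "cotangent_independent P xs" "set xs \<subseteq> P"
  shows "length xs \<le> d"
proof (rule ccontr)
  assume "\<not> ?thesis"
  have "\<forall>i. \<exists>c. i < length xs \<longrightarrow> xs ! i - (\<Sum>j<d. \<iota> (c j) * z j) \<in> powI P 2"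
    using assms(2) span nth_mem unfolding cotangent_span_def by blast
  then obtain c where c: "\<And>i. i < length xs \<Longrightarrow> xs ! i - (\<Sum>j<d. \<iota> (c i j) * z j) \<in> powI P 2" by metis
  from nontrivial_linear_relation[of "{..<d}" "{..<length xs}" c] \<open>\<not> length xs \<le> d\<close>
  obtain l where l: "\<exists>i<length xs. l i \<noteq> 0" "\<And>j. j < d \<Longrightarrow> (\<Sum>i<length xs. l i * c i j) = 0" by auto
  have "(\<Sum>i<length xs. \<iota> (l i) * (xs ! i - (\<Sum>j<d. \<iota> (c i j) * z j))) \<in> powI P 2"
    using c by (intro powI_sum[OF P] powI_mult_left[OF P]) auto
  moreover have "(\<Sum>i<length xs. \<iota> (l i) * (\<Sum>j<d. \<iota> (c i j) * z j)) =
      (\<Sum>j<d. \<iota> (\<Sum>i<length xs. l i * c i j) * z j)"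
    unfolding sum_distrib_left map_sum sum_distrib_right map_mult
    by (subst sum.swap) (simp only: mult.assoc)
  moreover have "\<dots> = 0" using l(2) by simp
  ultimately have "(\<Sum>i<length xs. \<iota> (l i) * xs ! i) \<in> powI P 2"
    by (simp add: right_diff_distrib sum_subtractf)
  with assms(1) l(1) show False unfolding cotangent_independent_def by blast
qed

text \<open>Greedy extension, which stops because an independent list has length at most
  \<open>d\<close>.\<close>

lemma cotangent_independent_extend:
  assumes "cotangent_subspace P U" "cotangent_independent P xs" "set xs \<subseteq> U"
  shows "\<exists>ys. cotangent_independent P (xs @ ys) \<and> set ys \<subseteq> U \<and>
    U \<subseteq> cotangent_span P (length (xs @ ys)) (\<lambda>i. (xs @ ys) ! i)"
  using assms(2,3)
proof (induction "d - length xs" arbitrary: xs rule: less_induct)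
  case less
  show ?case
  proof (cases "U \<subseteq> cotangent_span P (length xs) (\<lambda>i. xs ! i)")
    case True
    then show ?thesis using less.prems by (intro exI[of _ "[]"]) simp
  next
    case False
    then obtain v where v: "v \<in> U" "v \<notin> cotangent_span P (length xs) (\<lambda>i. xs ! i)" by blast
    have indep: "cotangent_independent P (xs @ [v])"
      unfolding cotangent_independent_def
    proof (intro allI impI)
      fix c i
      assume c: "(\<Sum>i<length (xs @ [v]). \<iota> (c i) * (xs @ [v]) ! i) \<in> powI P 2" and i: "i < length (xs @ [v])"
      have "(\<Sum>i<length (xs @ [v]). \<iota> (c i) * (xs @ [v]) ! i) =
          (\<Sum>i<length xs. \<iota> (c i) * xs ! i) + \<iota> (c (length xs)) * v"
        by (simp add: nth_append)
      with c have c': "(\<Sum>i<length xs. \<iota> (c i) * xs ! i) + \<iota> (c (length xs)) * v \<in> powI P 2" by simp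
      show "c i = 0"
      proof (cases "c (length xs) = 0")
        case True
        with c' less.prems(1) i show ?thesis
          unfolding cotangent_independent_def by (auto simp: less_Suc_eq)
      next
        case False
        define e where "e = inverse (c (length xs))"
        have "\<iota> e * ((\<Sum>i<length xs. \<iota> (c i) * xs ! i) + \<iota> (c (length xs)) * v) \<in> powI P 2"
          using c' by (rule powI_mult_left[OF P])
        moreover have "\<iota> e * \<iota> (c (length xs)) = 1"
          using False unfolding map_mult[symmetric] e_def by simp
        ultimately have "v - (\<Sum>i<length xs. \<iota> (- (e * c i)) * xs ! i) \<in> powI P 2"
          by (simp add: distrib_left mult.assoc[symmetric] sum_distrib_left map_mult map_minus sum_negf add.commute)
        then have "v \<in> cotangent_span P (length xs) (\<lambda>i. xs ! i)"
          unfolding cotangent_span_def by (intro CollectI exI[of _ "\<lambda>i. - (e * c i)"])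
        with v(2) show ?thesis by blast
      qed
    qed
    moreover have sub: "set (xs @ [v]) \<subseteq> U" using less.prems v by simp
    moreover have "length (xs @ [v]) \<le> d"
      using assms(1) sub by (intro cotangent_independent_length[OF indep]) (auto simp: cotangent_subspace_def)
    ultimately obtain ys where "cotangent_independent P ((xs @ [v]) @ ys) \<and> set ys \<subseteq> U \<and>
        U \<subseteq> cotangent_span P (length ((xs @ [v]) @ ys)) (\<lambda>i. ((xs @ [v]) @ ys) ! i)"
      using less.hyps[of "xs @ [v]"] by fastforce
    then show ?thesis using v(1) by (intro exI[of _ "v # ys"]) simp
  qed
qed

lemma cotangent_span_subset:
  assumes U: "cotangent_subspace P U" and x: "\<And>i. i < n \<Longrightarrow> x i \<in> U"
  shows "cotangent_span P n x \<subseteq> U"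
proof
  fix v assume "v \<in> cotangent_span P n x"
  then obtain c where c: "v - (\<Sum>i<n. \<iota> (c i) * x i) \<in> powI P 2" by (auto simp: cotangent_span_def)
  have "0 \<in> U" using U powI_zero[OF P] by (auto simp: cotangent_subspace_def)
  then have "(\<Sum>i\<in>S. \<iota> (c i) * x i) \<in> U" if "S \<subseteq> {..<n}" for S
    using that U x by (induction S rule: infinite_finite_induct) (auto simp: cotangent_subspace_def)
  from this[of "{..<n}"] c have "(v - (\<Sum>i<n. \<iota> (c i) * x i)) + (\<Sum>i<n. \<iota> (c i) * x i) \<in> U"
    using U unfolding cotangent_subspace_def by blast
  then show "v \<in> U" by simp
qed

lemma flag_basis:
  assumes "\<And>j. j \<le> J \<Longrightarrow> cotangent_subspace P (U j)" "\<And>j. j < J \<Longrightarrow> U j \<subseteq> U (Suc j)"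
  shows "\<exists>xs r. cotangent_independent P xs \<and> set xs \<subseteq> U J \<and> r J = length xs \<and>
    (\<forall>i j. i \<le> j \<longrightarrow> j \<le> J \<longrightarrow> r i \<le> r j) \<and> (\<forall>j\<le>J. U j = cotangent_span P (r j) (\<lambda>i. xs ! i))"
  using assms
proof (induction J)
  case 0
  have "cotangent_independent P []" by (simp add: cotangent_independent_def)
  from cotangent_independent_extend[OF 0(1) this, of 0] obtain ys where ys:
    "cotangent_independent P ys" "set ys \<subseteq> U 0" "U 0 \<subseteq> cotangent_span P (length ys) (\<lambda>i. ys ! i)" by auto
  have "cotangent_span P (length ys) (\<lambda>i. ys ! i) \<subseteq> U 0"
    using 0 ys by (intro cotangent_span_subset) auto
  with ys show ?case by (intro exI[of _ ys] exI[of _ "\<lambda>_. length ys"]) auto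
next
  case (Suc J)
  then obtain xs r where IH: "cotangent_independent P xs" "set xs \<subseteq> U J" "r J = length xs"
    "\<And>i j. i \<le> j \<Longrightarrow> j \<le> J \<Longrightarrow> r i \<le> r j" "\<And>j. j \<le> J \<Longrightarrow> U j = cotangent_span P (r j) (\<lambda>i. xs ! i)"
    by (auto simp: le_Suc_eq)
  have "set xs \<subseteq> U (Suc J)" using IH(2) Suc.prems(2)[of J] by auto
  from cotangent_independent_extend[OF Suc.prems(1) IH(1) this] obtain ys where ys:
    "cotangent_independent P (xs @ ys)" "set ys \<subseteq> U (Suc J)"
    "U (Suc J) \<subseteq> cotangent_span P (length (xs @ ys)) (\<lambda>i. (xs @ ys) ! i)" by auto
  have sub: "set (xs @ ys) \<subseteq> U (Suc J)" using ys(2) \<open>set xs \<subseteq> U (Suc J)\<close> by simp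
  define r' where "r' = r(Suc J := length (xs @ ys))"
  have "r' i \<le> r' j" if "i \<le> j" "j \<le> Suc J" for i j
  proof (cases "j = Suc J")
    case True
    show ?thesis
    proof (cases "i = Suc J")
      case False
      with that True have "r i \<le> r J" by (intro IH(4)) auto
      then show ?thesis using True False IH(3) by (simp add: r'_def)
    qed (simp add: True)
  next
    case False
    with that IH(4)[of i j] show ?thesis by (simp add: r'_def)
  qed
  moreover have "U j = cotangent_span P (r' j) (\<lambda>i. (xs @ ys) ! i)" if "j \<le> Suc J" for j
  proof (cases "j = Suc J")
    case True
    have "cotangent_span P (length (xs @ ys)) (\<lambda>i. (xs @ ys) ! i) \<subseteq> U (Suc J)"
      using sub nth_mem by (intro cotangent_span_subset Suc.prems(1)) blast+
    with ys(3) True show ?thesis by (simp add: r'_def)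
  next
    case False
    with that have j: "j \<le> J" by simp
    have "r j \<le> length xs" using IH(4)[OF j] IH(3) by simp
    then have "(\<Sum>i<r j. \<iota> (c i) * (xs @ ys) ! i) = (\<Sum>i<r j. \<iota> (c i) * xs ! i)" for c
      by (intro sum.cong) (auto simp: nth_append)
    then show ?thesis using IH(5)[OF j] False by (simp add: r'_def cotangent_span_def)
  qed
  ultimately show ?case using ys(1) sub by (intro exI[of _ "xs @ ys"] exI[of _ r']) (auto simp: r'_def)
qed

end

end

section \<open>The pure part as the image of a subspace of the cotangent space\<close>

section \<open>The dimension of the pure part\<close>

context closed_point_coordinates
begin

text \<open>The preimage of the pure part under the power map, as a set of representatives in
  \<open>Q\<close>. Passing from powers to vectors places the data of all exponents in the same
  cotangent space, where they form a flag.\<close>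

definition pure_vectors :: "('a \<times> real) set \<Rightarrow> nat \<Rightarrow> 'a set"
  where "pure_vectors \<I> n = {v \<in> Q. \<exists>f\<in>level \<I> (real n). f - v ^ n \<in> powI Q (Suc n)}"

lemma prime_Q: "prime_in UNIV Q"
  by (auto simp: prime_in_def Q_def ev_add ev_mult)

sublocale prime_localization Q
  by unfold_locales (rule prime_Q)

text \<open>Modulo \<open>Q\<close> the element \<open>s\<close> is its value at the point, a unit,
  so the membership of \<open>f\<close> can be improved one power at a time.\<close>

lemma powI_primary: "s \<notin> Q \<Longrightarrow> s * f \<in> powI Q n \<Longrightarrow> f \<in> powI Q n"
proof -
  assume s: "s \<notin> Q" and sf: "s * f \<in> powI Q n"
  have evs: "ev s \<noteq> 0" using s by (simp add: Q_def)
  have "f \<in> powI Q m" if "m \<le> n" for m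
    using that
  proof (induction m)
    case (Suc m)
    have "s - \<iota> (ev s) \<in> powI Q (Suc 0)" unfolding pw_1 by (simp add: Q_def ev_diff)
    from pw_mult[OF this, of f m] Suc have "(s - \<iota> (ev s)) * f \<in> powI Q (Suc m)" by simp
    moreover have "s * f \<in> powI Q (Suc m)" using sf Suc.prems by (rule pw_mono[rotated])
    ultimately have "s * f - (s - \<iota> (ev s)) * f \<in> powI Q (Suc m)" by (rule pw_diff[rotated])
    then have "\<iota> (ev s) * f \<in> powI Q (Suc m)" by (simp add: algebra_simps)
    then have "\<iota> (inverse (ev s)) * (\<iota> (ev s) * f) \<in> powI Q (Suc m)" by (rule pw_mult_left)
    then show ?case using evs by (simp add: mult.assoc[symmetric] map_mult[symmetric])
  qed simp
  then show ?thesis by simp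
qed

lemma Fract_mem_fractions_iff:
  assumes "s \<notin> Q" shows "Fract f s \<in> fractions (powI Q n) \<longleftrightarrow> f \<in> powI Q n"
proof
  assume "Fract f s \<in> fractions (powI Q n)"
  then obtain g t where g: "Fract f s = Fract g t" "g \<in> powI Q n" "t \<notin> Q" by (auto simp: fractions_def)
  then have "t * f = s * g" using assms denom_nonzero by (simp add: eq_fract mult.commute)
  with g(2) have "t * f \<in> powI Q n" by (simp add: pw_mult_left)
  with powI_primary g(3) show "f \<in> powI Q n" by blast
qed (use assms fractionsI in blast)

lemma ring_ideal_powI: "ring_ideal (powI Q n)"
  using pw_add pw_mult_left by (auto simp: ring_ideal_def)

lemma ring_ideal_level:
  assumes "idealistic_filtration type_ring \<I>" shows "ring_ideal (level \<I> u)"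
  using filtration_add[OF assms] filtration_mult_left[OF assms] filtration_zero[OF assms]
  by (auto simp: ring_ideal_def)

definition class_at :: "nat \<Rightarrow> 'a fract \<Rightarrow> 'a fract set"
  where "class_at n y = fractions (powI Q (Suc n)) +>\<^bsub>local_ring Q\<^esub> y"

lemma local_minus: "y \<in> carrier (local_ring Q) \<Longrightarrow> z \<in> carrier (local_ring Q) \<Longrightarrow> y \<ominus>\<^bsub>local_ring Q\<^esub> z = y - z"
proof -
  interpret A: cring "local_ring Q" by (rule cring_local_ring)
  assume y: "y \<in> carrier (local_ring Q)" and z: "z \<in> carrier (local_ring Q)"
  then obtain a b where ab: "z = Fract a b" "b \<notin> Q" by (auto simp: local_ring_simps(1))
  have "- z \<in> carrier (local_ring Q)"
    unfolding ab(1) minus_fract by (rule local_carrierI[OF ab(2)])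
  then have "\<ominus>\<^bsub>local_ring Q\<^esub> z = - z" using z by (intro A.minus_equality) simp_all
  then show ?thesis by (simp add: a_minus_def)
qed

lemma class_at_eq_iff:
  assumes "y \<in> carrier (local_ring Q)" "z \<in> carrier (local_ring Q)"
  shows "class_at n y = class_at n z \<longleftrightarrow> y - z \<in> fractions (powI Q (Suc n))"
proof -
  interpret A: cring "local_ring Q" by (rule cring_local_ring)
  show ?thesis
    using A.quotient_eq_iff_same_a_r_cos[OF ideal_fractions[OF ring_ideal_powI] assms] local_minus[OF assms]
    by (simp add: class_at_def)
qed

definition germ_class :: "nat \<Rightarrow> 'a \<Rightarrow> 'a fract set"
  where "germ_class n f = class_at n (Fract f 1)"

lemma germ_class_eq_iff: "germ_class n f = germ_class n g \<longleftrightarrow> f - g \<in> powI Q (Suc n)"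
  unfolding germ_class_def
  using class_at_eq_iff[OF Fract_one_mem Fract_one_mem, of n f g] Fract_mem_fractions_iff[OF one_nmem, of "f - g"]
  by simp

lemma pure_part_eq:
  assumes \<I>: "idealistic_filtration type_ring \<I>"
  shows "pure_part (local_ring Q) (local_max Q) (localization \<I> Q) n =
    (\<lambda>v. germ_class n (v ^ n)) ` pure_vectors \<I> n"
proof -
  have gc: "graded_class (local_ring Q) (local_max Q) n y = class_at n y" for y
    by (simp add: graded_class_def ideal_pow_local class_at_def)
  have loc: "(y, real n) \<in> localization \<I> Q \<longleftrightarrow> y \<in> fractions (level \<I> (real n))" for y
    by (simp add: localization_def genideal_local[OF ring_ideal_level[OF \<I>]])
  show ?thesis
    unfolding pure_part_def leading_part_def gc local_ring_pow ideal_pow_local loc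
    unfolding local_max_eq
  proof (intro subset_antisym subsetI)
    fix Y assume "Y \<in> class_at n ` {f \<in> fractions (powI Q n). f \<in> fractions (level \<I> (real n))} \<inter>
        (\<lambda>x. class_at n (x ^ n)) ` fractions Q"
    then obtain g y where Y: "Y = class_at n g" "Y = class_at n (y ^ n)" and g: "g \<in> fractions (powI Q n)"
      "g \<in> fractions (level \<I> (real n))" and y: "y \<in> fractions Q" by auto
    from g(2) obtain f s where f: "g = Fract f s" "f \<in> level \<I> (real n)" "s \<notin> Q" by (auto simp: fractions_def)
    from y obtain a b where ab: "y = Fract a b" "a \<in> Q" "b \<notin> Q" by (auto simp: fractions_def)
    have fn: "f \<in> powI Q n" using g(1) Fract_mem_fractions_iff[OF f(3)] f(1) by simp
    have "ev s \<noteq> 0" "ev b \<noteq> 0" using f ab by (auto simp: Q_def)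
    define f' where "f' = \<iota> (inverse (ev s)) * f"
    define v where "v = \<iota> (inverse (ev b)) * a"
    \<comment> \<open>On the n-th power of \<open>Q\<close> a denominator may be replaced by its
      value at the point: the two differ by an element of \<open>Q\<close>, which shifts the
      fraction only by an element of the next power.\<close>
    have approx: "class_at n (Fract h t) = germ_class n (\<iota> (inverse (ev t)) * h)"
      if h: "h \<in> powI Q n" and t: "t \<notin> Q" for h t
    proof -
      have evt: "ev t \<noteq> 0" using t by (simp add: Q_def)
      have "1 - \<iota> (inverse (ev t)) * t \<in> powI Q (Suc 0)"
        using evt by (simp add: pw_1) (simp add: Q_def ev_diff ev_mult)
      from pw_mult[OF this h] have "(1 - \<iota> (inverse (ev t)) * t) * h \<in> powI Q (Suc n)" by simp
      moreover have "Fract h t - Fract (\<iota> (inverse (ev t)) * h) 1 = Fract ((1 - \<iota> (inverse (ev t)) * t) * h) t"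
        using denom_nonzero[OF t] by (simp add: eq_fract algebra_simps)
      ultimately show ?thesis
        unfolding germ_class_def using class_at_eq_iff[OF local_carrierI[OF t] Fract_one_mem] fractionsI[OF _ t] by simp
    qed
    have "Y = germ_class n f'" unfolding Y(1) f(1) f'_def by (rule approx[OF fn f(3)])
    moreover have "Y = germ_class n (v ^ n)"
    proof -
      have "a ^ n \<in> powI Q n"
        using powI_power[OF ring_ideal_Q, of a "Suc 0" n] ab(2) by (simp add: pw_1)
      have "y ^ n = Fract (a ^ n) (b ^ n)"
        unfolding ab(1) by (induction n) (simp_all add: One_fract_def)
      then have "Y = germ_class n (\<iota> (inverse (ev (b ^ n))) * a ^ n)"
        unfolding Y(2) using approx[OF \<open>a ^ n \<in> powI Q n\<close> denom_power[OF ab(3), of n]] by simp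
      also have "\<iota> (inverse (ev (b ^ n))) * a ^ n = v ^ n"
        by (simp add: v_def ev_power power_mult_distrib map_power[symmetric] power_inverse)
      finally show ?thesis .
    qed
    ultimately have "f' - v ^ n \<in> powI Q (Suc n)" using germ_class_eq_iff by metis
    moreover have "f' \<in> level \<I> (real n)" unfolding f'_def using f(2) by (rule filtration_mult_left[OF \<I>])
    moreover have "v \<in> Q" unfolding v_def using ab(2) by (rule mult_mem)
    ultimately have "v \<in> pure_vectors \<I> n" by (auto simp: pure_vectors_def)
    with \<open>Y = germ_class n (v ^ n)\<close> show "Y \<in> (\<lambda>v. germ_class n (v ^ n)) ` pure_vectors \<I> n" by blast
  next
    fix Y assume "Y \<in> (\<lambda>v. germ_class n (v ^ n)) ` pure_vectors \<I> n"
    then obtain v f where v: "Y = germ_class n (v ^ n)" "v \<in> Q" "f \<in> level \<I> (real n)"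
      "f - v ^ n \<in> powI Q (Suc n)" by (auto simp: pure_vectors_def)
    have vn: "v ^ n \<in> powI Q n"
      using powI_power[OF ring_ideal_Q, of v "Suc 0" n] v(2) by (simp add: pw_1)
    have "f - v ^ n \<in> powI Q n" using v(4) by (rule pw_mono[rotated]) simp
    from pw_add[OF this vn] have "f \<in> powI Q n" by simp
    then have "germ_class n f \<in> class_at n ` {f \<in> fractions (powI Q n). f \<in> fractions (level \<I> (real n))}"
      unfolding germ_class_def using v(3) one_nmem by (intro imageI CollectI conjI fractionsI)
    moreover have "Y = germ_class n f" unfolding v(1) using v(4) germ_class_eq_iff by metis
    moreover have "Fract v 1 ^ n = Fract (v ^ n) 1" by (induction n) (simp_all add: One_fract_def)
    then have "Y \<in> (\<lambda>x. class_at n (x ^ n)) ` fractions Q"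
      unfolding v(1) germ_class_def using v(2) one_nmem by (intro image_eqI[of _ _ "Fract v 1"] fractionsI) auto
    ultimately show "Y \<in> class_at n ` {f \<in> fractions (powI Q n). f \<in> fractions (level \<I> (real n))} \<inter>
        (\<lambda>x. class_at n (x ^ n)) ` fractions Q" by blast
  qed
qed

lemma frobenius_positive: "e \<in> exponents TYPE('k) \<Longrightarrow> CHAR('k) ^ e > 0"
  by (cases rule: exponents_cases) (auto intro: prime_gt_0_nat)

text \<open>The classes of the x_i^n with i < r span the pure part, because every scalar has an n-th
  root and the power map is additive; they are independent because the coefficients of a leading
  form are unique.\<close>

lemma pure_dim_eq:
  assumes \<I>: "idealistic_filtration type_ring \<I>" and e: "e \<in> exponents TYPE('k)"
    and n: "n = CHAR('k) ^ e" and r: "r \<le> d"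
    and W: "pure_vectors \<I> n = cotangent_span Q r x"
  shows "pure_dim \<iota> \<I> Q n = r"
proof -
  define I where "I = fractions (powI Q (Suc n))"
  have I: "ideal I (local_ring Q)" unfolding I_def by (rule ideal_fractions[OF ring_ideal_powI])
  interpret A: cring "local_ring Q" by (rule cring_local_ring)
  interpret B: cring "local_ring Q Quot I" by (rule ideal.quotient_is_cring[OF I A.is_cring])
  define C where "C f = germ_class n f" for f
  have C: "C f = I +>\<^bsub>local_ring Q\<^esub> Fract f 1" for f by (simp add: C_def germ_class_def class_at_def I_def)
  have hom: "(+>\<^bsub>local_ring Q\<^esub>) I \<in> Ring.ring_hom (local_ring Q) (local_ring Q Quot I)"
    by (rule ideal.rcos_ring_hom[OF I])
  have C_add: "C (f + g) = C f \<oplus>\<^bsub>local_ring Q Quot I\<^esub> C g" for f g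
    using ring_hom_add[OF hom Fract_one_mem[of f] Fract_one_mem[of g]] by (simp add: C)
  have C_mult: "C (f * g) = C f \<otimes>\<^bsub>local_ring Q Quot I\<^esub> C g" for f g
    using ring_hom_mult[OF hom Fract_one_mem[of f] Fract_one_mem[of g]] by (simp add: C)
  have C_one: "C 1 = \<one>\<^bsub>local_ring Q Quot I\<^esub>"
    using ring_hom_one[OF hom] by (simp add: C One_fract_def)
  have C_carr: "C f \<in> carrier (local_ring Q Quot I)" for f
    using ring_hom_closed[OF hom Fract_one_mem[of f]] by (simp add: C)
  have C_zero: "C 0 = \<zero>\<^bsub>local_ring Q Quot I\<^esub>"
    using C_add[of 0 0] C_carr[of 0] B.add.l_cancel_one by simp
  have C_eq: "C f = C g \<longleftrightarrow> f - g \<in> powI Q (Suc n)" for f g unfolding C_def by (rule germ_class_eq_iff)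
  define K where "K = range (\<lambda>c. C (\<iota> c))"
  have K: "subfield K (local_ring Q Quot I)"
  proof -
    interpret k: field "type_ring :: 'k ring" by (rule field_from_type_algebra)
    have "(\<lambda>c. C (\<iota> c)) \<in> Ring.ring_hom (type_ring :: 'k ring) (local_ring Q Quot I)"
      by (intro ring_hom_memI) (auto simp: C_carr C_add C_mult C_one map_add map_mult)
    then interpret h: ring_hom_ring "type_ring :: 'k ring" "local_ring Q Quot I" "\<lambda>c. C (\<iota> c)"
      by (intro ring_hom_ringI2 k.ring_axioms B.ring_axioms)
    have "1 \<notin> powI Q (Suc n)"
      using one_nmem pw_mono[of "Suc 0" "Suc n" 1] by (auto simp: pw_1)
    then have "\<one>\<^bsub>local_ring Q Quot I\<^esub> \<noteq> \<zero>\<^bsub>local_ring Q Quot I\<^esub>"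
      unfolding C_one[symmetric] C_zero[symmetric] C_eq by simp
    from h.img_is_subfield(2)[OF k.carrier_is_subfield this] show ?thesis by (simp add: K_def)
  qed
  define Es where "Es k = range (\<lambda>c. C (\<Sum>i<k. \<iota> (c i) * x i ^ n))" for k
  have dim: "B.dimension k K (Es k)" if "k \<le> r" for k
    using that
  proof (induction k)
    case 0
    have "Es 0 = {\<zero>\<^bsub>local_ring Q Quot I\<^esub>}" by (auto simp: Es_def C_zero)
    then show ?case by simp
  next
    case (Suc k)
    have k: "k < d" using Suc.prems r by simp
    have "C (x k ^ n) \<notin> Es k"
    proof
      assume "C (x k ^ n) \<in> Es k"
      then obtain c where c: "x k ^ n - (\<Sum>i<k. \<iota> (c i) * x i ^ n) \<in> powI Q (Suc n)"
        by (auto simp: Es_def C_eq)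
      define single where "single i = (\<lambda>_. 0)(i := n)" for i :: nat
      have single: "single i \<in> multi_indices d n" "mon (single i) = x i ^ n" if "i < d" for i
      proof -
        show "single i \<in> multi_indices d n"
          using sum_upd[OF that, of "\<lambda>_. 0" n] that by (simp add: multi_indices_def single_def)
        have "mon (single i) = (\<Prod>j<d. if j = i then x i ^ n else 1)"
          unfolding mon_def by (rule prod.cong) (auto simp: single_def)
        then show "mon (single i) = x i ^ n" using that by simp
      qed
      have rep_single: "rep n (\<lambda>a. if a = single i then 1 else 0) (x i ^ n)" if "i < d" for i
        using rep_mon[OF single(1)[OF that]] single(2)[OF that] by simp
      have "rep n (\<lambda>a. \<Sum>i<k. c i * (if a = single i then 1 else 0)) (\<Sum>i<k. \<iota> (c i) * x i ^ n)"
        using k by (intro rep_sum rep_scale rep_single) auto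
      from rep_add[OF this rep_higher[OF c]]
      have "rep n (\<lambda>a. (\<Sum>i<k. c i * (if a = single i then 1 else 0)) + 0) (x k ^ n)" by simp
      from rep_unique[OF this rep_single[OF k] single(1)[OF k]]
      have "(\<Sum>i<k. c i * (if single k = single i then 1 else 0)) = 1" by simp
      moreover have "single k \<noteq> single i" if "i < k" for i
        using that frobenius_positive[OF e] n by (auto simp: single_def fun_eq_iff)
      then have "(\<Sum>i<k. c i * (if single k = single i then 1 else 0)) = 0"
        by (intro sum.neutral) auto
      ultimately show False by simp
    qed
    \<comment> \<open>Dimension is defined by successive line extensions, so the basis is added one
      element at a time.\<close>
    moreover have "Es (Suc k) = B.line_extension K (C (x k ^ n)) (Es k)"
    proof (rule Set.set_eqI)
      fix u
      have "u \<in> B.line_extension K (C (x k ^ n)) (Es k) \<longleftrightarrow>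
          (\<exists>a c. u = C (\<iota> a * x k ^ n + (\<Sum>i<k. \<iota> (c i) * x i ^ n)))"
        unfolding B.line_extension_mem_iff K_def Es_def by (auto simp: C_add C_mult)
      also have "\<dots> \<longleftrightarrow> u \<in> Es (Suc k)"
      proof
        assume "\<exists>a c. u = C (\<iota> a * x k ^ n + (\<Sum>i<k. \<iota> (c i) * x i ^ n))"
        then obtain a c where u: "u = C (\<iota> a * x k ^ n + (\<Sum>i<k. \<iota> (c i) * x i ^ n))" by blast
        have "(\<Sum>i<k. \<iota> ((c(k := a)) i) * x i ^ n) = (\<Sum>i<k. \<iota> (c i) * x i ^ n)"
          by (rule sum.cong) auto
        then have "u = C (\<Sum>i<Suc k. \<iota> ((c(k := a)) i) * x i ^ n)" using u by (simp add: add.commute)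
        then show "u \<in> Es (Suc k)" unfolding Es_def by (intro image_eqI[of _ _ "c(k := a)"]) simp_all
      qed (auto simp: Es_def add.commute)
      finally show "u \<in> Es (Suc k) \<longleftrightarrow> u \<in> B.line_extension K (C (x k ^ n)) (Es k)" ..
    qed
    ultimately show ?case using B.Suc_dim[OF C_carr _ Suc.IH] Suc.prems by simp
  qed
  have "pure_part (local_ring Q) (local_max Q) (localization \<I> Q) n = Es r"
    unfolding pure_part_eq[OF \<I>] C_def[symmetric]
  proof (intro subset_antisym subsetI)
    fix Y assume "Y \<in> (\<lambda>v. C (v ^ n)) ` pure_vectors \<I> n"
    then obtain v c where v: "Y = C (v ^ n)" "v - (\<Sum>i<r. \<iota> (c i) * x i) \<in> powI Q (Suc (Suc 0))"
      unfolding W cotangent_span_def by (auto simp: numeral_2_eq_2)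
    have "(\<Sum>i<r. \<iota> (c i) * x i) \<in> powI Q (Suc 0)"
      using x_mem r by (intro pw_sum pw_mult_left) (simp add: pw_1)
    from powI_power_cong[OF ring_ideal_Q v(2) this, of n]
    have "Y = C ((\<Sum>i<r. \<iota> (c i) * x i) ^ n)" unfolding v(1) C_eq by simp
    also have "(\<Sum>i<r. \<iota> (c i) * x i) ^ n = (\<Sum>i<r. \<iota> (c i ^ n) * x i ^ n)"
      unfolding n frobenius_sum[OF e] by (simp add: power_mult_distrib map_power)
    finally show "Y \<in> Es r" unfolding Es_def by (intro image_eqI[of _ _ "\<lambda>i. c i ^ n"]) simp_all
  next
    fix Y assume "Y \<in> Es r"
    then obtain c where c: "Y = C (\<Sum>i<r. \<iota> (c i) * x i ^ n)" by (auto simp: Es_def)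
    have "\<forall>i. \<exists>b. b ^ n = c i" using nth_root_exists[OF frobenius_positive[OF e]] n by blast
    then obtain b where b: "\<And>i. b i ^ n = c i" by metis
    have "(\<Sum>i<r. \<iota> (b i) * x i) ^ n = (\<Sum>i<r. \<iota> (b i ^ n) * x i ^ n)"
      unfolding n frobenius_sum[OF e] by (simp add: power_mult_distrib map_power)
    then have "Y = C ((\<Sum>i<r. \<iota> (b i) * x i) ^ n)" using c b by simp
    moreover have "(\<Sum>i<r. \<iota> (b i) * x i) \<in> pure_vectors \<I> n"
      unfolding W cotangent_span_def by (auto intro!: exI[of _ b])
    ultimately show "Y \<in> (\<lambda>v. C (v ^ n)) ` pure_vectors \<I> n" by blast
  qed
  moreover have "B.dim K (Es r) = r"
    unfolding B.dim_def using dim[OF le_refl] B.dimension_is_inj[OF K] by blast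
  ultimately show ?thesis
    unfolding pure_dim_def Let_def ideal_pow_local I_def[symmetric] by (simp add: K_def C)
qed

end

context closed_point_coordinates
begin

lemma frobenius_add:
  assumes "e \<in> exponents TYPE('k)"
  shows "(f + g :: 'a) ^ (CHAR('k) ^ e) = f ^ (CHAR('k) ^ e) + g ^ (CHAR('k) ^ e)"
  using assms by (cases rule: exponents_cases) (auto simp: char_eq intro!: freshmans_dream')

lemma power_mem_powI: "v \<in> Q \<Longrightarrow> v ^ n \<in> powI Q n"
  using powI_power[OF ring_ideal_Q, of v "Suc 0" n] by (simp add: pw_1)

text \<open>The power map is additive for these exponents, which gives closure under sums; the
  square of \<open>Q\<close> is contained because its n-th powers lie in degree 2n, at least n +
  1.\<close>

lemma pure_vectors_subspace:
  assumes \<I>: "idealistic_filtration type_ring \<I>" and e: "e \<in> exponents TYPE('k)"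
  shows "cotangent_subspace Q (pure_vectors \<I> (CHAR('k) ^ e))"
proof -
  define n where "n = CHAR('k) ^ e"
  have n: "n > 0" using frobenius_positive[OF e] by (simp add: n_def)
  have "v \<in> pure_vectors \<I> n" if v: "v \<in> powI Q 2" for v
  proof -
    have "v \<in> Q" using pw_mono[of "Suc 0" 2 v] v by (simp add: pw_1)
    moreover have "v ^ n \<in> powI Q (2 * n)" by (rule powI_power[OF ring_ideal_Q v])
    then have "v ^ n \<in> powI Q (Suc n)" using n by (intro pw_mono[of "Suc n" "2 * n"]) simp_all
    then have "0 - v ^ n \<in> powI Q (Suc n)" by (intro pw_diff) simp
    ultimately show ?thesis
      unfolding pure_vectors_def using filtration_zero[OF \<I>] by blast
  qed
  moreover have "u + v \<in> pure_vectors \<I> n" if u: "u \<in> pure_vectors \<I> n" and v: "v \<in> pure_vectors \<I> n" for u v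
  proof -
    from u obtain f where f: "u \<in> Q" "f \<in> level \<I> (real n)" "f - u ^ n \<in> powI Q (Suc n)"
      by (auto simp: pure_vectors_def)
    from v obtain g where g: "v \<in> Q" "g \<in> level \<I> (real n)" "g - v ^ n \<in> powI Q (Suc n)"
      by (auto simp: pure_vectors_def)
    have "(f + g) - (u + v) ^ n = (f - u ^ n) + (g - v ^ n)"
      unfolding n_def frobenius_add[OF e] by simp
    then have "(f + g) - (u + v) ^ n \<in> powI Q (Suc n)" using pw_add[OF f(3) g(3)] by (simp only:)
    moreover have "f + g \<in> level \<I> (real n)" using f(2) g(2) by (rule filtration_add[OF \<I>])
    ultimately show ?thesis using add_mem[OF f(1) g(1)] by (auto simp: pure_vectors_def)
  qed
  moreover have "\<iota> c * u \<in> pure_vectors \<I> n" if u: "u \<in> pure_vectors \<I> n" for c u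
  proof -
    from u obtain f where f: "u \<in> Q" "f \<in> level \<I> (real n)" "f - u ^ n \<in> powI Q (Suc n)"
      by (auto simp: pure_vectors_def)
    have "\<iota> (c ^ n) * f - (\<iota> c * u) ^ n = \<iota> (c ^ n) * (f - u ^ n)"
      by (simp add: power_mult_distrib map_power right_diff_distrib)
    then have "\<iota> (c ^ n) * f - (\<iota> c * u) ^ n \<in> powI Q (Suc n)" using pw_mult_left[OF f(3)] by simp
    moreover have "\<iota> (c ^ n) * f \<in> level \<I> (real n)" using f(2) by (rule filtration_mult_left[OF \<I>])
    ultimately show ?thesis using mult_mem[OF f(1)] by (auto simp: pure_vectors_def)
  qed
  moreover have "pure_vectors \<I> n \<subseteq> Q" by (auto simp: pure_vectors_def)
  ultimately show ?thesis unfolding cotangent_subspace_def n_def by blast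
qed

lemma pure_vectors_mono:
  assumes \<I>: "idealistic_filtration type_ring \<I>"
  shows "pure_vectors \<I> (CHAR('k) ^ e) \<subseteq> pure_vectors \<I> (CHAR('k) ^ Suc e)"
proof
  define n where "n = CHAR('k) ^ e"
  have n': "CHAR('k) ^ Suc e = n * CHAR('k)" by (simp add: n_def)
  fix v assume "v \<in> pure_vectors \<I> (CHAR('k) ^ e)"
  then obtain f where f: "v \<in> Q" "f \<in> level \<I> (real n)" "f - v ^ n \<in> powI Q (Suc n)"
    by (auto simp: pure_vectors_def n_def)
  have "f ^ CHAR('k) - v ^ (n * CHAR('k)) \<in> powI Q (Suc (n * CHAR('k)))"
    using powI_power_cong[OF ring_ideal_Q f(3) power_mem_powI[OF f(1)], of "CHAR('k)"] by (simp add: power_mult)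
  moreover have "f ^ CHAR('k) \<in> level \<I> (real (n * CHAR('k)))"
    using filtration_power[OF \<I> f(2), of "CHAR('k)"] by (simp add: mult.commute)
  ultimately show "v \<in> pure_vectors \<I> (CHAR('k) ^ Suc e)"
    unfolding n' pure_vectors_def using f(1) by blast
qed

text \<open>Powers of \<open>f\<close> reach every level and are invertible at the point, so the
  product of v^n with a suitable scalar multiple of such a power lies in level n and has the leading
  form of v^n.\<close>

lemma pure_vectors_off_support:
  assumes \<I>: "idealistic_filtration type_ring \<I>" and u: "u > 0" "f \<in> level \<I> u" "f \<notin> Q"
  shows "pure_vectors \<I> n = Q"
proof
  obtain N :: nat where "real n < real N * u" using u(1) reals_Archimedean3 by blast
  then have g: "f ^ N \<in> level \<I> (real n)"
    using filtration_mono[OF \<I> filtration_power[OF \<I> u(2), of N]] by simp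
  have nz: "ev (f ^ N) \<noteq> 0" using u(3) by (simp add: ev_power Q_def)
  show "Q \<subseteq> pure_vectors \<I> n"
  proof
    fix v assume v: "v \<in> Q"
    define c where "c = \<iota> (inverse (ev (f ^ N)))"
    have "c * f ^ N - 1 \<in> powI Q (Suc 0)" using nz unfolding pw_1 c_def by (simp add: Q_def ev_diff ev_mult)
    from pw_mult[OF this power_mem_powI[OF v, of n]] have "(c * v ^ n) * f ^ N - v ^ n \<in> powI Q (Suc n)"
      by (simp add: algebra_simps)
    moreover have "(c * v ^ n) * f ^ N \<in> level \<I> (real n)" using g by (rule filtration_mult_left[OF \<I>])
    ultimately show "v \<in> pure_vectors \<I> n" using v by (auto simp: pure_vectors_def)
  qed
qed (auto simp: pure_vectors_def)

end

section \<open>From semicontinuity of single entries to closed sets for the lexicographic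
  order\<close>

section \<open>Upper semicontinuity\<close>

locale saturated_filtration = nonsingular_affine_variety \<iota> d
  for \<iota> :: "'k :: alg_closed_field \<Rightarrow> 'a :: idom" and d :: nat +
  fixes \<I> :: "('a \<times> real) set"
  assumes filtration: "idealistic_filtration type_ring \<I>"
    and saturated: "D_saturated \<iota> \<I>"
begin

lemma algebra_map_structure: "algebra_map \<iota>"
proof
  show "\<iota> (a + b) = \<iota> a + \<iota> b" for a b
    using ring_hom_add[OF structure_map, of a b] by simp
  show "\<iota> (a * b) = \<iota> a * \<iota> b" for a b
    using ring_hom_mult[OF structure_map, of a b] by simp
  show "\<iota> 1 = 1" using ring_hom_one[OF structure_map] by simp
qed

sublocale closed_field_algebra \<iota>
  by (intro closed_field_algebra.intro algebra_map_structure)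

sublocale domain_algebra \<iota>
  by (intro domain_algebra.intro algebra_map_structure)

lemma generators: "\<exists>ys. adjoin_list (range \<iota>) ys = UNIV"
proof -
  obtain S where S: "finite S" "generate_ring type_ring (range \<iota> \<union> S) = UNIV" using finite_type by blast
  obtain ys where ys: "set ys = S" using finite_list[OF S(1)] by blast
  define B where "B = adjoin_list (range \<iota>) ys"
  have B: "subalg B" unfolding B_def by (intro subalg_adjoin_list subalg_range)
  have sub: "range \<iota> \<union> S \<subseteq> B"
    unfolding B_def using adjoin_list_subset[OF subalg_range] adjoin_list_mem[OF subalg_range] ys by auto
  have "f \<in> B" if "f \<in> generate_ring type_ring (range \<iota> \<union> S)" for f
    using that
  proof (induction rule: generate_ring.induct)
    case one
    then show ?case using B by simp
  next
    case (incl h)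
    then show ?case using sub by blast
  next
    case (a_inv h)
    then show ?case using subalg_minus[OF B] by (simp add: type_ring_uminus)
  next
    case (eng_add h1 h2)
    then show ?case using subalg_add[OF B] by simp
  next
    case (eng_mult h1 h2)
    then show ?case using subalg_mult[OF B] by simp
  qed
  with S(2) show ?thesis by (intro exI[of _ ys]) (auto simp: B_def)
qed

lemma prime_chain:
  "\<exists>\<pp>. (\<forall>i\<le>d. prime_in (UNIV :: 'a set) (\<pp> i)) \<and> (\<forall>i<d. \<pp> i \<subset> \<pp> (Suc i))"
proof -
  define A where "A = {enat n | n. \<exists>\<pp>. (\<forall>i\<le>n. primeideal (\<pp> i) (type_ring :: 'a ring)) \<and> (\<forall>i<n. \<pp> i \<subset> \<pp> (Suc i))}"
  have "prime_in UNIV {0 :: 'a}" by (auto simp: prime_in_def)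
  then have "enat 0 \<in> A"
    unfolding A_def by (auto simp: primeideal_type_ring_iff intro!: exI[of _ "\<lambda>_. {0}"])
  moreover have "Sup A = enat d" using dimension by (simp add: krull_dim_def A_def)
  \<comment> \<open>A finite supremum of a nonempty set in \<open>enat\<close> is attained.\<close>
  ultimately have "enat d \<in> A"
    unfolding Sup_enat_def by (auto split: if_splits) (metis Max_in empty_iff)
  then show ?thesis by (auto simp: A_def primeideal_type_ring_iff)
qed

lemma max_spec_prime: "P \<in> max_spec (type_ring :: 'a ring) \<Longrightarrow> prime_in UNIV P"
  using cring.maximalideal_prime[OF cring_from_type_algebra]
  by (simp add: max_spec_def primeideal_type_ring_iff[symmetric])

lemma max_spec_evaluation:
  assumes P: "P \<in> max_spec (type_ring :: 'a ring)"
  shows "\<exists>ev :: 'a \<Rightarrow> 'k. (\<forall>f g. ev (f + g) = ev f + ev g) \<and> (\<forall>f g. ev (f * g) = ev f * ev g) \<and>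
    (\<forall>c. ev (\<iota> c) = c) \<and> P = {f. ev f = 0}"
proof -
  obtain ys where ys: "adjoin_list (range \<iota>) ys = UNIV" using generators by blast
  have "J = P" if "prime_in UNIV J" "P \<subseteq> J" for J
  proof -
    have "ideal J (type_ring :: 'a ring)"
      using that(1) by (simp add: ideal_type_ring_iff prime_in_ring_ideal)
    then have "J = P \<or> J = UNIV"
      using maximalideal.I_maximal[of P type_ring J] P that(2) by (simp add: max_spec_def)
    then show ?thesis using that(1) by (auto simp: prime_in_def)
  qed
  from weak_nullstellensatz[OF max_spec_prime[OF P] this ys] obtain f :: "'a \<Rightarrow> 'k" where
    "\<And>x y. f (x + y) = f x + f y" "\<And>x y. f (x * y) = f x * f y" "\<And>c. f (\<iota> c) = c" "\<And>x. f x = 0 \<longleftrightarrow> x \<in> P"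
    by blast
  then show ?thesis by (intro exI[of _ f]) auto
qed

text \<open>Coordinates are built twice: an arbitrary system \<open>z\<close> shows that the pure
  vectors form a flag of subspaces of the cotangent space, and a basis adapted to this flag then
  gives \<open>x\<close>. The last two clauses distinguish points of the support from the
  others.\<close>

lemma adapted_point:
  assumes P: "P \<in> max_spec (type_ring :: 'a ring)" and E: "E \<in> exponents TYPE('k)"
  obtains ev x \<phi> r where "P = {f. ev f = 0}"
    "\<And>j. j \<le> E \<Longrightarrow> pure_dim \<iota> \<I> P (CHAR('k) ^ j) = r j" "\<And>j. j \<le> E \<Longrightarrow> r j \<le> d"
    "(\<And>u. u > 0 \<Longrightarrow> level \<I> u \<subseteq> P) \<Longrightarrow> adapted_coordinates \<iota> d ev x \<phi> \<I> E r"
    "\<And>u j. u > 0 \<Longrightarrow> \<not> level \<I> u \<subseteq> P \<Longrightarrow> j \<le> E \<Longrightarrow> r j = d"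
proof -
  obtain ev :: "'a \<Rightarrow> 'k" where ev: "\<And>f g. ev (f + g) = ev f + ev g" "\<And>f g. ev (f * g) = ev f * ev g"
    "\<And>c. ev (\<iota> c) = c" and P_eq: "P = {f. ev f = 0}" using max_spec_evaluation[OF P] by blast
  obtain ys where ys: "adjoin_list (range \<iota>) ys = UNIV" using generators by blast
  obtain \<pp> where \<pp>: "\<And>i. i \<le> d \<Longrightarrow> prime_in (UNIV :: 'a set) (\<pp> i)" "\<And>i. i < d \<Longrightarrow> \<pp> i \<subset> \<pp> (Suc i)"
    using prime_chain by blast
  have coordinates: "\<exists>\<phi>. local_coordinates \<iota> d ev x \<phi>"
    if "\<And>i. i < d \<Longrightarrow> ev (x i) = 0"
      "\<And>f. ev f = 0 \<Longrightarrow> \<exists>c. f - (\<Sum>i<d. \<iota> (c i) * x i) \<in> powI {f. ev f = 0} 2" for x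
    by (rule local_coordinates_exist[of ev ys d \<pp> x]) (use ev ys \<pp> that in auto)
  have prime: "prime_in UNIV P" using max_spec_prime[OF P] .
  have "krull_dim (local_ring P) \<le> enat d"
    using prime_localization.krull_dim_local_le[of P] prime dimension by (simp add: prime_localization_def)
  from regular_cotangent_span[OF ev P_eq nonsingular this] prime
  obtain z where z: "\<And>i. i < d \<Longrightarrow> ev (z i) = 0"
    "\<And>f. ev f = 0 \<Longrightarrow> \<exists>c. f - (\<Sum>i<d. \<iota> (c i) * z i) \<in> powI {f. ev f = 0} 2"
    by (auto simp: primeideal_type_ring_iff P_eq)
  obtain \<phi>0 where "local_coordinates \<iota> d ev z \<phi>0" using coordinates[of z] z by blast
  then interpret C0: closed_point_coordinates \<iota> d ev z \<phi>0 by (rule closed_point_coordinates.intro)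
  have Q: "C0.Q = P" by (simp add: C0.Q_def P_eq)
  define W where "W j = C0.pure_vectors \<I> (CHAR('k) ^ j)" for j
  \<comment> \<open>One further step, the whole maximal ideal, ends the flag, so that the adapted
    list is a basis of the cotangent space.\<close>
  define U where "U j = (if j \<le> E then W j else P)" for j
  have expo: "j \<in> exponents TYPE('k)" if "j \<le> E" for j
    using E that by (auto simp: exponents_def split: if_splits)
  have RI: "ring_ideal P" using C0.ring_ideal_Q Q by simp
  have span: "P \<subseteq> cotangent_span P d z"
    using z(2) by (auto simp: cotangent_span_def P_eq)
  have sub: "cotangent_subspace P (U j)" for j
  proof (cases "j \<le> E")
    case True
    from C0.pure_vectors_subspace[OF filtration expo[OF True]] True show ?thesis
      by (simp add: U_def W_def Q)
  next
    case False
    have "powI P 2 \<subseteq> P" using powI_mono[OF RI, of "Suc 0" 2] powI_1[OF RI] by auto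
    with False RI show ?thesis by (auto simp: U_def cotangent_subspace_def ring_ideal_def)
  qed
  have mono: "U j \<subseteq> U (Suc j)" if "j < Suc E" for j
  proof (cases "Suc j \<le> E")
    case True
    then show ?thesis using C0.pure_vectors_mono[OF filtration, of j] by (simp add: U_def W_def)
  next
    case False
    then show ?thesis using sub[of j] by (auto simp: U_def cotangent_subspace_def)
  qed
  obtain xs r where xs: "cotangent_independent P xs"
    "set xs \<subseteq> U (Suc E)" "r (Suc E) = length xs" "\<And>i j. i \<le> j \<Longrightarrow> j \<le> Suc E \<Longrightarrow> r i \<le> r j"
    "\<And>j. j \<le> Suc E \<Longrightarrow> U j = cotangent_span P (r j) (\<lambda>i. xs ! i)"
    using flag_basis[OF RI span, of "Suc E" U] sub mono by blast
  have xsP: "set xs \<subseteq> P" using xs(2) by (simp add: U_def)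
  have len: "length xs \<le> d" using cotangent_independent_length[OF RI span xs(1) xsP] .
  define x where "x i = (if i < length xs then xs ! i else 0)" for i
  have ev0: "ev 0 = 0" using ev(3)[of 0] by simp
  have evx: "ev (x i) = 0" for i
  proof (cases "i < length xs")
    case True
    then have "xs ! i \<in> P" using xsP nth_mem by blast
    with True show ?thesis by (simp add: x_def P_eq)
  qed (simp add: x_def ev0)
  have spanx: "cotangent_span P (r j) x = U j" if "j \<le> Suc E" for j
  proof -
    have "r j \<le> length xs" using xs(3) xs(4)[OF that] by simp
    then have "(\<Sum>i<r j. \<iota> (c i) * x i) = (\<Sum>i<r j. \<iota> (c i) * xs ! i)" for c
      by (intro sum.cong) (auto simp: x_def)
    then show ?thesis using xs(5)[OF that] by (simp add: cotangent_span_def)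
  qed
  have "\<exists>c. f - (\<Sum>i<d. \<iota> (c i) * x i) \<in> powI {f. ev f = 0} 2" if "ev f = 0" for f
  proof -
    have "f \<in> cotangent_span P (length xs) x"
      using spanx[of "Suc E"] that xs(3) by (simp add: U_def P_eq)
    then obtain c where c: "f - (\<Sum>i<length xs. \<iota> (c i) * x i) \<in> powI P 2" by (auto simp: cotangent_span_def)
    have "(\<Sum>i<length xs. \<iota> (c i) * x i) = (\<Sum>i<d. \<iota> (c i) * x i)"
      using len by (intro sum.mono_neutral_left) (auto simp: x_def)
    with c show ?thesis by (auto simp: P_eq)
  qed
  then obtain \<phi> where "local_coordinates \<iota> d ev x \<phi>" using coordinates[of x] evx by blast
  then interpret C: closed_point_coordinates \<iota> d ev x \<phi> by (rule closed_point_coordinates.intro)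
  have CQ: "C.Q = P" by (simp add: C.Q_def P_eq)
  have W: "W j = C.pure_vectors \<I> (CHAR('k) ^ j)" for j
    by (simp add: W_def C.pure_vectors_def C0.pure_vectors_def C.Q_def C0.Q_def)
  \<comment> \<open>A list shorter than \<open>d\<close> would leave a zero coordinate, on which the
    dual Hasse--Schmidt derivation would still have first coefficient of value 1.\<close>
  have lend: "length xs = d"
  proof (rule ccontr)
    assume "length xs \<noteq> d"
    then have l: "length xs < d" using len by simp
    then show False using C.hs_dual[OF l l] by (simp add: x_def C.hs_0)
  qed
  have rd: "r j \<le> d" if "j \<le> E" for j using xs(4)[of j "Suc E"] xs(3) that lend by simp
  have pd: "pure_dim \<iota> \<I> P (CHAR('k) ^ j) = r j" if "j \<le> E" for j
    using C.pure_dim_eq[OF filtration expo[OF that] refl rd[OF that]] spanx[of j] that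
    by (simp add: CQ W[symmetric] U_def)
  have adapted: "adapted_coordinates \<iota> d ev x \<phi> \<I> E r" if supp: "\<And>u. u > 0 \<Longrightarrow> level \<I> u \<subseteq> P"
  proof unfold_locales
    show "level \<I> u \<subseteq> C.Q" if "u > 0" for u using supp[OF that] by (simp add: CQ)
    show "r i \<le> r j" if "i \<le> j" "j \<le> E" for i j using xs(4)[of i j] that by simp
    show "\<exists>h\<in>level \<I> (real (CHAR('k) ^ j)). h - x i ^ CHAR('k) ^ j \<in> powI C.Q (Suc (CHAR('k) ^ j))"
      if j: "j \<le> E" and i: "i < r j" for i j
    proof -
      have "(\<Sum>l<r j. \<iota> (if l = i then 1 else 0) * x l) = (\<Sum>l<r j. if l = i then x i else 0)"
        by (rule sum.cong) auto
      then have "x i - (\<Sum>l<r j. \<iota> (if l = i then 1 else 0) * x l) \<in> powI P 2"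
        using i powI_zero[OF RI] by simp
      then have "x i \<in> cotangent_span P (r j) x"
        unfolding cotangent_span_def by (intro CollectI exI[of _ "\<lambda>l. if l = i then 1 else 0"])
      then have "x i \<in> C.pure_vectors \<I> (CHAR('k) ^ j)" using spanx[of j] j by (simp add: U_def W)
      then show ?thesis by (simp add: C.pure_vectors_def)
    qed
    show "c i = 0" if j: "j \<le> E" and f: "f \<in> level \<I> (real (CHAR('k) ^ j))"
      "f - (\<Sum>i<d. \<iota> (c i) * x i) ^ CHAR('k) ^ j \<in> powI C.Q (Suc (CHAR('k) ^ j))"
      and i: "r j \<le> i" "i < d" for j f c i
    proof -
      have "(\<Sum>i<d. \<iota> (c i) * x i) \<in> C.Q"
        by (simp add: C.Q_def C.ev_sum ev evx)
      with f have "(\<Sum>i<d. \<iota> (c i) * x i) \<in> C.pure_vectors \<I> (CHAR('k) ^ j)"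
        by (auto simp: C.pure_vectors_def)
      then have "(\<Sum>i<d. \<iota> (c i) * x i) \<in> cotangent_span P (r j) x"
        using spanx[of j] j by (simp add: U_def W)
      then obtain b where b: "(\<Sum>i<d. \<iota> (c i) * x i) - (\<Sum>i<r j. \<iota> (b i) * x i) \<in> powI P 2"
        by (auto simp: cotangent_span_def)
      define b' where "b' i = (if i < r j then b i else 0)" for i
      have "(\<Sum>i<r j. \<iota> (b i) * x i) = (\<Sum>i<d. \<iota> (b' i) * x i)"
        using rd[OF j] by (intro sum.mono_neutral_cong_left) (auto simp: b'_def)
      with b have "(\<Sum>i<d. \<iota> (c i - b' i) * x i) \<in> powI P 2"
        by (simp add: map_diff left_diff_distrib sum_subtractf)
      moreover have "(\<Sum>i<d. \<iota> (c i - b' i) * x i) = (\<Sum>i<length xs. \<iota> (c i - b' i) * xs ! i)"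
        unfolding lend by (rule sum.cong) (auto simp: x_def lend)
      ultimately have 0: "(\<Sum>i<length xs. \<iota> (c i - b' i) * xs ! i) \<in> powI P 2" by simp
      have "\<And>e. (\<Sum>i<length xs. \<iota> (e i) * xs ! i) \<in> powI P 2 \<Longrightarrow> \<forall>i<length xs. e i = 0"
        using xs(1) unfolding cotangent_independent_def by blast
      from this[OF 0] i lend have "c i - b' i = 0" by blast
      then show ?thesis using i by (simp add: b'_def)
    qed
  qed (use filtration saturated E rd in auto)
  have off: "r j = d" if "u > 0" "\<not> level \<I> u \<subseteq> P" "j \<le> E" for u j
  proof -
    from that obtain f where "f \<in> level \<I> u" "f \<notin> C.Q" by (auto simp: CQ)
    from C.pure_vectors_off_support[OF filtration that(1) this]
    have "C.pure_vectors \<I> (CHAR('k) ^ j) = cotangent_span C.Q d x"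
      using spanx[of "Suc E"] xs(3) lend by (simp add: U_def CQ)
    from C.pure_dim_eq[OF filtration expo[OF that(3)] refl le_refl this] pd[OF that(3)]
    show ?thesis by (simp add: CQ)
  qed
  show thesis
  proof (rule that)
    show "P = {f. ev f = 0}" by (rule P_eq)
    show "pure_dim \<iota> \<I> P (CHAR('k) ^ j) = r j" "r j \<le> d" if "j \<le> E" for j
      using pd[OF that] rd[OF that] .
    show "adapted_coordinates \<iota> d ev x \<phi> \<I> E r" if "\<And>u. u > 0 \<Longrightarrow> level \<I> u \<subseteq> P"
      using that by (rule adapted)
    show "r j = d" if "u > 0" "\<not> level \<I> u \<subseteq> P" "j \<le> E" for u j
      using that by (rule off)
  qed
qed

lemma pure_dim_le:
  assumes "P \<in> max_spec (type_ring :: 'a ring)" "e \<in> exponents TYPE('k)"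
  shows "pure_dim \<iota> \<I> P (CHAR('k) ^ e) \<le> d"
  using adapted_point[OF assms] by (metis le_refl)

text \<open>If \<open>P\<close> is off the support, some function of positive level is nonzero at
  \<open>P\<close>, and wherever it is nonzero all dimensions equal \<open>d\<close>. If
  \<open>P\<close> lies in the support, other points off the support again have the maximal
  dimension \<open>d\<close>, and points of the support are compared by
  \<open>semicontinuity_at\<close>.\<close>

lemma pure_dim_semicontinuous:
  assumes P: "P \<in> max_spec (type_ring :: 'a ring)" and e: "e \<in> exponents TYPE('k)"
  shows "\<exists>g. g \<notin> P \<and> (\<forall>P' \<in> max_spec type_ring. g \<notin> P' \<longrightarrow>
    (\<forall>j<e. pure_dim \<iota> \<I> P' (CHAR('k) ^ j) = pure_dim \<iota> \<I> P (CHAR('k) ^ j)) \<longrightarrow>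
    pure_dim \<iota> \<I> P (CHAR('k) ^ e) \<le> pure_dim \<iota> \<I> P' (CHAR('k) ^ e))"
proof (cases "\<exists>u>0. \<not> level \<I> u \<subseteq> P")
  case True
  then obtain u f where u: "u > 0" "f \<in> level \<I> u" "f \<notin> P" by blast
  have "pure_dim \<iota> \<I> P (CHAR('k) ^ e) \<le> pure_dim \<iota> \<I> P' (CHAR('k) ^ e)"
    if P': "P' \<in> max_spec type_ring" "f \<notin> P'" for P'
  proof -
    have nl: "\<not> level \<I> u \<subseteq> P'" using u P' by blast
    obtain r where "\<And>j. j \<le> e \<Longrightarrow> pure_dim \<iota> \<I> P' (CHAR('k) ^ j) = r j"
      "\<And>u j. u > 0 \<Longrightarrow> \<not> level \<I> u \<subseteq> P' \<Longrightarrow> j \<le> e \<Longrightarrow> r j = d"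
      using adapted_point[OF P'(1) e] by metis
    with nl u(1) pure_dim_le[OF P e] show ?thesis by simp
  qed
  with u show ?thesis by blast
next
  case False
  then have supp: "\<And>u. u > 0 \<Longrightarrow> level \<I> u \<subseteq> P" by blast
  obtain ev x \<phi> r where A: "P = {f. ev f = 0}" "\<And>j. j \<le> e \<Longrightarrow> pure_dim \<iota> \<I> P (CHAR('k) ^ j) = r j"
    "adapted_coordinates \<iota> d ev x \<phi> \<I> e r"
    using adapted_point[OF P e] supp by metis
  from adapted_coordinates.semicontinuity_at[OF A(3)] obtain g where g: "ev g \<noteq> 0"
    "\<And>ev' x' \<phi>' r'. adapted_coordinates \<iota> d ev' x' \<phi>' \<I> e r' \<Longrightarrow> ev' g \<noteq> 0 \<Longrightarrow>
      (\<forall>j<e. r' j = r j) \<Longrightarrow> r e \<le> r' e" by blast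
  have "pure_dim \<iota> \<I> P (CHAR('k) ^ e) \<le> pure_dim \<iota> \<I> P' (CHAR('k) ^ e)"
    if P': "P' \<in> max_spec type_ring" "g \<notin> P'"
      and eq: "\<forall>j<e. pure_dim \<iota> \<I> P' (CHAR('k) ^ j) = pure_dim \<iota> \<I> P (CHAR('k) ^ j)" for P'
  proof -
    obtain ev' x' \<phi>' r' where B: "P' = {f. ev' f = 0}" "\<And>j. j \<le> e \<Longrightarrow> pure_dim \<iota> \<I> P' (CHAR('k) ^ j) = r' j"
      "(\<And>u. u > 0 \<Longrightarrow> level \<I> u \<subseteq> P') \<Longrightarrow> adapted_coordinates \<iota> d ev' x' \<phi>' \<I> e r'"
      "\<And>u j. u > 0 \<Longrightarrow> \<not> level \<I> u \<subseteq> P' \<Longrightarrow> j \<le> e \<Longrightarrow> r' j = d"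
      by (rule adapted_point[OF P'(1) e]) blast
    show ?thesis
    proof (cases "\<exists>u>0. \<not> level \<I> u \<subseteq> P'")
      case True
      then have "r' e = d" using B(4) by blast
      then show ?thesis using B(2)[of e] pure_dim_le[OF P e] by simp
    next
      case False
      have "r e \<le> r' e"
      proof (rule g(2))
        show "adapted_coordinates \<iota> d ev' x' \<phi>' \<I> e r'" using B(3) False by blast
        show "ev' g \<noteq> 0" using P'(2) B(1) by simp
        show "\<forall>j<e. r' j = r j" using eq A(2) B(2) by (metis less_imp_le)
      qed
      then show ?thesis using A(2)[of e] B(2)[of e] by simp
    qed
  qed
  with g(1) A(1) show ?thesis by (intro exI[of _ g]) auto
qed

text \<open>At the first index k where \<open>t\<close> and sigma at \<open>P\<close> differ, sigma
  is smaller. Near \<open>P\<close> the entries up to k either all agree or drop at the first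
  change, and both keep sigma below \<open>t\<close>. Each entry up to k brings its own
  neighbourhood function, and the product of these serves all of them.\<close>

lemma sigma_neighbourhood:
  assumes P: "P \<in> max_spec (type_ring :: 'a ring)" and t: "t \<in> exponents TYPE('k) \<rightarrow>\<^sub>E (UNIV :: nat set)"
    and not_le: "\<not> lex_le t (sigma \<iota> d \<I> P)"
  shows "\<exists>g. g \<notin> P \<and> (\<forall>P' \<in> max_spec type_ring. g \<notin> P' \<longrightarrow> \<not> lex_le t (sigma \<iota> d \<I> P'))"
proof -
  define s where "s P = sigma \<iota> d \<I> P" for P
  have s: "s P e = d - pure_dim \<iota> \<I> P (CHAR('k) ^ e)" if "e \<in> exponents TYPE('k)" for P e
    using that by (simp add: s_def sigma_def)
  have "t \<noteq> s P" and nl: "\<not> less_fun t (s P)" using not_le by (auto simp: lex_le_def s_def)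
  then have "\<exists>k. t k \<noteq> s P k" by auto
  then obtain k where k: "t k \<noteq> s P k" and below: "\<And>j. j < k \<Longrightarrow> t j = s P j"
    using exists_least_iff[of "\<lambda>k. t k \<noteq> s P k"] by blast
  \<comment> \<open>Outside the exponents both sequences take the value \<open>undefined\<close>, so
    they cannot differ there.\<close>
  have kE: "k \<in> exponents TYPE('k)"
  proof (rule ccontr)
    assume "k \<notin> exponents TYPE('k)"
    then have "t k = s P k" using t by (auto simp: PiE_def extensional_def s_def sigma_def)
    with k show False by simp
  qed
  have expo: "j \<in> exponents TYPE('k)" if "j \<le> k" for j
    using kE that by (auto simp: exponents_def split: if_splits)
  have less: "s P k < t k"
    using nl k below unfolding less_fun_def by (metis linorder_neqE_nat)
  have "\<forall>j. \<exists>g. j \<le> k \<longrightarrow> g \<notin> P \<and> (\<forall>P' \<in> max_spec type_ring. g \<notin> P' \<longrightarrow>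
    (\<forall>i<j. pure_dim \<iota> \<I> P' (CHAR('k) ^ i) = pure_dim \<iota> \<I> P (CHAR('k) ^ i)) \<longrightarrow>
    pure_dim \<iota> \<I> P (CHAR('k) ^ j) \<le> pure_dim \<iota> \<I> P' (CHAR('k) ^ j))"
    using pure_dim_semicontinuous[OF P expo] by blast
  then obtain g where g: "\<And>j. j \<le> k \<Longrightarrow> g j \<notin> P"
    "\<And>j P'. j \<le> k \<Longrightarrow> P' \<in> max_spec type_ring \<Longrightarrow> g j \<notin> P' \<Longrightarrow>
      (\<And>i. i < j \<Longrightarrow> pure_dim \<iota> \<I> P' (CHAR('k) ^ i) = pure_dim \<iota> \<I> P (CHAR('k) ^ i)) \<Longrightarrow>
      pure_dim \<iota> \<I> P (CHAR('k) ^ j) \<le> pure_dim \<iota> \<I> P' (CHAR('k) ^ j)" by metis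
  define h where "h = (\<Prod>j\<le>k. g j)"
  have "(\<Prod>j\<in>S. g j) \<notin> P" if "finite S" "S \<subseteq> {..k}" for S
    using that
  proof (induction S rule: finite_induct)
    case empty
    then show ?case using max_spec_prime[OF P] by (simp add: prime_in_def)
  next
    case (insert j S)
    then show ?case using max_spec_prime[OF P] g(1)[of j] by (auto simp: prime_in_def)
  qed
  then have "h \<notin> P" by (simp add: h_def)
  moreover have "\<not> lex_le t (s P')" if P': "P' \<in> max_spec type_ring" "h \<notin> P'" for P'
  proof -
    have gP': "g j \<notin> P'" if "j \<le> k" for j
    proof
      assume "g j \<in> P'"
      moreover have "h = (\<Prod>i\<in>{..k} - {j}. g i) * g j"
        unfolding h_def using that by (subst prod.remove[of _ j]) (auto simp: mult.commute)
      ultimately have "h \<in> P'" using max_spec_prime[OF P'(1)] by (simp add: prime_in_def)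
      with P'(2) show False by simp
    qed
    have "less_fun (s P') t"
    proof (cases "\<exists>j\<le>k. s P' j \<noteq> s P j")
      case False
      then have "s P' k < t k" "\<And>j. j < k \<Longrightarrow> s P' j = t j" using less below by auto
      then show ?thesis unfolding less_fun_def by blast
    next
      case True
      then obtain j where j: "j \<le> k" "s P' j \<noteq> s P j" and eq: "\<And>i. i < j \<Longrightarrow> s P' i = s P i"
        using exists_least_iff[of "\<lambda>j. j \<le> k \<and> s P' j \<noteq> s P j"] by (metis less_imp_le order_trans)
      have "pure_dim \<iota> \<I> P (CHAR('k) ^ j) \<le> pure_dim \<iota> \<I> P' (CHAR('k) ^ j)"
      proof (rule g(2)[OF j(1) P'(1) gP'[OF j(1)]])
        fix i assume i: "i < j"
        then have i': "i \<in> exponents TYPE('k)" using j(1) expo by simp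
        \<comment> \<open>Equal differences from \<open>d\<close> give equal dimensions because
          neither dimension exceeds \<open>d\<close>, so that the subtraction is not
          truncated.\<close>
        show "pure_dim \<iota> \<I> P' (CHAR('k) ^ i) = pure_dim \<iota> \<I> P (CHAR('k) ^ i)"
          using eq[OF i] s[OF i'] pure_dim_le[OF P i'] pure_dim_le[OF P'(1) i'] by simp
      qed
      then have "s P' j \<le> s P j" using s[OF expo[OF j(1)]] by simp
      with j(2) have "s P' j < s P j" by simp
      moreover have "s P j \<le> t j" using j(1) below[of j] less by (cases "j = k") auto
      moreover have "s P' i = t i" if "i < j" for i using eq[OF that] below[of i] that j(1) by simp
      ultimately show ?thesis unfolding less_fun_def by (metis less_le_trans)
    qed
    then show ?thesis unfolding lex_le_def using less_fun_asym by blast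
  qed
  ultimately show ?thesis unfolding s_def by blast
qed

lemma closedin_sigma:
  assumes t: "t \<in> exponents TYPE('k) \<rightarrow>\<^sub>E (UNIV :: nat set)"
  shows "closedin (zariski_max_spec type_ring) {P \<in> max_spec type_ring. lex_le t (sigma \<iota> d \<I> P)}"
proof -
  define C where "C = {P \<in> max_spec (type_ring :: 'a ring). lex_le t (sigma \<iota> d \<I> P)}"
  \<comment> \<open>A point outside C has a function \<open>g\<close> that is nonzero there and lies
    in every member of C, hence in their intersection.\<close>
  have "C = {P \<in> max_spec type_ring. \<Inter>C \<subseteq> P}"
    using sigma_neighbourhood[OF _ t] unfolding C_def by blast
  then show ?thesis
    unfolding cring.closedin_zariski_max_spec[OF cring_from_type_algebra] C_def[symmetric] by auto
qed

end

theorem proposition1p2p2p1: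
  fixes \<iota> :: "'k :: alg_closed_field \<Rightarrow> 'a :: idom"
    and d :: nat
    and \<I> :: "('a \<times> real) set"
  assumes "nonsingular_affine_variety \<iota> d"
    and "idealistic_filtration type_ring \<I>"
    and "D_saturated \<iota> \<I>"
  shows "\<forall>t \<in> exponents TYPE('k) \<rightarrow>\<^sub>E (UNIV :: nat set).
    closedin (zariski_max_spec type_ring)
      {P \<in> max_spec type_ring. lex_le t (sigma \<iota> d \<I> P)}"
proof -
  interpret saturated_filtration \<iota> d \<I>
    using assms by (intro saturated_filtration.intro saturated_filtration_axioms.intro)
  show ?thesis using closedin_sigma by blast
qed

end
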